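(* Let $-A$ be the generator of a bounded $C_0$-semigroup $(T(t))_{t\ge 0}$ on a Banach space $X$ such that $i\mathbb{R}\subset\rho(A)$. Let $\ell$ be a slowly varying function on $\mathbb{R}_+$, let $\alpha>0$ and $\beta\in(0,1]$. Assume that $g:s\mapsto s^{1-\beta}\ell(s)$ is increasing. The following statements are equivalent: (i) $\displaystyle\|(is+A)^{-1}\|=O\left(\frac{|s|^{\alpha}}{\ell(|s|)}\right)$ as $|s|\to\infty$ ($s\in\mathbb{R}$); (ii) $\displaystyle\sup_{z\in\mathbb{C}_+}\|(z+A)^{-1}W_{\alpha,\beta,\ell}(A)\|<\infty$.
   Context: $\mathbb{R}_+=[0,\infty)$ and $\mathbb{C}_+=\{z:\operatorname{Re}z>0\}$. A strictly positive measurable function $\ell$ is slowly varying if $\lim_{s\to\infty}\ell(\lambda s)/\ell(s)=1$ for every $\lambda>0$. "Increasing" means non-decreasing. Here $A$ is a sectorial invertible operator and $A^{\gamma}$ ($\gamma\in\mathbb{R}$) are its usual fractional powers. The bounded operator $W_{\alpha,\beta,\ell}(A)$ is defined as follows. For $\alpha\ge\beta$, $$W_{\alpha,\beta,\ell}(A)=A^{-(\alpha-\beta)}S_g(A),\qquad S_g(A)=\int_0^\infty (s+A)^{-2}s^{1-\beta}\ell(s)\,ds,$$ which corresponds to the Stieltjes function $S_g(\lambda)=\int_{0}^{\infty}\frac{s^{1-\beta}\ell(s)}{(s+\lambda)^2}\,ds$ associated with $g$ (in Stieltjes-integral form, $S_g(A)=\int (s+A)^{-1}\,d(s^{1-\beta}\ell(s))$).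 For $0<\alpha<\beta$, $$W_{\alpha,\beta,\ell}(A)=\int_0^\infty A^{\beta-\alpha}(s+A)^{-2}s^{1-\beta}\ell(s)\,ds.$$ These integrals converge absolutely in operator norm. *)

theory Defs
  imports "HOL-Analysis.Analysis" "HOL-Library.Landau_Symbols"
begin

class complex_normed_vector = real_normed_vector +
  fixes scaleC :: "complex \<Rightarrow> 'a \<Rightarrow> 'a"  (infixr \<open>*\<^sub>C\<close> 75)
  assumes scaleC_add_right: "z *\<^sub>C (x + y) = z *\<^sub>C x + z *\<^sub>C y"
    and scaleC_add_left: "(z + w) *\<^sub>C x = z *\<^sub>C x + w *\<^sub>C x"
    and scaleC_scaleC: "z *\<^sub>C (w *\<^sub>C x) = (z * w) *\<^sub>C x"
    and scaleC_of_real: "complex_of_real r *\<^sub>C x = r *\<^sub>R x"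
    and norm_scaleC: "norm (z *\<^sub>C x) = cmod z * norm x"

class complex_banach = complex_normed_vector + banach

instantiation complex :: complex_banach
begin

definition scaleC_complex :: "complex \<Rightarrow> complex \<Rightarrow> complex"
  where "scaleC_complex z w = z * w"

instance
  by standard
    (simp_all add: scaleC_complex_def algebra_simps norm_mult scaleR_conv_of_real)

end

text \<open>
  A bounded operator is an element of the Banach space of bounded real-linear maps, with
  complex linearity as an extra condition; its norm there is its usual operator norm.
\<close>

definition clinear_op :: "('a::complex_normed_vector \<Rightarrow>\<^sub>L 'a) \<Rightarrow> bool"
  where "clinear_op B \<longleftrightarrow> (\<forall>z x. blinfun_apply B (z *\<^sub>C x) = z *\<^sub>C blinfun_apply B x)"

text \<open>
  An unbounded operator is identified with its graph, so that its domain is \<open>Domain\<close>,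
  its inverse is the converse relation, and the product \<open>A B\<close> is \<open>B O A\<close>.
\<close>

definition op_graph :: "('a::complex_normed_vector \<Rightarrow>\<^sub>L 'a) \<Rightarrow> ('a \<times> 'a) set"
  where "op_graph B = {(x, blinfun_apply B x) | x. True}"

definition bounded_op_of :: "('a \<times> 'a) set \<Rightarrow> ('a::complex_normed_vector \<Rightarrow>\<^sub>L 'a)"
  where "bounded_op_of R = (THE B. op_graph B = R)"

lemma op_graph_inject: "op_graph B = op_graph C \<longleftrightarrow> B = C"
proof
  assume eq: "op_graph B = op_graph C"
  show "B = C"
  proof (rule blinfun_eqI)
    fix x
    have "(x, blinfun_apply B x) \<in> op_graph C"
      unfolding eq[symmetric] by (auto simp: op_graph_def)
    then show "blinfun_apply B x = blinfun_apply C x"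
      by (auto simp: op_graph_def)
  qed
qed simp

lemma bounded_op_of_op_graph [simp]: "bounded_op_of (op_graph B) = B"
  by (simp add: bounded_op_of_def op_graph_inject)

definition op_uminus :: "('a \<times> 'a) set \<Rightarrow> ('a::complex_normed_vector \<times> 'a) set"
  where "op_uminus A = {(x, - y) | x y. (x, y) \<in> A}"

text \<open>The operator \<open>z + A\<close>, with the domain of \<open>A\<close>.\<close>

definition op_shift :: "complex \<Rightarrow> ('a \<times> 'a) set \<Rightarrow> ('a::complex_normed_vector \<times> 'a) set"
  where "op_shift z A = {(x, z *\<^sub>C x + y) | x y. (x, y) \<in> A}"

definition resolvent_set :: "('a::complex_normed_vector \<times> 'a) set \<Rightarrow> complex set"
  where "resolvent_set A =
    {z. \<exists>B. clinear_op B \<and> op_graph B = (op_shift z (op_uminus A))\<inverse>}"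

text \<open>The bounded operator \<open>(z + A)\<^sup>-\<^sup>1\<close>, meaningful when \<open>- z\<close> is in the resolvent set of \<open>A\<close>.\<close>

definition shift_inv :: "('a \<times> 'a) set \<Rightarrow> complex \<Rightarrow> ('a::complex_normed_vector \<Rightarrow>\<^sub>L 'a)"
  where "shift_inv A z = bounded_op_of ((op_shift z A)\<inverse>)"

definition bounded_C0_semigroup :: "(real \<Rightarrow> ('a::complex_banach \<Rightarrow>\<^sub>L 'a)) \<Rightarrow> bool"
  where "bounded_C0_semigroup T \<longleftrightarrow>
    (\<forall>t\<ge>0. clinear_op (T t)) \<and>
    T 0 = id_blinfun \<and>
    (\<forall>s\<ge>0. \<forall>t\<ge>0. T (s + t) = T s o\<^sub>L T t) \<and>
    (\<forall>x. continuous_on {0..} (\<lambda>t. blinfun_apply (T t) x)) \<and>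
    (\<exists>M. \<forall>t\<ge>0. norm (T t) \<le> M)"

definition C0_generator :: "(real \<Rightarrow> ('a::complex_banach \<Rightarrow>\<^sub>L 'a)) \<Rightarrow> ('a \<times> 'a) set"
  where "C0_generator T =
    {(x, y). ((\<lambda>t. (blinfun_apply (T t) x - x) /\<^sub>R t) \<longlongrightarrow> y) (at_right 0)}"

definition slowly_varying :: "(real \<Rightarrow> real) \<Rightarrow> bool"
  where "slowly_varying l \<longleftrightarrow>
    (\<forall>s\<ge>0. l s > 0) \<and>
    l \<in> borel_measurable (restrict_space borel {0..}) \<and>
    (\<forall>c>0. ((\<lambda>s. l (c * s) / l s) \<longlongrightarrow> 1) at_top)"

text \<open>
  Operator-valued integrals are gauge integrals in the Banach space of bounded operators
  (the Bochner integral of the library needs separable values). All the integrals below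
  converge absolutely in operator norm for sectorial invertible \<open>A\<close>.

  For a sectorial invertible operator, \<open>A\<^sup>-\<^sup>\<theta>\<close> with \<open>0 < \<theta> < 1\<close> is given by Balakrishnan's
  formula, \<open>A\<^sup>-\<^sup>c = A\<^sup>-\<^sup>n A\<^sup>-\<^sup>\<theta>\<close> for \<open>c = n + \<theta> \<ge> 0\<close> with integer part \<open>n\<close>, and positive
  powers are the (in general unbounded) inverses of the negative ones.
\<close>

definition neg_power :: "('a \<times> 'a) set \<Rightarrow> real \<Rightarrow> ('a::complex_banach \<Rightarrow>\<^sub>L 'a)"
  where "neg_power A c =
    ((\<lambda>B. shift_inv A 0 o\<^sub>L B) ^^ nat \<lfloor>c\<rfloor>)
      (if frac c = 0 then id_blinfun
       else (sin (pi * frac c) / pi) *\<^sub>R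
         integral {0..} (\<lambda>s. s powr (- frac c) *\<^sub>R shift_inv A (complex_of_real s)))"

definition op_power :: "('a \<times> 'a) set \<Rightarrow> real \<Rightarrow> ('a::complex_banach \<times> 'a) set"
  where "op_power A c =
    (if c \<le> 0 then op_graph (neg_power A (- c)) else (op_graph (neg_power A c))\<inverse>)"

text \<open>
  The function \<open>s \<mapsto> s\<^sup>1\<^sup>-\<^sup>\<beta> l(s)\<close>. The case distinction gives \<open>0\<^sup>0 = 1\<close> for \<open>\<beta> = 1\<close>,
  whereas \<open>0 powr 0 = 0\<close>.
\<close>

definition g_fun :: "real \<Rightarrow> (real \<Rightarrow> real) \<Rightarrow> real \<Rightarrow> real"
  where "g_fun \<beta> l s = (if \<beta> = 1 then l s else s powr (1 - \<beta>) * l s)"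

definition S_op :: "(real \<Rightarrow> real) \<Rightarrow> ('a \<times> 'a) set \<Rightarrow> ('a::complex_banach \<Rightarrow>\<^sub>L 'a)"
  where "S_op g A =
    integral {0..} (\<lambda>s. g s *\<^sub>R (shift_inv A (complex_of_real s) o\<^sub>L shift_inv A (complex_of_real s)))"

definition W_op ::
    "real \<Rightarrow> real \<Rightarrow> (real \<Rightarrow> real) \<Rightarrow> ('a \<times> 'a) set \<Rightarrow> ('a::complex_banach \<Rightarrow>\<^sub>L 'a)"
  where "W_op \<alpha> \<beta> l A =
    (if \<alpha> \<ge> \<beta> then
       bounded_op_of (op_power A (- (\<alpha> - \<beta>))) o\<^sub>L S_op (g_fun \<beta> l) A
     else
       integral {0..} (\<lambda>s. g_fun \<beta> l s *\<^sub>R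
         bounded_op_of
           (op_graph (shift_inv A (complex_of_real s) o\<^sub>L shift_inv A (complex_of_real s))
              O op_power A (\<beta> - \<alpha>))))"

end

theory Submission
  imports Defs
begin

text \<open>
  Write \<open>R(z) = (z + A)\<^sup>-\<^sup>1\<close> for \<open>Re z \<ge> 0\<close>. Although \<open>W\<close> is a function of \<open>A\<close>, on the imaginary axis it acts on
  the resolvent like a number, up to a bounded error:
  \<open>R(is) W = m(s) R(is) + O(1)\<close>, where \<open>\<bar>m(s)\<bar>\<close> is comparable to \<open>l(\<bar>s\<bar>) / \<bar>s\<bar>\<^sup>\<alpha>\<close>. Such an \<open>m\<close> is called a symbol of
  \<open>W\<close> below (\<open>has_symbol\<close>, \<open>has_symbol_W_op\<close>). Hence \<open>R(is) W\<close> is bounded for large \<open>\<bar>s\<bar>\<close> exactly if \<open>m(s) R(is)\<close> is,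
  which is statement (i); and the resolvent identity
  \<open>R(a + is) W = (1 - a R(a + is)) R(is) W\<close> with \<open>\<parallel>a R(a + is)\<parallel> \<le> M\<close> carries bounds between the imaginary axis and the
  right half-plane (\<open>has_symbol_bounded_iff\<close>).

  Symbols come from partial fractions. In \<open>R(z) R(r) = (R(z) - R(r)) / (r - z)\<close> and in the corresponding formula for
  \<open>R(z) R(r)\<^sup>2\<close>, the coefficient of \<open>R(z)\<close>, integrated against a weight over \<open>r > 0\<close>, is the symbol, while
  the remaining terms contain only \<open>R(r)\<close> for \<open>r > 0\<close>, whose norm is \<open>O(1 / (1 + r))\<close>, and their integrals are
  bounded uniformly in \<open>z = is\<close>, \<open>\<bar>s\<bar> \<ge> 1\<close>. Thus the negative power \<open>A\<^sup>-\<^sup>\<theta>\<close>, \<open>0 < \<theta> < 1\<close>, has the symbol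
  \<open>c \<integral> r\<^sup>-\<^sup>\<theta> / (r - is) dr\<close> and \<open>\<integral> g(r) R(r)\<^sup>2 dr\<close> has the symbol \<open>\<integral> g(r) / (r - is)\<^sup>2 dr\<close>; symbols of products are
  products. Only the size of these integrals matters, and their lower bounds are immediate because
  the imaginary parts of both integrands have constant sign. The upper bound for the second integral is where
  slow variation enters: a monotone \<open>g\<close> with \<open>g(2s) / g(s) \<rightarrow> 2\<^bsup>1-\<beta>\<^esup>\<close> grows more slowly than \<open>s\<^sup>\<eta>\<close> for every
  \<open>\<eta> > 1 - \<beta>\<close>, uniformly in the starting point (\<open>potter_bound\<close>).

  If \<open>\<alpha> < \<beta>\<close>, the integrand of \<open>W\<close> contains the unbounded \<open>A\<^sup>\<gamma>\<close>, \<open>\<gamma> = \<beta> - \<alpha>\<close>, the inverse of \<open>A\<^sup>-\<^sup>\<gamma>\<close>. It is made explicit by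
  \<open>Q\<^sub>\<gamma> Q\<^bsub>1-\<gamma>\<^esub> = \<kappa> A\<^sup>-\<^sup>1\<close> with some \<open>\<kappa> > 0\<close>, where \<open>Q\<^sub>\<theta> = \<integral> r\<^sup>-\<^sup>\<theta> R(r) dr\<close> (\<open>Q_product\<close>): then \<open>A\<^sup>\<gamma> R(r)\<close> is a positive multiple of
  \<open>Q\<^bsub>1-\<gamma>\<^esub> A R(r) = Q\<^bsub>1-\<gamma>\<^esub> (1 - r R(r))\<close>, and this operator satisfies the same partial fraction formulas as \<open>R(r)\<close>.
  To avoid interchanging operator-valued double integrals, the product formula is derived from a linear
  differential equation in the parameter \<open>a\<close> for \<open>A + a\<close> in place of \<open>A\<close>.
\<close>

section \<open>Integrals of Banach-space-valued functions over the half-line\<close>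

text \<open>
  The space of operators need not be separable, so integrability has to be proved for gauge integrals of functions
  with values in an arbitrary Banach space. Riemann sums of \<open>f - G\<close> are dominated by Riemann sums of \<open>k\<close>, so the
  Cauchy criterion passes from \<open>G\<close> to \<open>f\<close>.
\<close>

lemma integrable_L1_approximable:
  fixes f :: "real \<Rightarrow> 'b::banach"
  assumes "\<And>e. e > 0 \<Longrightarrow> \<exists>G k. G integrable_on {a..b} \<and> k integrable_on {a..b} \<and>
      (\<forall>x\<in>{a..b}. norm (f x - G x) \<le> k x) \<and> integral {a..b} k < e"
  shows "f integrable_on {a..b}"
proof -
  have "f integrable_on cbox a b"
    unfolding integrable_Cauchy
  proof (intro allI impI)
    fix e :: real assume e: "e > 0"
    obtain G k where G: "G integrable_on {a..b}" and k: "k integrable_on {a..b}"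
      and le: "\<And>x. x \<in> {a..b} \<Longrightarrow> norm (f x - G x) \<le> k x" and small: "integral {a..b} k < e / 6"
      using assms[of "e/6"] e by auto
    obtain \<gamma>1 where \<gamma>1: "gauge \<gamma>1" "\<And>D. D tagged_division_of cbox a b \<Longrightarrow> \<gamma>1 fine D \<Longrightarrow>
        norm ((\<Sum>(x,K)\<in>D. measure lborel K *\<^sub>R G x) - integral {a..b} G) < e / 6"
      using G[THEN integrable_integral] e unfolding has_integral[of G] has_integral
      by (metis box_real(2) divide_pos_pos has_integral zero_less_numeral)
    obtain \<gamma>2 where \<gamma>2: "gauge \<gamma>2" "\<And>D. D tagged_division_of cbox a b \<Longrightarrow> \<gamma>2 fine D \<Longrightarrow>
        norm ((\<Sum>(x,K)\<in>D. measure lborel K *\<^sub>R k x) - integral {a..b} k) < e / 6"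
      using k[THEN integrable_integral] e 
      by (metis box_real(2) divide_pos_pos has_integral zero_less_numeral)
    have close: "norm ((\<Sum>(x,K)\<in>D. measure lborel K *\<^sub>R f x) - integral {a..b} G) < e / 2"
      if D: "D tagged_division_of cbox a b" and fine: "\<gamma>1 fine D" "\<gamma>2 fine D" for D
    proof -
      have "norm ((\<Sum>(x,K)\<in>D. measure lborel K *\<^sub>R f x) - (\<Sum>(x,K)\<in>D. measure lborel K *\<^sub>R G x))
          = norm (\<Sum>(x,K)\<in>D. measure lborel K *\<^sub>R (f x - G x))"
        by (simp add: sum_subtractf[symmetric] split_beta scaleR_right_diff_distrib)
      also have "\<dots> \<le> (\<Sum>(x,K)\<in>D. measure lborel K *\<^sub>R k x)"
      proof (rule sum_norm_le)
        fix p assume p: "p \<in> D"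
        obtain x K where xK: "p = (x, K)" by force
        then have "x \<in> {a..b}"
          using tagged_division_ofD(2,3)[OF D, of x K] p by auto
        then show "norm (case p of (x, K) \<Rightarrow> measure lborel K *\<^sub>R (f x - G x)) \<le> (case p of (x, K) \<Rightarrow> measure lborel K *\<^sub>R k x)"
          unfolding xK by (auto intro!: mult_left_mono le)
      qed
      also have "\<dots> < e / 3"
        using \<gamma>2(2)[OF D fine(2)] small unfolding real_norm_def real_scaleR_def by linarith
      finally show ?thesis
        using \<gamma>1(2)[OF D fine(1)] by norm
    qed
    show "\<exists>\<gamma>. gauge \<gamma> \<and> (\<forall>\<D>1 \<D>2. \<D>1 tagged_division_of cbox a b \<and> \<gamma> fine \<D>1 \<and>
        \<D>2 tagged_division_of cbox a b \<and> \<gamma> fine \<D>2 \<longrightarrow>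
        norm ((\<Sum>(x,K)\<in>\<D>1. measure lborel K *\<^sub>R f x) - (\<Sum>(x,K)\<in>\<D>2. measure lborel K *\<^sub>R f x)) < e)"
    proof (intro exI conjI allI impI)
      show "gauge (\<lambda>x. \<gamma>1 x \<inter> \<gamma>2 x)" using \<gamma>1(1) \<gamma>2(1) by (rule gauge_Int)
    next
      fix D1 D2
      assume "D1 tagged_division_of cbox a b \<and> (\<lambda>x. \<gamma>1 x \<inter> \<gamma>2 x) fine D1 \<and>
        D2 tagged_division_of cbox a b \<and> (\<lambda>x. \<gamma>1 x \<inter> \<gamma>2 x) fine D2"
      then have "norm ((\<Sum>(x,K)\<in>D1. measure lborel K *\<^sub>R f x) - integral {a..b} G) < e / 2"
        "norm ((\<Sum>(x,K)\<in>D2. measure lborel K *\<^sub>R f x) - integral {a..b} G) < e / 2"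
        using close[of D1] close[of D2] unfolding fine_Int by blast+
      then show "norm ((\<Sum>(x,K)\<in>D1. measure lborel K *\<^sub>R f x) - (\<Sum>(x,K)\<in>D2. measure lborel K *\<^sub>R f x)) < e"
        by norm
    qed
  qed
  then show ?thesis by simp
qed

text \<open>
  A possible singularity at the end point \<open>0\<close> is removed by cutting \<open>f\<close> off near \<open>0\<close>: the error is controlled by
  the integral of \<open>h\<close> over a short interval.
\<close>

lemma integrable_right_of_zero:
  fixes f :: "real \<Rightarrow> 'b::banach"
  assumes loc: "\<And>a b. 0 < a \<Longrightarrow> f integrable_on {a..b}"
    and h: "h integrable_on {0..b}" and le: "\<And>x. x > 0 \<Longrightarrow> norm (f x) \<le> h x"
  shows "f integrable_on {0..b}"
proof (cases "b > 0")
  case False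
  then show ?thesis using integrable_on_refl[of f 0] by (cases "b = 0") auto
next
  case b: True
  define f0 where "f0 = (\<lambda>x. if x = 0 then 0 else f x)"
  define h0 where "h0 = (\<lambda>x. if x = 0 then 0 else h x)"
  have h0: "h0 integrable_on {0..b}"
    by (rule integrable_spike[OF h, of "{0}"]) (auto simp: h0_def)
  have "f0 integrable_on {0..b}"
  proof (rule integrable_L1_approximable)
    fix e :: real assume e: "e > 0"
    have "continuous_on {0..b} (\<lambda>x. integral {0..x} h0)"
      by (rule indefinite_integral_continuous_1[OF h0])
    then obtain d where d: "d > 0" "\<And>x. x \<in> {0..b} \<Longrightarrow> dist x 0 < d \<Longrightarrow> dist (integral {0..x} h0) (integral {0..0} h0) < e"
      using e b unfolding continuous_on_iff by (metis atLeastAtMost_iff less_eq_real_def)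
    define c where "c = min (d/2) b"
    have c: "c > 0" "c \<le> b" "c < d" using d b by (auto simp: c_def)
    have small: "integral {0..c} h0 < e"
      using d(2)[of c] c by (auto simp: dist_real_def)
    let ?G = "\<lambda>x. if x \<in> {c..b} then f x else 0"
    let ?k = "\<lambda>x. if x \<in> {0..c} then h0 x else 0"
    have "?G integrable_on {0..b}"
      using loc[OF c(1), of b] c by (subst integrable_restrict_Int) (auto simp: Int_absorb2)
    moreover have kI: "h0 integrable_on {0..c}"
      using h0 c by (auto intro: integrable_subinterval_real)
    then have "?k integrable_on {0..b}"
      using c by (subst integrable_restrict_Int) (auto simp: Int_absorb2)
    moreover have "integral {0..b} ?k = integral {0..c} h0"
      using c by (subst integral_restrict_Int) (auto simp: Int_absorb2)
    moreover have "\<forall>x\<in>{0..b}. norm (f0 x - ?G x) \<le> ?k x"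
      using le c by (auto simp: f0_def h0_def intro: order_trans[OF norm_ge_zero le])
    ultimately show "\<exists>G k. G integrable_on {0..b} \<and> k integrable_on {0..b} \<and>
      (\<forall>x\<in>{0..b}. norm (f0 x - G x) \<le> k x) \<and> integral {0..b} k < e"
      using small by (intro exI[of _ ?G] exI[of _ ?k]) simp
  qed
  then show ?thesis
    by (rule integrable_spike[of _ _ "{0}"]) (auto simp: f0_def)
qed

text \<open>
  The source of all operator-valued integrals below. The third part expresses the integral as an improper one,
  which gives access to the fundamental theorem of calculus.
\<close>

lemma dominated_integrable:
  fixes f :: "real \<Rightarrow> 'b::banach"
  assumes loc: "\<And>a b. 0 < a \<Longrightarrow> f integrable_on {a..b}"
    and h: "h integrable_on {0..}" and le: "\<And>x. x > 0 \<Longrightarrow> norm (f x) \<le> h x"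
  shows "f integrable_on {0..}"
    and "norm (integral {0..} f) \<le> integral {0..} h"
    and "(\<lambda>n. integral {inverse (Suc n)..Suc n} f) \<longlonglongrightarrow> integral {0..} f"
proof -
  define f0 where "f0 = (\<lambda>x. if x = 0 then 0 else f x)"
  define h0 where "h0 = (\<lambda>x. if x = 0 then 0 else h x)"
  have h0: "h0 integrable_on {0..}"
    by (rule integrable_spike[OF h, of "{0}"]) (auto simp: h0_def)
  have le0: "norm (f0 x) \<le> h0 x" if "x \<ge> 0" for x
    using that le by (auto simp: f0_def h0_def)
  have loc0: "f0 integrable_on {a..b}" if "a \<ge> 0" for a b
  proof (cases "a = 0")
    case True
    have "h integrable_on {0..b}"
      using h by (rule integrable_on_subinterval) auto
    then have "f integrable_on {0..b}" by (intro integrable_right_of_zero[OF loc _ le])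
    then show ?thesis unfolding True
      by (rule integrable_spike[of _ _ "{0}"]) (auto simp: f0_def)
  next
    case False
    then have "f integrable_on {a..b}" using loc that by auto
    then show ?thesis
      by (rule integrable_spike[of _ _ "{0}"]) (auto simp: f0_def)
  qed
  have int0: "f0 integrable_on {0..}"
  proof (rule integrable_on_all_intervals_integrable_bound[OF _ _ h0])
    fix a b :: real
    have "{0..} \<inter> {a..b} = {max a 0..b}" by auto
    then show "(\<lambda>x. if x \<in> {0..} then f0 x else 0) integrable_on cbox a b"
      using loc0[of "max a 0" b] by (simp only: box_real integrable_restrict_Int)
  qed (use le0 in auto)
  then show int: "f integrable_on {0..}"
    by (rule integrable_spike[of _ _ "{0}"]) (auto simp: f0_def)
  have eqf: "integral S f0 = integral S f" and eqh: "integral S h0 = integral S h" for S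
    by (rule integral_spike[of "{0}"]; auto simp: f0_def h0_def)+
  have "norm (integral {0..} f0) \<le> integral {0..} h0"
    by (rule integral_norm_bound_integral[OF int0 h0]) (use le0 in auto)
  then show "norm (integral {0..} f) \<le> integral {0..} h" by (simp add: eqf eqh)
  define J where "J n = {inverse (real (Suc n))..real (Suc n)}" for n
  have J: "J n \<subseteq> {0..}" for n by (auto simp: J_def intro: order_trans[rotated])
  have intJ: "u integrable_on J n" if "u integrable_on {0..}" for n and u :: "real \<Rightarrow> 'c::banach"
    unfolding J_def by (rule integrable_on_subinterval[OF that]) (use J[of n] in \<open>simp add: J_def\<close>)
  have inJ: "eventually (\<lambda>n. x \<in> J n) sequentially" if x: "x > 0" for x
  proof -
    obtain N where N: "real N > max x (inverse x)" using reals_Archimedean2 by blast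
    show ?thesis
    proof (rule eventually_sequentiallyI[of N])
      fix n assume "N \<le> n"
      then have *: "real (Suc n) \<ge> x" "real (Suc n) > inverse x" using N by auto
      have "inverse (real (Suc n)) < inverse (inverse x)"
        using * x by (intro less_imp_inverse_less) auto
      then show "x \<in> J n" using * by (simp add: J_def)
    qed
  qed
  have "(\<lambda>n. integral {0..} (\<lambda>x. if x \<in> J n then h0 x else 0)) \<longlonglongrightarrow> integral {0..} h0"
  proof (rule dominated_convergence(2)[OF _ h0])
    show "(\<lambda>x. if x \<in> J n then h0 x else 0) integrable_on {0..}" for n
      using intJ[OF h0] J[of n] by (simp only: integrable_restrict_Int Int_absorb2)
    show "norm (if x \<in> J n then h0 x else 0) \<le> h0 x" if "x \<in> {0..}" for n x
      using order_trans[OF norm_ge_zero le0, of x] that by auto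
    show "(\<lambda>n. if x \<in> J n then h0 x else 0) \<longlonglongrightarrow> h0 x" if "x \<in> {0..}" for x
    proof (cases "x = 0")
      case True
      then have "h0 x = 0" by (simp add: h0_def)
      then show ?thesis by (simp cong: if_cong)
    next
      case False
      then have "eventually (\<lambda>n. x \<in> J n) sequentially" using inJ that by auto
      then show ?thesis by (rule tendsto_eventually[OF eventually_mono]) auto
    qed
  qed
  then have "(\<lambda>n. integral (J n) h0) \<longlonglongrightarrow> integral {0..} h0"
    by (simp only: integral_restrict_Int Int_absorb2[OF J])
  then have lim0: "(\<lambda>n. integral {0..} h0 - integral (J n) h0) \<longlonglongrightarrow> 0"
    using tendsto_diff[OF tendsto_const, of "\<lambda>n. integral (J n) h0" "integral {0..} h0" sequentially "integral {0..} h0"]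
    by simp
  have bd: "norm (integral (J n) f0 - integral {0..} f0) \<le> integral {0..} h0 - integral (J n) h0" for n
  proof -
    let ?f = "\<lambda>x. if x \<in> J n then f0 x else 0" and ?h = "\<lambda>x. if x \<in> J n then h0 x else 0"
    have i: "?f integrable_on {0..}" "?h integrable_on {0..}"
      using intJ[OF h0] intJ[OF int0] J[of n] by (simp_all only: integrable_restrict_Int Int_absorb2)
    have "norm (integral {0..} (\<lambda>x. f0 x - ?f x)) \<le> integral {0..} (\<lambda>x. h0 x - ?h x)"
      by (rule integral_norm_bound_integral) (use i int0 h0 le0 in \<open>auto intro!: integrable_diff\<close>)
    also have "integral {0..} (\<lambda>x. f0 x - ?f x) = integral {0..} f0 - integral (J n) f0"
      using i int0 J[of n] by (simp only: integral_diff integral_restrict_Int Int_absorb2)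
    also have "integral {0..} (\<lambda>x. h0 x - ?h x) = integral {0..} h0 - integral (J n) h0"
      using i h0 J[of n] by (simp only: integral_diff integral_restrict_Int Int_absorb2)
    finally show ?thesis by (simp only: norm_minus_commute)
  qed
  have "(\<lambda>n. integral (J n) f0 - integral {0..} f0) \<longlonglongrightarrow> 0"
    by (rule Lim_null_comparison[OF _ lim0]) (use bd in auto)
  then show "(\<lambda>n. integral {inverse (Suc n)..Suc n} f) \<longlonglongrightarrow> integral {0..} f"
    unfolding eqf J_def by (rule LIM_zero_cancel)
qed

text \<open>
  On a fine division, \<open>F\<close> may be replaced on each piece by a constant, and a monotone scalar function times a
  constant is integrable.
\<close>

lemma integrable_mono_scaleR_continuous:
  fixes F :: "real \<Rightarrow> 'b::banach"
  assumes p: "mono_on {a..b} p" and F: "continuous_on {a..b} F"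
  shows "(\<lambda>x. p x *\<^sub>R F x) integrable_on {a..b}"
proof (cases "a \<le> b")
  case True
  define P where "P = \<bar>p a\<bar> + \<bar>p b\<bar> + 1"
  have P: "P > 0" "\<bar>p x\<bar> \<le> P" if "x \<in> {a..b}" for x
    using mono_onD[OF p, of a x] mono_onD[OF p, of x b] that True by (auto simp: P_def)
  have Ppos: "P > 0" by (auto simp: P_def)
  have "(\<lambda>x. p x *\<^sub>R F x) integrable_on cbox a b"
  proof (rule integrable_uniform_limit)
    fix e :: real assume e: "e > 0"
    have "uniformly_continuous_on {a..b} F" using F by (intro compact_uniformly_continuous) auto
    then obtain d where d: "d > 0"
      and dF: "\<And>x x'. x \<in> {a..b} \<Longrightarrow> x' \<in> {a..b} \<Longrightarrow> dist x' x < d \<Longrightarrow> dist (F x') (F x) < e / P"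
      using e Ppos unfolding uniformly_continuous_on_def by (metis divide_pos_pos)
    obtain q where q: "q tagged_division_of cbox a b" and fine: "(\<lambda>x. ball x d) fine q"
      using fine_division_exists[OF gauge_ball[OF d], of a b] .
    have *: "\<forall>i\<in>snd ` q. \<exists>g. (\<forall>x\<in>i. norm (p x *\<^sub>R F x - g x) \<le> e) \<and> g integrable_on i"
    proof safe
      fix x K assume xK: "(x, K) \<in> q"
      have x: "x \<in> K" "K \<subseteq> cbox a b" using tagged_division_ofD(2,3)[OF q xK] by auto
      obtain u v where uv: "K = cbox u v" using tagged_division_ofD(4)[OF q xK] by blast
      have Kd: "K \<subseteq> ball x d" using fineD[OF fine xK] .
      have "mono_on {u..v} p" using p x uv by (auto intro: mono_on_subset)
      then have "(\<lambda>y. p y *\<^sub>R F x) integrable_on K"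
        unfolding uv using integrable_on_mono_on[of u v p]
        by (auto intro: integrable_on_scaleR_left)
      moreover have "norm (p y *\<^sub>R F y - p y *\<^sub>R F x) \<le> e" if y: "y \<in> K" for y
      proof -
        have "norm (p y *\<^sub>R F y - p y *\<^sub>R F x) = \<bar>p y\<bar> * dist (F y) (F x)"
          by (simp add: dist_norm scaleR_right_diff_distrib[symmetric])
        also have "\<dots> \<le> P * (e / P)"
        proof (rule mult_mono)
          show "\<bar>p y\<bar> \<le> P" using P(2)[of y] y x by auto
          have "dist y x < d" using Kd y by (auto simp: dist_commute)
          then show "dist (F y) (F x) \<le> e / P" using dF[of x y] y x by fastforce
        qed (use Ppos in auto)
        finally show ?thesis using Ppos by simp
      qed
      ultimately show "\<exists>g. (\<forall>x\<in>snd (x, K). norm (p x *\<^sub>R F x - g x) \<le> e) \<and> g integrable_on snd (x, K)"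
        by (intro exI[of _ "\<lambda>y. p y *\<^sub>R F x"]) auto
    qed
    have "0 \<le> e" using e by simp
    then obtain g where "\<forall>x\<in>cbox a b. norm (p x *\<^sub>R F x - g x) \<le> e" "g integrable_on cbox a b"
      using approximable_on_division[OF _ division_of_tagged_division[OF q] *] by blast
    then show "\<exists>g. (\<forall>x\<in>cbox a b. norm (p x *\<^sub>R F x - g x) \<le> e) \<and> g integrable_on cbox a b" by blast
  qed
  then show ?thesis by simp
qed auto

lemma integral_Ici_limit:
  fixes f :: "real \<Rightarrow> 'b::banach"
  assumes "f integrable_on {0..}"
  shows "((\<lambda>N. integral {0..N} f) \<longlongrightarrow> integral {0..} f) at_top"
proof (rule tendstoI)
  fix e :: real assume e: "e > 0"
  have *: "(f has_integral integral {0..} f) {0..}" using assms by (rule integrable_integral)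
  obtain B where B: "B > 0" "\<And>a b. ball 0 B \<subseteq> cbox a b \<Longrightarrow>
      norm (integral (cbox a b) (\<lambda>x. if x \<in> {0..} then f x else 0) - integral {0..} f) < e"
    using *[unfolded has_integral_alt'[of f]] e by blast
  show "\<forall>\<^sub>F N in at_top. dist (integral {0..N} f) (integral {0..} f) < e"
    unfolding eventually_at_top_linorder
  proof (intro exI allI impI)
    fix N assume N: "B \<le> N"
    have "ball 0 B \<subseteq> cbox (- N) N" using N by (auto simp: dist_real_def)
    from B(2)[OF this] have "norm (integral ({0..} \<inter> {-N..N}) f - integral {0..} f) < e"
      by (simp only: integral_restrict_Int box_real)
    moreover have "{0..} \<inter> {-N..N} = {0..N}" using N B(1) by auto
    ultimately show "dist (integral {0..N} f) (integral {0..} f) < e" by (simp only: dist_norm)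
  qed
qed

lemma has_vector_derivative_right_quotient:
  assumes "(f has_vector_derivative D) (at 0 within {0..})"
  shows "((\<lambda>h. (f h - f 0) /\<^sub>R h) \<longlongrightarrow> D) (at_right 0)"
proof -
  have "((\<lambda>y. norm (f y - f 0 - y *\<^sub>R D) / \<bar>y\<bar>) \<longlongrightarrow> 0) (at 0 within {0..})"
    using assms unfolding has_vector_derivative_def has_derivative_iff_norm by simp
  then have "((\<lambda>y. norm (f y - f 0 - y *\<^sub>R D) / \<bar>y\<bar>) \<longlongrightarrow> 0) (at_right 0)"
    by (rule tendsto_within_subset) auto
  then have "((\<lambda>h. norm ((f h - f 0) /\<^sub>R h - D)) \<longlongrightarrow> 0) (at_right 0)"
  proof (rule Lim_transform_eventually)
    show "\<forall>\<^sub>F y in at_right 0. norm (f y - f 0 - y *\<^sub>R D) / \<bar>y\<bar> = norm ((f y - f 0) /\<^sub>R y - D)"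
      unfolding eventually_at_filter
    proof (rule always_eventually, intro allI impI)
      fix y :: real assume "y \<noteq> 0" "y \<in> {0<..}"
      then have y: "y > 0" by auto
      have "(f y - f 0) /\<^sub>R y - D = (f y - f 0 - y *\<^sub>R D) /\<^sub>R y"
        using y by (simp add: scaleR_diff_right)
      then show "norm (f y - f 0 - y *\<^sub>R D) / \<bar>y\<bar> = norm ((f y - f 0) /\<^sub>R y - D)"
        using y by (simp add: divide_inverse mult.commute)
    qed
  qed
  then show ?thesis using tendsto_norm_zero_iff Lim_null by blast
qed

lemma has_vector_derivative_quadratic:
  assumes "\<And>y. y \<in> S \<Longrightarrow> norm (f y - f x - (y - x) *\<^sub>R D) \<le> C * (y - x)\<^sup>2"
  shows "(f has_vector_derivative D) (at x within S)"
  unfolding has_vector_derivative_def has_derivative_iff_norm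
proof
  show "bounded_linear (\<lambda>x. x *\<^sub>R D)" by (rule bounded_linear_scaleR_left)
  have "((\<lambda>y. C * \<bar>y - x\<bar>) \<longlongrightarrow> C * \<bar>x - x\<bar>) (at x within S)" by (intro tendsto_intros)
  then have "((\<lambda>y. C * \<bar>y - x\<bar>) \<longlongrightarrow> 0) (at x within S)" by simp
  then show "((\<lambda>y. norm (f y - f x - (y - x) *\<^sub>R D) / norm (y - x)) \<longlongrightarrow> 0) (at x within S)"
  proof (rule Lim_null_comparison[rotated])
    show "\<forall>\<^sub>F y in at x within S. norm (norm (f y - f x - (y - x) *\<^sub>R D) / norm (y - x)) \<le> C * \<bar>y - x\<bar>"
      unfolding eventually_at_filter
    proof (rule always_eventually, intro allI impI)
      fix y assume "y \<noteq> x" "y \<in> S"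
      then show "norm (norm (f y - f x - (y - x) *\<^sub>R D) / norm (y - x)) \<le> C * \<bar>y - x\<bar>"
        using assms[of y] by (simp add: divide_le_eq power2_eq_square mult.assoc abs_mult[symmetric])
    qed
  qed
qed

section \<open>Complex scalars as bounded operators\<close>

lemma bounded_bilinear_scaleC:
  "bounded_bilinear (scaleC :: complex \<Rightarrow> 'a \<Rightarrow> 'a::complex_normed_vector)"
proof
  fix a a' :: complex and b b' :: 'a and r :: real
  show "(a + a') *\<^sub>C b = a *\<^sub>C b + a' *\<^sub>C b" by (rule scaleC_add_left)
  show "a *\<^sub>C (b + b') = a *\<^sub>C b + a *\<^sub>C b'" by (rule scaleC_add_right)
  show "(r *\<^sub>R a) *\<^sub>C b = r *\<^sub>R (a *\<^sub>C b)"
    unfolding scaleR_conv_of_real by (simp only: scaleC_of_real[symmetric] scaleC_scaleC)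
  show "a *\<^sub>C (r *\<^sub>R b) = r *\<^sub>R (a *\<^sub>C b)"
    by (simp only: scaleC_of_real[symmetric] scaleC_scaleC mult.commute)
  show "\<exists>K. \<forall>a (b::'a). norm (a *\<^sub>C b) \<le> norm a * norm b * K"
    by (rule exI[of _ 1]) (simp add: norm_scaleC)
qed

interpretation scaleC: bounded_bilinear "scaleC :: complex \<Rightarrow> 'a \<Rightarrow> 'a::complex_normed_vector"
  by (rule bounded_bilinear_scaleC)

interpretation comp: bounded_bilinear "(o\<^sub>L) :: ('b::real_normed_vector \<Rightarrow>\<^sub>L 'c::real_normed_vector) \<Rightarrow> ('a::real_normed_vector \<Rightarrow>\<^sub>L 'b) \<Rightarrow> _"
  by (rule bounded_bilinear_blinfun_compose)

lemma scaleC_one [simp]: "1 *\<^sub>C x = (x :: 'a::complex_normed_vector)"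
  using scaleC_of_real[of 1 x] by simp

lemma comp_assoc: "(A o\<^sub>L B) o\<^sub>L C = A o\<^sub>L (B o\<^sub>L C)"
  by (rule blinfun_eqI) simp

lemma id_comp [simp]: "id_blinfun o\<^sub>L A = A" "A o\<^sub>L id_blinfun = A"
  by (rule blinfun_eqI; simp)+

text \<open>
  Multiplication by a complex number. Bounded operators form only a real vector space here, so complex multiples of
  an operator are written as compositions with \<open>cop z\<close>.
\<close>

definition cop :: "complex \<Rightarrow> ('a::complex_normed_vector \<Rightarrow>\<^sub>L 'a)"
  where "cop z = Blinfun (\<lambda>x. z *\<^sub>C x)"

lemma cop_apply [simp]: "blinfun_apply (cop z) x = z *\<^sub>C x"
  unfolding cop_def by (simp add: bounded_linear_Blinfun_apply scaleC.bounded_linear_right)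

lemma cop_mult: "cop z o\<^sub>L cop w = cop (z * w)"
  by (rule blinfun_eqI) (simp add: scaleC_scaleC)

lemma cop_one [simp]: "cop 1 = id_blinfun"
  by (rule blinfun_eqI) simp

lemma cop_of_real_comp: "cop (of_real r) o\<^sub>L A = r *\<^sub>R A"
  by (rule blinfun_eqI) (simp add: scaleC_of_real blinfun.scaleR_left)

lemma cop_add: "cop (z + w) = cop z + cop w"
  by (rule blinfun_eqI) (simp add: blinfun.bilinear_simps scaleC.bilinear_simps)

lemma cop_minus: "cop (- z) = - cop z"
  by (rule blinfun_eqI) (simp add: blinfun.bilinear_simps scaleC.bilinear_simps)

lemma cop_zero [simp]: "cop 0 = 0"
  by (rule blinfun_eqI) (simp add: scaleC.bilinear_simps)

lemma norm_cop_le: "norm (cop z) \<le> cmod z"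
  by (rule norm_blinfun_bound) (simp_all add: norm_scaleC)

lemma norm_cop_comp:
  fixes A :: "'b::real_normed_vector \<Rightarrow>\<^sub>L 'a::complex_normed_vector"
  shows "norm (cop z o\<^sub>L A) = cmod z * norm A"
proof (cases "z = 0")
  case False
  have le: "norm (cop w o\<^sub>L B) \<le> cmod w * norm B" for w and B :: "'b \<Rightarrow>\<^sub>L 'a"
    by (rule order_trans[OF norm_blinfun_compose]) (simp add: mult_right_mono norm_cop_le)
  have "A = cop (inverse z) o\<^sub>L (cop z o\<^sub>L A)"
    using False by (simp add: comp_assoc[symmetric] cop_mult)
  then have "norm A \<le> cmod (inverse z) * norm (cop z o\<^sub>L A)" using le by metis
  then have "cmod z * norm A \<le> norm (cop z o\<^sub>L A)"
    using False by (simp add: norm_inverse norm_divide field_simps)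
  then show ?thesis using le[of z A] by linarith
qed simp

lemma bounded_linear_cop: "bounded_linear cop"
proof
  show "cop (r *\<^sub>R z) = r *\<^sub>R cop z" for r z
    by (rule blinfun_eqI) (simp add: scaleC.scaleR_left blinfun.scaleR_left)
  show "\<exists>K. \<forall>x. norm (cop x) \<le> norm x * K"
    by (rule exI[of _ 1]) (simp add: norm_cop_le)
qed (rule cop_add)

lemma clinear_op_cop_commute: "clinear_op B \<Longrightarrow> B o\<^sub>L cop z = cop z o\<^sub>L B"
  by (rule blinfun_eqI) (simp add: clinear_op_def)

lemma integral_comp_right:
  fixes f :: "real \<Rightarrow> ('a::real_normed_vector \<Rightarrow>\<^sub>L 'b::real_normed_vector)" and B :: "'b \<Rightarrow>\<^sub>L 'c::real_normed_vector"
  assumes "f integrable_on S"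
  shows "(\<lambda>r. B o\<^sub>L f r) integrable_on S" "integral S (\<lambda>r. B o\<^sub>L f r) = B o\<^sub>L integral S f"
  using integrable_linear[OF assms comp.bounded_linear_right[of B]] integral_linear[OF assms comp.bounded_linear_right[of B]]
  by (simp_all add: o_def)

lemma integral_comp_left:
  fixes f :: "real \<Rightarrow> ('b::real_normed_vector \<Rightarrow>\<^sub>L 'c::real_normed_vector)" and B :: "'a::real_normed_vector \<Rightarrow>\<^sub>L 'b"
  assumes "f integrable_on S"
  shows "(\<lambda>r. f r o\<^sub>L B) integrable_on S" "integral S (\<lambda>r. f r o\<^sub>L B) = integral S f o\<^sub>L B"
  using integrable_linear[OF assms comp.bounded_linear_left[of B]] integral_linear[OF assms comp.bounded_linear_left[of B]]
  by (simp_all add: o_def)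

lemma integral_cop:
  assumes "f integrable_on S"
  shows "(\<lambda>r. cop (f r)) integrable_on S" "integral S (\<lambda>r. cop (f r)) = cop (integral S f)"
  using integrable_linear[OF assms bounded_linear_cop] integral_linear[OF assms bounded_linear_cop]
  by (simp_all add: o_def)

lemma norm_comp_le: "norm A \<le> a \<Longrightarrow> norm B \<le> b \<Longrightarrow> norm (A o\<^sub>L B) \<le> a * b"
  by (rule order_trans[OF norm_blinfun_compose]) (auto intro!: mult_mono order_trans[OF norm_ge_zero])

lemma continuous_cop_comp [continuous_intros]:
  "continuous_on S f \<Longrightarrow> continuous_on S K \<Longrightarrow> continuous_on S (\<lambda>r. cop (f r) o\<^sub>L K r)"
  by (intro bounded_bilinear.continuous_on[OF bounded_bilinear_blinfun_compose]
      bounded_linear.continuous_on[OF bounded_linear_cop])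

lemma scaleR_cop_comp: "a *\<^sub>R (cop z o\<^sub>L B) = cop (a *\<^sub>R z) o\<^sub>L B"
  by (rule blinfun_eqI) (simp add: scaleC.scaleR_left blinfun.scaleR_left)

section \<open>The resolvent of a semigroup generator\<close>

text \<open>
  What the proof uses of \<open>R z = (z + A)\<^sup>-\<^sup>1\<close>. The resolvent identity is required up to and including the
  imaginary axis, the Hille--Yosida bound only inside the half-plane.
\<close>

locale resolvent_family =
  fixes R :: "complex \<Rightarrow> ('a::complex_banach \<Rightarrow>\<^sub>L 'a)" and M :: real
  assumes clin: "Re z \<ge> 0 \<Longrightarrow> clinear_op (R z)"
    and resolvent: "Re z \<ge> 0 \<Longrightarrow> Re w \<ge> 0 \<Longrightarrow> R z - R w = cop (w - z) o\<^sub>L (R w o\<^sub>L R z)"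
    and bound: "Re z > 0 \<Longrightarrow> Re z * norm (R z) \<le> M"
    and inj0: "blinfun_apply (R 0) x = 0 \<Longrightarrow> x = 0"
    and M_ge_1: "1 \<le> M"

text \<open>
  This is \<open>B = (z + A)\<^sup>-\<^sup>1\<close>, with \<open>A\<close> given by its graph.
\<close>

definition inverts_shift :: "('a::complex_normed_vector \<times> 'a) set \<Rightarrow> complex \<Rightarrow> ('a \<Rightarrow>\<^sub>L 'a) \<Rightarrow> bool"
  where "inverts_shift A z B \<longleftrightarrow> (\<forall>x y. blinfun_apply B y = x \<longleftrightarrow> (x, y - z *\<^sub>C x) \<in> A)"

lemma op_graph_eq_converse_shift: "op_graph B = (op_shift z A)\<inverse> \<longleftrightarrow> inverts_shift A z B"
proof -
  have "(y, x) \<in> (op_shift z A)\<inverse> \<longleftrightarrow> (x, y - z *\<^sub>C x) \<in> A" for x y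
  proof
    assume "(y, x) \<in> (op_shift z A)\<inverse>"
    then show "(x, y - z *\<^sub>C x) \<in> A" by (auto simp: op_shift_def)
  next
    assume "(x, y - z *\<^sub>C x) \<in> A"
    then have "(x, z *\<^sub>C x + (y - z *\<^sub>C x)) \<in> op_shift z A" unfolding op_shift_def by blast
    then show "(y, x) \<in> (op_shift z A)\<inverse>" by simp
  qed
  moreover have "(y, x) \<in> op_graph B \<longleftrightarrow> blinfun_apply B y = x" for x y
    by (auto simp: op_graph_def)
  ultimately show ?thesis
    unfolding inverts_shift_def set_eq_iff by auto
qed

lemma shift_inv_eqI: "inverts_shift A z B \<Longrightarrow> shift_inv A z = B"
  unfolding shift_inv_def by (metis bounded_op_of_op_graph op_graph_eq_converse_shift)

lemma op_uminus_iff: "(x, y) \<in> op_uminus A \<longleftrightarrow> (x, - y) \<in> A"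
  unfolding op_uminus_def by force

lemma inverts_shift_of_resolvent_set:
  assumes "- z \<in> resolvent_set A"
  obtains B where "clinear_op B" "inverts_shift A z B"
proof -
  obtain B where B: "clinear_op B" "inverts_shift (op_uminus A) (- z) B"
    using assms unfolding resolvent_set_def op_graph_eq_converse_shift by auto
  have "clinear_op (- B)"
    using B(1) by (auto simp: clinear_op_def blinfun.bilinear_simps scaleC.bilinear_simps)
  moreover have "inverts_shift A z (- B)"
    unfolding inverts_shift_def
  proof (intro allI)
    fix x y
    have "blinfun_apply (- B) y = x \<longleftrightarrow> blinfun_apply B (- y) = x"
      by (simp add: blinfun.bilinear_simps)
    also have "\<dots> \<longleftrightarrow> (x, - (- y - (- z) *\<^sub>C x)) \<in> A"
      using B(2) by (simp add: inverts_shift_def op_uminus_iff)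
    finally show "blinfun_apply (- B) y = x \<longleftrightarrow> (x, y - z *\<^sub>C x) \<in> A"
      by (simp add: scaleC.bilinear_simps)
  qed
  ultimately show ?thesis using that by blast
qed

lemma inverts_shift_resolvent_identity:
  assumes "inverts_shift A z B" "inverts_shift A w C" "clinear_op C"
  shows "B - C = cop (w - z) o\<^sub>L (C o\<^sub>L B)"
proof (rule blinfun_eqI)
  fix y
  let ?x = "blinfun_apply B y"
  have "(?x, y - z *\<^sub>C ?x) \<in> A" using assms(1) unfolding inverts_shift_def by blast
  then have "(?x, (y + (w - z) *\<^sub>C ?x) - w *\<^sub>C ?x) \<in> A"
    by (simp add: scaleC.bilinear_simps algebra_simps)
  then have "blinfun_apply C (y + (w - z) *\<^sub>C ?x) = ?x" using assms(2) by (simp add: inverts_shift_def)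
  then have "blinfun_apply C y + (w - z) *\<^sub>C blinfun_apply C ?x = ?x"
    using assms(3) by (simp add: blinfun.bilinear_simps clinear_op_def)
  then show "blinfun_apply (B - C) y = blinfun_apply (cop (w - z) o\<^sub>L (C o\<^sub>L B)) y"
    by (simp add: blinfun.bilinear_simps algebra_simps)
qed

lemma C0_generator_unique:
  assumes "(x, y) \<in> C0_generator T" "(x, y') \<in> C0_generator T"
  shows "y = y'"
  using assms unfolding C0_generator_def by (auto intro: tendsto_unique[rotated])

text \<open>
  The operator \<open>L x = \<integral> exp(- z t) T(t) x dt\<close> over \<open>t > 0\<close> inverts \<open>z + A\<close>. Shifting the variable shows
  \<open>T(s) L x = exp(z s) (L x - \<integral> exp(- z t) T(t) x dt)\<close>, the integral being over \<open>[0, s]\<close>, and the right-hand side has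
  the derivative \<open>z L x - x\<close> at \<open>s = 0\<close>; this is \<open>(z + A) L x = x\<close>. Since \<open>L\<close> commutes with \<open>T(s)\<close>, the same
  limit gives \<open>L (z + A) x = x\<close> on the domain of \<open>A\<close>.
\<close>

lemma laplace_transform_resolvent:
  fixes T :: "real \<Rightarrow> ('a::complex_banach \<Rightarrow>\<^sub>L 'a)"
  assumes T: "bounded_C0_semigroup T" and gen: "op_uminus A = C0_generator T"
    and M: "\<And>t. t \<ge> 0 \<Longrightarrow> norm (T t) \<le> M" and z: "Re z > 0"
  shows "\<exists>L. clinear_op L \<and> inverts_shift A z L \<and> Re z * norm L \<le> M"
proof -
  have T0: "T 0 = id_blinfun" and TC: "\<And>t w x. t \<ge> 0 \<Longrightarrow> T t (w *\<^sub>C x) = w *\<^sub>C T t x"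
    and Tadd: "\<And>s t x. s \<ge> 0 \<Longrightarrow> t \<ge> 0 \<Longrightarrow> T (s + t) x = T s (T t x)"
    and Tcont: "\<And>x. continuous_on {0..} (\<lambda>t. T t x)"
    using T by (auto simp: bounded_C0_semigroup_def clinear_op_def)
  have M0: "0 \<le> M" using M[of 0] norm_ge_zero order_trans by blast
  define u where "u x t = exp (- (z * of_real t)) *\<^sub>C T t x" for x t
  define h where "h x t = M * norm x * exp (- Re z * t)" for x :: 'a and t
  have hI: "(h x has_integral M * norm x * (1 / Re z)) {0..}" for x
    unfolding h_def using has_integral_mult_right[OF has_integral_exp_minus_to_infinity[OF z, of 0], of "M * norm x"]
    by simp
  have ucont: "continuous_on {0..} (u x)" for x
    unfolding u_def by (intro scaleC.continuous_on Tcont continuous_intros)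
  have uloc: "u x integrable_on {a..b}" if "0 \<le> a" for a b x
    by (rule integrable_continuous_interval, rule continuous_on_subset[OF ucont]) (use that in auto)
  have ule: "norm (u x t) \<le> h x t" if "t \<ge> 0" for x t
  proof -
    have "norm (u x t) = exp (- Re z * t) * norm (T t x)" by (simp add: u_def norm_scaleC)
    also have "\<dots> \<le> exp (- Re z * t) * (M * norm x)"
      by (intro mult_left_mono order_trans[OF norm_blinfun] mult_right_mono M that) auto
    finally show ?thesis by (simp add: h_def mult_ac)
  qed
  have uI: "u x integrable_on {0..}" and ub: "norm (integral {0..} (u x)) \<le> M * norm x * (1 / Re z)" for x
    using dominated_integrable(1,2)[of "u x" "h x"] uloc ule has_integral_integrable[OF hI[of x]]
      integral_unique[OF hI[of x]] by auto
  define Lf where "Lf x = integral {0..} (u x)" for x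
  have "bounded_linear Lf"
  proof (rule bounded_linear_intro)
    show "Lf (x + y) = Lf x + Lf y" for x y
    proof -
      have "u (x + y) = (\<lambda>t. u x t + u y t)"
        by (auto simp: u_def blinfun.bilinear_simps scaleC.bilinear_simps)
      then show ?thesis unfolding Lf_def using integral_add[OF uI uI] by simp
    qed
    show "Lf (r *\<^sub>R x) = r *\<^sub>R Lf x" for r x
    proof -
      have "u (r *\<^sub>R x) = (\<lambda>t. r *\<^sub>R u x t)"
        by (auto simp: u_def blinfun.bilinear_simps scaleC.bilinear_simps)
      then show ?thesis unfolding Lf_def by simp
    qed
    show "norm (Lf x) \<le> norm x * (M / Re z)" for x
      using ub[of x] by (simp add: Lf_def mult_ac)
  qed
  then have L: "blinfun_apply (Blinfun Lf) = Lf" by (rule bounded_linear_Blinfun_apply)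
  define L where "L = Blinfun Lf"
  note L = L[folded L_def]
  have "norm L \<le> M / Re z"
    by (rule norm_blinfun_bound) (use ub M0 z in \<open>auto simp: L Lf_def mult_ac\<close>)
  then have nL: "Re z * norm L \<le> M" using z by (simp add: field_simps)
  have LC: "L (w *\<^sub>C x) = w *\<^sub>C L x" for w x
  proof -
    have "u (w *\<^sub>C x) t = w *\<^sub>C u x t" if "t \<in> {0..}" for t
      using TC that by (auto simp: u_def scaleC_scaleC mult.commute)
    then have "L (w *\<^sub>C x) = integral {0..} (scaleC w \<circ> u x)"
      unfolding L Lf_def by (intro integral_cong) auto
    also have "\<dots> = w *\<^sub>C L x"
      unfolding L Lf_def by (rule integral_linear[OF uI scaleC.bounded_linear_right])
    finally show ?thesis .
  qed
  have TL: "T s (L x) = L (T s x)" if s: "s \<ge> 0" for s x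
  proof -
    have "T s (u x t) = u (T s x) t" if "t \<in> {0..}" for t
      using TC[OF s] Tadd[of s t x] Tadd[of t s x] s that by (simp add: u_def add.commute)
    then have "L (T s x) = integral {0..} (T s \<circ> u x)"
      unfolding L Lf_def by (intro integral_cong) auto
    also have "\<dots> = T s (L x)"
      unfolding L Lf_def by (rule integral_linear[OF uI blinfun.bounded_linear_right])
    finally show ?thesis by simp
  qed
  have shift: "T s (L x) = exp (z * of_real s) *\<^sub>C (L x - integral {0..s} (u x))" if s: "s \<ge> 0" for s x
  proof -
    have fin: "T s (integral {0..N} (u x)) = exp (z * of_real s) *\<^sub>C (integral {0..N + s} (u x) - integral {0..s} (u x))"
      if N: "N \<ge> 0" for N
    proof -
      have "T s (integral {0..N} (u x)) = integral {0..N} (blinfun_apply (T s) \<circ> u x)"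
        by (rule integral_linear[symmetric, OF uloc blinfun.bounded_linear_right]) simp
      also have "\<dots> = integral {0..N} (scaleC (exp (z * of_real s)) \<circ> (u x \<circ> (+) s))"
      proof (rule integral_cong)
        fix t assume t: "t \<in> {0..N}"
        have "T s (u x t) = exp (- (z * of_real t)) *\<^sub>C T (s + t) x"
          using t s TC Tadd by (simp add: u_def)
        also have "\<dots> = exp (z * of_real s) *\<^sub>C u x (s + t)"
          by (simp add: u_def scaleC_scaleC exp_add[symmetric] algebra_simps)
        finally show "(blinfun_apply (T s) \<circ> u x) t = (scaleC (exp (z * of_real s)) \<circ> (u x \<circ> (+) s)) t"
          by simp
      qed
      also have "\<dots> = exp (z * of_real s) *\<^sub>C integral {0..N} (u x \<circ> (+) s)"
      proof (rule integral_linear[OF _ scaleC.bounded_linear_right])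
        show "(u x \<circ> (+) s) integrable_on {0..N}"
          by (intro integrable_continuous_interval continuous_on_compose continuous_intros
              continuous_on_subset[OF ucont]) (use s in auto)
      qed
      also have "integral {0..N} (u x \<circ> (+) s) = integral {s..N + s} (u x)"
        using integral_shift_Icc_real[of 0 N "u x" s] by simp
      also have "\<dots> = integral {0..N + s} (u x) - integral {0..s} (u x)"
      proof -
        have "integral {0..s} (u x) + integral {s..N + s} (u x) = integral {0..N + s} (u x)"
          by (rule Henstock_Kurzweil_Integration.integral_combine) (use uloc s N in auto)
        then show ?thesis by (simp add: algebra_simps)
      qed
      finally show ?thesis .
    qed
    have 1: "((\<lambda>N. T s (integral {0..N} (u x))) \<longlongrightarrow> T s (L x)) at_top"
      unfolding L Lf_def by (intro blinfun.tendsto tendsto_const integral_Ici_limit uI)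
    have "filterlim (\<lambda>N. N + s) at_top at_top" by (rule filterlim_tendsto_add_at_top[OF tendsto_const filterlim_ident, of s, unfolded add.commute[of s]])
    from filterlim_compose[OF integral_Ici_limit[OF uI] this]
    have "((\<lambda>N. exp (z * of_real s) *\<^sub>C (integral {0..N + s} (u x) - integral {0..s} (u x)))
        \<longlongrightarrow> exp (z * of_real s) *\<^sub>C (L x - integral {0..s} (u x))) at_top"
      unfolding L Lf_def by (intro scaleC.tendsto tendsto_const tendsto_diff)
    then have "((\<lambda>N. T s (integral {0..N} (u x))) \<longlongrightarrow> exp (z * of_real s) *\<^sub>C (L x - integral {0..s} (u x))) at_top"
      by (rule Lim_transform_eventually) (auto simp: eventually_at_top_linorder fin intro!: exI[of _ 0])
    from tendsto_unique[OF _ 1 this] show ?thesis by simp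
  qed
  have gen_L: "((\<lambda>s. (T s (L x) - L x) /\<^sub>R s) \<longlongrightarrow> z *\<^sub>C L x - x) (at_right 0)" for x
  proof -
    let ?G = "\<lambda>s. exp (z * of_real s) *\<^sub>C (L x - integral {0..s} (u x))"
    have "((\<lambda>s. integral {0..s} (u x)) has_vector_derivative u x 0) (at 0 within {0..1})"
      by (rule integral_has_vector_derivative[OF continuous_on_subset[OF ucont]]) auto
    moreover have "at (0::real) within {0..1} = at 0 within {0..}"
      by (rule at_within_nhd[of _ "{..<1}"]) auto
    ultimately have 1: "((\<lambda>s. integral {0..s} (u x)) has_vector_derivative x) (at 0 within {0..})"
      by (simp add: u_def T0)
    have 2: "((\<lambda>s. exp (z * of_real s)) has_vector_derivative z) (at 0 within {0..})"
      by (auto intro!: derivative_eq_intros has_vector_derivative_real_field simp: o_def)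
    have "(?G has_vector_derivative (exp (z * of_real 0) *\<^sub>C (0 - x) + z *\<^sub>C (L x - integral {0..0} (u x)))) (at 0 within {0..})"
      by (intro bounded_bilinear.has_vector_derivative[OF bounded_bilinear_scaleC] 2 has_vector_derivative_diff
           has_vector_derivative_const 1)
    from has_vector_derivative_right_quotient[OF this]
    have "((\<lambda>s. (?G s - L x) /\<^sub>R s) \<longlongrightarrow> z *\<^sub>C L x - x) (at_right 0)" by (simp add: scaleC.bilinear_simps)
    then show ?thesis
      by (rule Lim_transform_eventually) (auto simp: eventually_at_filter shift)
  qed
  have genA: "(x, y) \<in> A \<longleftrightarrow> ((\<lambda>t. (T t x - x) /\<^sub>R t) \<longlongrightarrow> - y) (at_right 0)" for x y
    using gen op_uminus_iff[of x "- y" A] unfolding C0_generator_def by auto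
  have "inverts_shift A z L"
    unfolding inverts_shift_def
  proof (intro allI iffI)
    fix x y assume "L y = x"
    then show "(x, y - z *\<^sub>C x) \<in> A" using gen_L[of y] by (auto simp: genA)
  next
    fix x y assume "(x, y - z *\<^sub>C x) \<in> A"
    then have "((\<lambda>t. (T t x - x) /\<^sub>R t) \<longlongrightarrow> z *\<^sub>C x - y) (at_right 0)" by (simp add: genA)
    then have "((\<lambda>t. L ((T t x - x) /\<^sub>R t)) \<longlongrightarrow> L (z *\<^sub>C x - y)) (at_right 0)"
      by (intro blinfun.tendsto tendsto_const)
    then have "((\<lambda>t. (T t (L x) - L x) /\<^sub>R t) \<longlongrightarrow> L (z *\<^sub>C x - y)) (at_right 0)"
      by (rule Lim_transform_eventually) (auto simp: eventually_at_filter TL blinfun.bilinear_simps)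
    from tendsto_unique[OF _ this gen_L] have "L (z *\<^sub>C x - y) = z *\<^sub>C L x - x" by simp
    then show "L y = x" by (simp add: blinfun.bilinear_simps LC)
  qed
  then show ?thesis using LC nL by (auto simp: clinear_op_def)
qed

theorem semigroup_resolvent_family:
  fixes T :: "real \<Rightarrow> ('a::complex_banach \<Rightarrow>\<^sub>L 'a)"
  assumes T: "bounded_C0_semigroup T" and gen: "op_uminus A = C0_generator T"
    and iR: "range (\<lambda>s. \<i> * complex_of_real s) \<subseteq> resolvent_set A"
  obtains M where "resolvent_family (shift_inv A) M"
proof -
  obtain M where M: "\<And>t. t \<ge> 0 \<Longrightarrow> norm (T t) \<le> M"
    using T by (auto simp: bounded_C0_semigroup_def)
  have ex: "\<exists>L. clinear_op L \<and> inverts_shift A z L \<and> Re z * norm L \<le> max 1 M" if "Re z \<ge> 0" for z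
  proof (cases "Re z = 0")
    case True
    then have "- z \<in> range (\<lambda>s. \<i> * complex_of_real s)"
      by (intro image_eqI[of _ _ "- Im z"]) (auto simp: complex_eq_iff)
    then have "- z \<in> resolvent_set A" using iR by blast
    then obtain L where "clinear_op L" "inverts_shift A z L"
      by (rule inverts_shift_of_resolvent_set)
    then show ?thesis using True by (intro exI[of _ L]) auto
  next
    case False
    then obtain L where "clinear_op L" "inverts_shift A z L" "Re z * norm L \<le> M"
      using laplace_transform_resolvent[OF T gen M, of z] \<open>Re z \<ge> 0\<close> False by fastforce
    then show ?thesis by (intro exI[of _ L]) auto
  qed
  have R: "clinear_op (shift_inv A z)" "inverts_shift A z (shift_inv A z)"
      "Re z * norm (shift_inv A z) \<le> max 1 M" if "Re z \<ge> 0" for z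
    using ex[OF that] shift_inv_eqI by auto
  have "resolvent_family (shift_inv A) (max 1 M)"
  proof
    show "shift_inv A z - shift_inv A w = cop (w - z) o\<^sub>L (shift_inv A w o\<^sub>L shift_inv A z)"
      if "0 \<le> Re z" "0 \<le> Re w" for z w
      by (rule inverts_shift_resolvent_identity) (use R that in auto)
    show "x = 0" if "blinfun_apply (shift_inv A 0) x = 0" for x
    proof -
      have graph: "blinfun_apply (shift_inv A 0) v = w \<longleftrightarrow> (w, v) \<in> A" for v w
        using R(2)[of 0] unfolding inverts_shift_def by (simp add: scaleC.bilinear_simps)
      have "(0, x) \<in> A" "(0, 0) \<in> A"
        using graph[of x 0] graph[of 0 0] that by (auto simp: blinfun.bilinear_simps)
      then have "(0, - x) \<in> C0_generator T" "(0, 0) \<in> C0_generator T"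
        using op_uminus_iff[of 0 _ A] by (auto simp: gen[symmetric])
      then have "- x = 0" by (rule C0_generator_unique)
      then show ?thesis by simp
    qed
  qed (use R in auto)
  then show ?thesis using that by blast
qed

section \<open>Scalar integrals of power functions\<close>

lemma has_integral_max_powr:
  assumes p: "p < -1" and s: "s > (0::real)"
  shows "((\<lambda>r. max s r powr p) has_integral s powr (p + 1) * (1 - 1 / (p + 1))) {0..}"
proof -
  have "((\<lambda>r. s powr p) has_integral s powr p * s) {0..s}"
    using has_integral_const_real[of "s powr p" 0 s] s by (simp add: mult.commute)
  then have 1: "((\<lambda>r. max s r powr p) has_integral s powr (p + 1)) {0..s}"
    using s by (subst has_integral_cong[where g = "\<lambda>r. s powr p"]) (auto simp: max_def powr_add)
  have "((\<lambda>r. r powr p) has_integral - (s powr (p + 1)) / (p + 1)) {s..}"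
    by (rule has_integral_powr_to_inf[OF p s])
  then have 2: "((\<lambda>r. max s r powr p) has_integral - (s powr (p + 1)) / (p + 1)) {s..}"
    by (subst has_integral_cong[where g = "\<lambda>r. r powr p"]) (auto simp: max_def)
  have "((\<lambda>r. max s r powr p) has_integral (s powr (p + 1) + - (s powr (p + 1)) / (p + 1))) ({0..s} \<union> {s..})"
    using s by (intro has_integral_Un 1 2) (simp add: Int_atLeastAtMostL2 inf.absorb1)
  moreover have "{0..s} \<union> {s..} = {0..}" using s by auto
  ultimately show ?thesis by (simp add: algebra_simps)
qed

text \<open>
  The model kernel: \<open>1 / max t r\<close> is comparable to \<open>1 / (t + r)\<close> and has the same homogeneity, but it can
  be integrated by elementary means.
\<close>

lemma has_integral_powr_div_max:
  assumes \<theta>: "0 < \<theta>" "\<theta> < 1" and r: "r > (0::real)"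
  shows "((\<lambda>t. t powr (-\<theta>) / max t r) has_integral r powr (-\<theta>) * (1 / (1 - \<theta>) + 1 / \<theta>)) {0..}"
proof -
  have "((\<lambda>t. t powr (-\<theta>)) has_integral r powr (-\<theta> + 1) / (-\<theta> + 1)) {0..r}"
    by (rule has_integral_powr_from_0) (use \<theta> r in auto)
  from has_integral_divide[OF this, of r]
  have "((\<lambda>t. t powr (-\<theta>) / r) has_integral r powr (-\<theta>) * (1 / (1 - \<theta>))) {0..r}"
    using r powr_add[of r "-\<theta>" 1] by (simp add: mult.commute)
  then have 1: "((\<lambda>t. t powr (-\<theta>) / max t r) has_integral r powr (-\<theta>) * (1 / (1 - \<theta>))) {0..r}"
    by (subst has_integral_cong[where g = "\<lambda>t. t powr (-\<theta>) / r"]) (auto simp: max_def)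
  have "((\<lambda>t. t powr (-\<theta> - 1)) has_integral - (r powr (-\<theta> - 1 + 1)) / (-\<theta> - 1 + 1)) {r..}"
    by (rule has_integral_powr_to_inf) (use \<theta> r in auto)
  then have 2: "((\<lambda>t. t powr (-\<theta>) / max t r) has_integral r powr (-\<theta>) * (1 / \<theta>)) {r..}"
    using r by (subst has_integral_cong[where g = "\<lambda>t. t powr (-\<theta> - 1)"]) (auto simp: max_def powr_diff)
  have "((\<lambda>t. t powr (-\<theta>) / max t r) has_integral (r powr (-\<theta>) * (1 / (1 - \<theta>)) + r powr (-\<theta>) * (1 / \<theta>))) ({0..r} \<union> {r..})"
    using r by (intro has_integral_Un 1 2) (simp add: Int_atLeastAtMostL2 inf.absorb1)
  moreover have "{0..r} \<union> {r..} = {0..}" using r by auto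
  ultimately show ?thesis by (simp only: distrib_left)
qed

lemma integral_lower_bound:
  fixes f :: "real \<Rightarrow> real"
  assumes f: "f integrable_on {0..}" and "\<And>r. r > 0 \<Longrightarrow> 0 \<le> f r"
    and "0 < u" "u \<le> v" and c: "\<And>r. r \<in> {u..v} \<Longrightarrow> c \<le> f r"
  shows "c * (v - u) \<le> integral {0..} f"
proof -
  have i: "f integrable_on {u..v}"
    by (rule integrable_on_subinterval[OF f]) (use assms in auto)
  have "c * (v - u) = integral {u..v} (\<lambda>r. c)" using assms by simp
  also have "\<dots> \<le> integral {u..v} f" by (intro integral_le i) (use c in auto)
  also have "\<dots> = integral {0..} (\<lambda>r. if r \<in> {u..v} then f r else 0)"
  proof -
    have "{u..v} \<inter> {0..} = {u..v}" using assms by auto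
    then show ?thesis by (simp only: integral_restrict_Int)
  qed
  also have "\<dots> \<le> integral {0..} (\<lambda>r. if r = 0 then f 0 + max 0 (- f 0) else f r)"
  proof (rule integral_le)
    have "{u..v} \<inter> {0..} = {u..v}" using assms by auto
    then show "(\<lambda>r. if r \<in> {u..v} then f r else 0) integrable_on {0..}"
      using i by (simp only: integrable_restrict_Int)
    show "(\<lambda>r. if r = 0 then f 0 + max 0 (- f 0) else f r) integrable_on {0..}"
      by (rule integrable_spike[OF f, of "{0}"]) auto
  qed (use assms in \<open>auto simp: max_def\<close>)
  also have "\<dots> = integral {0..} f"
    by (rule integral_spike[of "{0}"]) auto
  finally show ?thesis .
qed

lemma powr_dominated:
  fixes K :: "real \<Rightarrow> 'b::banach"
  assumes \<theta>: "0 < \<theta>" "\<theta> < 1" and c: "c > 0" and K: "continuous_on {0<..} K"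
    and le: "\<And>r. r > 0 \<Longrightarrow> norm (K r) \<le> D * (r powr (-\<theta>) / max r c)"
  shows "K integrable_on {0..}"
    and "norm (integral {0..} K) \<le> D * (c powr (-\<theta>) * (1 / (1 - \<theta>) + 1 / \<theta>))"
    and "(\<lambda>n. integral {inverse (Suc n)..Suc n} K) \<longlonglongrightarrow> integral {0..} K"
proof -
  have loc: "K integrable_on {a..b}" if "0 < a" for a b
    by (rule integrable_continuous_interval, rule continuous_on_subset[OF K]) (use that in auto)
  have h: "((\<lambda>r. D * (r powr (-\<theta>) / max r c)) has_integral D * (c powr (-\<theta>) * (1 / (1 - \<theta>) + 1 / \<theta>))) {0..}"
    by (intro has_integral_mult_right has_integral_powr_div_max \<theta> c)
  note d = dominated_integrable[OF loc has_integral_integrable[OF h] le]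
  show "K integrable_on {0..}" by (rule d(1))
  show "norm (integral {0..} K) \<le> D * (c powr (-\<theta>) * (1 / (1 - \<theta>) + 1 / \<theta>))"
    using d(2) integral_unique[OF h] by simp
  show "(\<lambda>n. integral {inverse (Suc n)..Suc n} K) \<longlonglongrightarrow> integral {0..} K" by (rule d(3))
qed

lemma max_le_cmod: "max r \<bar>s\<bar> \<le> cmod (of_real r - \<i> * of_real s)" if "r \<ge> 0"
  using abs_Re_le_cmod[of "of_real r - \<i> * of_real s"] abs_Im_le_cmod[of "of_real r - \<i> * of_real s"] that
  by auto

lemma ne_imaginary: "r > 0 \<Longrightarrow> of_real r - \<i> * of_real s \<noteq> (0 :: complex)"
  by (auto simp: complex_eq_iff)

lemma powr_kernel_lower:
  assumes \<theta>: "0 < \<theta>" and a: "0 < (a::real)" and r: "r \<in> {a/2..a}"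
  shows "a powr (-\<theta>) / (2 * a) \<le> r powr (-\<theta>) * (a / (r\<^sup>2 + a\<^sup>2))"
    and "a powr (-\<theta>) / (2 * a) \<le> r powr (-\<theta>) / (r + a)"
proof -
  have 1: "a powr (-\<theta>) \<le> r powr (-\<theta>)" using assms by (intro powr_mono2') auto
  have "r\<^sup>2 \<le> a\<^sup>2" using r a by (intro power_mono) auto
  moreover have "0 < r\<^sup>2 + a\<^sup>2" using a by (simp add: add_nonneg_pos)
  ultimately have "1 / (2 * a) \<le> a / (r\<^sup>2 + a\<^sup>2)" using a by (simp add: field_simps power2_eq_square)
  then show "a powr (-\<theta>) / (2 * a) \<le> r powr (-\<theta>) * (a / (r\<^sup>2 + a\<^sup>2))"
    using mult_mono[OF 1, of "1 / (2 * a)" "a / (r\<^sup>2 + a\<^sup>2)"] a by simp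
  have "1 / (2 * a) \<le> 1 / (r + a)" using r a by (intro divide_left_mono) auto
  then show "a powr (-\<theta>) / (2 * a) \<le> r powr (-\<theta>) / (r + a)"
    using mult_mono[OF 1, of "1 / (2 * a)" "1 / (r + a)"] a by simp
qed

text \<open>
  Up to a constant factor this is \<open>(-is)\<^sup>-\<^sup>\<theta>\<close>, the symbol of \<open>A\<^sup>-\<^sup>\<theta>\<close>.
\<close>

definition powr_transform :: "real \<Rightarrow> real \<Rightarrow> complex"
  where "powr_transform \<theta> s = integral {0..} (\<lambda>r. r powr (-\<theta>) *\<^sub>R inverse (of_real r - \<i> * of_real s))"

text \<open>
  For the lower bound, \<open>Im (1 / (r - is)) = s / (r\<^sup>2 + s\<^sup>2)\<close> has the sign of \<open>s\<close> for all \<open>r\<close>, so the interval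
  \<open>[\<bar>s\<bar>/2, \<bar>s\<bar>]\<close> suffices.
\<close>

lemma powr_transform_bounds:
  assumes \<theta>: "0 < \<theta>" "\<theta> < 1" and s: "s \<noteq> 0"
  shows "(\<lambda>r. r powr (-\<theta>) *\<^sub>R inverse (of_real r - \<i> * of_real s)) integrable_on {0..}" (is "?f integrable_on _")
    and "cmod (powr_transform \<theta> s) \<le> \<bar>s\<bar> powr (-\<theta>) * (1 / (1 - \<theta>) + 1 / \<theta>)"
    and "\<bar>s\<bar> powr (-\<theta>) / 4 \<le> cmod (powr_transform \<theta> s)"
proof -
  have h: "((\<lambda>t. t powr (-\<theta>) / max t \<bar>s\<bar>) has_integral \<bar>s\<bar> powr (-\<theta>) * (1 / (1 - \<theta>) + 1 / \<theta>)) {0..}"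
    by (rule has_integral_powr_div_max) (use \<theta> s in auto)
  have loc: "?f integrable_on {a..b}" if "0 < a" for a b
    by (intro integrable_continuous_interval continuous_intros) (use that ne_imaginary in auto)
  have le: "norm (?f r) \<le> r powr (-\<theta>) / max r \<bar>s\<bar>" if "r > 0" for r
  proof -
    have "inverse (cmod (of_real r - \<i> * of_real s)) \<le> inverse (max r \<bar>s\<bar>)"
      using that max_le_cmod[of r s] by (intro le_imp_inverse_le) auto
    then show ?thesis by (simp add: norm_inverse divide_inverse mult_left_mono)
  qed
  note d = dominated_integrable[OF loc has_integral_integrable[OF h] le]
  show int: "?f integrable_on {0..}" by (rule d(1))
  show "cmod (powr_transform \<theta> s) \<le> \<bar>s\<bar> powr (-\<theta>) * (1 / (1 - \<theta>) + 1 / \<theta>)"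
    using d(2) integral_unique[OF h] by (simp add: powr_transform_def)
  have bl: "bounded_linear (\<lambda>z. sgn s * Im z)"
    using bounded_linear_Im by (rule bounded_linear_const_mult)
  have Im: "sgn s * Im (?f r) = r powr (-\<theta>) * (\<bar>s\<bar> / (r\<^sup>2 + \<bar>s\<bar>\<^sup>2))" for r
  proof -
    have "Im (?f r) = r powr (-\<theta>) * (s / (r\<^sup>2 + s\<^sup>2))"
      by (simp add: Im_divide inverse_eq_divide power2_eq_square)
    then have "sgn s * Im (?f r) = r powr (-\<theta>) * ((sgn s * s) / (r\<^sup>2 + s\<^sup>2))" by simp
    moreover have "s\<^sup>2 = \<bar>s\<bar>\<^sup>2" by simp
    moreover have "sgn s * s = \<bar>s\<bar>" by (simp add: sgn_if)
    ultimately show ?thesis by (simp only:)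
  qed
  have "\<bar>s\<bar> powr (-\<theta>) / (2 * \<bar>s\<bar>) * (\<bar>s\<bar> - \<bar>s\<bar> / 2) \<le> integral {0..} (\<lambda>r. sgn s * Im (?f r))"
  proof (rule integral_lower_bound)
    show "(\<lambda>r. sgn s * Im (?f r)) integrable_on {0..}"
      using integrable_linear[OF int bl] by (simp add: o_def)
    show "\<bar>s\<bar> powr - \<theta> / (2 * \<bar>s\<bar>) \<le> sgn s * Im (?f r)" if "r \<in> {\<bar>s\<bar> / 2..\<bar>s\<bar>}" for r
      unfolding Im using powr_kernel_lower(1)[OF \<theta>(1) _ that] s by auto
    show "0 \<le> sgn s * Im (?f r)" for r unfolding Im by simp
  qed (use s in auto)
  also have "integral {0..} (\<lambda>r. sgn s * Im (?f r)) = sgn s * Im (powr_transform \<theta> s)"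
    using integral_linear[OF int bl] by (simp add: o_def powr_transform_def)
  also have "\<dots> \<le> \<bar>Im (powr_transform \<theta> s)\<bar>" using s by (auto simp: sgn_if)
  also have "\<dots> \<le> cmod (powr_transform \<theta> s)" by (rule abs_Im_le_cmod)
  finally show "\<bar>s\<bar> powr (-\<theta>) / 4 \<le> cmod (powr_transform \<theta> s)" using s by simp
qed

text \<open>
  The counterpart of \<open>powr_transform_bounds\<close> with \<open>-is\<close> replaced by \<open>a > 0\<close>. It is a constant times \<open>a\<^sup>-\<^sup>\<theta>\<close>; the proof
  uses its order of magnitude.
\<close>

lemma powr_transform_neg_axis:
  assumes \<theta>: "0 < \<theta>" "\<theta> < 1" and a: "0 < (a::real)"
  shows "(\<lambda>r. r powr (-\<theta>) / (r + a)) integrable_on {0..}"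
    and "integral {0..} (\<lambda>r. r powr (-\<theta>) / (r + a)) \<le> a powr (-\<theta>) * (1 / (1 - \<theta>) + 1 / \<theta>)"
    and "a powr (-\<theta>) / 4 \<le> integral {0..} (\<lambda>r. r powr (-\<theta>) / (r + a))"
proof -
  let ?f = "\<lambda>r. r powr (-\<theta>) / (r + a)"
  have h: "((\<lambda>t. t powr (-\<theta>) / max t a) has_integral a powr (-\<theta>) * (1 / (1 - \<theta>) + 1 / \<theta>)) {0..}"
    by (rule has_integral_powr_div_max) (use \<theta> a in auto)
  have loc: "?f integrable_on {u..v}" if "0 < u" for u v
    by (intro integrable_continuous_interval continuous_intros) (use that a in auto)
  have le: "norm (?f r) \<le> r powr (-\<theta>) / max r a" if "r > 0" for r
    using that a by (auto intro!: divide_left_mono)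
  note d = dominated_integrable[OF loc has_integral_integrable[OF h] le]
  show int: "?f integrable_on {0..}" by (rule d(1))
  show "integral {0..} ?f \<le> a powr (-\<theta>) * (1 / (1 - \<theta>) + 1 / \<theta>)"
    using d(2) integral_unique[OF h] by simp
  have "a powr (-\<theta>) / (2 * a) * (a - a / 2) \<le> integral {0..} ?f"
    by (rule integral_lower_bound[OF int]) (use powr_kernel_lower(2)[OF \<theta>(1) a] a in auto)
  then show "a powr (-\<theta>) / 4 \<le> integral {0..} ?f" using a by simp
qed

lemma inverse_line_le:
  assumes "r \<ge> 0" "\<bar>s\<bar> \<ge> 1"
  shows "cmod (inverse (of_real r - \<i> * of_real s)) \<le> max 1 r powr (-1)"
    and "cmod (inverse (of_real r - \<i> * of_real s)) \<le> 1"
    and "cmod (inverse (of_real r - \<i> * of_real s)) \<le> 1 / \<bar>s\<bar>"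
proof -
  have m: "max r \<bar>s\<bar> \<le> cmod (of_real r - \<i> * of_real s)" by (rule max_le_cmod[OF assms(1)])
  have "inverse (cmod (of_real r - \<i> * of_real s)) \<le> inverse (max 1 r)"
    using m assms by (intro le_imp_inverse_le) auto
  then show "cmod (inverse (of_real r - \<i> * of_real s)) \<le> max 1 r powr (-1)"
    by (simp add: norm_inverse powr_minus)
  have "inverse (cmod (of_real r - \<i> * of_real s)) \<le> inverse 1"
    using m assms by (intro le_imp_inverse_le) auto
  then show "cmod (inverse (of_real r - \<i> * of_real s)) \<le> 1" by (simp add: norm_inverse)
  have "inverse (cmod (of_real r - \<i> * of_real s)) \<le> inverse \<bar>s\<bar>"
    using m assms by (intro le_imp_inverse_le) auto
  then show "cmod (inverse (of_real r - \<i> * of_real s)) \<le> 1 / \<bar>s\<bar>"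
    by (simp add: norm_inverse norm_divide inverse_eq_divide)
qed

section \<open>Monotone functions of regular growth\<close>

text \<open>
  The properties of \<open>g(s) = s\<^bsup>1-\<beta>\<^esup> l(s)\<close> that matter, with \<open>\<rho> = 1 - \<beta>\<close>. For a monotone function, the
  limit along the single ratio \<open>2\<close> controls all the others.
\<close>

locale regular_growth =
  fixes g :: "real \<Rightarrow> real" and \<rho> :: real
  assumes mono: "mono_on {0..} g" and pos: "\<And>s. s > 0 \<Longrightarrow> g s > 0"
    and \<rho>: "0 \<le> \<rho>" "\<rho> < 1"
    and doubling: "((\<lambda>s. g (2 * s) / g s) \<longlongrightarrow> 2 powr \<rho>) at_top"
begin

lemma nonneg: "s > 0 \<Longrightarrow> 0 \<le> g s"
  using pos[of s] by simp

text \<open>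
  Iterate \<open>g(2s) \<le> 2\<^sup>\<eta> g(s)\<close> and use monotonicity between consecutive dyadic multiples of \<open>s\<close>; the
  factor \<open>2\<^sup>\<eta>\<close> pays for rounding \<open>r / s\<close> up to a power of two.
\<close>

lemma potter_bound:
  assumes \<eta>: "\<rho> < \<eta>"
  obtains r0 where "1 \<le> r0"
    and "\<And>s r. r0 \<le> s \<Longrightarrow> s \<le> r \<Longrightarrow> g r \<le> 2 powr \<eta> * (r / s) powr \<eta> * g s"
proof -
  have "eventually (\<lambda>s. g (2 * s) / g s < 2 powr \<eta>) at_top"
    by (rule order_tendstoD(2)[OF doubling]) (use \<eta> in auto)
  then obtain r1 where r1: "\<And>s. s \<ge> r1 \<Longrightarrow> g (2 * s) / g s < 2 powr \<eta>"
    by (auto simp: eventually_at_top_linorder)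
  define r0 where "r0 = max 1 r1"
  have dbl: "g (2 * s) \<le> 2 powr \<eta> * g s" if "s \<ge> r0" for s
    using r1[of s] pos[of s] that by (simp add: r0_def field_simps)
  have iter: "g (2 ^ k * s) \<le> (2 powr \<eta>) ^ k * g s" if s: "s \<ge> r0" for s k
  proof (induction k)
    case (Suc k)
    have "1 * s \<le> 2 ^ k * s" using s by (intro mult_right_mono) (auto simp: r0_def)
    then have "g (2 * (2 ^ k * s)) \<le> 2 powr \<eta> * g (2 ^ k * s)" using s by (intro dbl) auto
    also have "\<dots> \<le> 2 powr \<eta> * ((2 powr \<eta>) ^ k * g s)" using Suc by (intro mult_left_mono) auto
    finally show ?case by (simp add: mult_ac)
  qed simp
  show ?thesis
  proof (rule that[of r0])
    fix s r assume s: "r0 \<le> s" "s \<le> r"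
    have s0: "s > 0" using s by (auto simp: r0_def)
    define k where "k = nat \<lceil>log 2 (r / s)\<rceil>"
    have rs: "r / s \<ge> 1" using s s0 by simp
    then have l0: "log 2 (r / s) \<ge> 0" by simp
    have k: "log 2 (r / s) \<le> k" "k \<le> log 2 (r / s) + 1"
      using l0 by (auto simp: k_def)
    \<comment> \<open>\<open>2\<^sup>k\<close> is the least power of two that is at least \<open>r / s\<close>.\<close>
    have "r / s = 2 powr log 2 (r / s)" using rs by simp
    also have "\<dots> \<le> 2 powr k" using k by (intro powr_mono) auto
    finally have "r \<le> 2 ^ k * s" using s0 by (simp add: powr_realpow field_simps)
    then have "g r \<le> g (2 ^ k * s)" using s s0 by (intro mono_onD[OF mono]) auto
    also have "\<dots> \<le> (2 powr \<eta>) ^ k * g s" by (rule iter[OF s(1)])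
    also have "(2 powr \<eta>) ^ k = 2 powr (\<eta> * k)" by (simp add: powr_powr[symmetric] powr_realpow)
    also have "2 powr (\<eta> * k) \<le> 2 powr (\<eta> * (log 2 (r / s) + 1))"
      using k \<eta> \<rho> by (intro powr_mono mult_left_mono) auto
    also have "\<dots> = 2 powr \<eta> * (r / s) powr \<eta>"
      using rs by (simp add: powr_add powr_powr[symmetric] distrib_left mult.commute[of \<eta>])
    finally show "g r \<le> 2 powr \<eta> * (r / s) powr \<eta> * g s"
      using pos[OF s0] by (simp add: mult_right_mono)
  qed (simp add: r0_def)
qed

lemma polynomial_bound:
  assumes \<eta>: "\<rho> < \<eta>"
  obtains C where "0 < C" and "\<And>r. 0 \<le> r \<Longrightarrow> g r \<le> C * max 1 r powr \<eta>"
proof -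
  obtain r0 where r0: "1 \<le> r0" "\<And>s r. r0 \<le> s \<Longrightarrow> s \<le> r \<Longrightarrow> g r \<le> 2 powr \<eta> * (r / s) powr \<eta> * g s"
    using potter_bound[OF \<eta>] by blast
  have \<eta>0: "\<eta> > 0" using \<eta> \<rho> by simp
  define C where "C = 2 powr \<eta> * g r0"
  have g0: "g r0 > 0" using pos r0 by simp
  show ?thesis
  proof (rule that[of C])
    show "0 < C" using g0 by (simp add: C_def)
    fix r :: real assume r: "0 \<le> r"
    show "g r \<le> C * max 1 r powr \<eta>"
    proof (cases "r \<le> r0")
      case True
      then have "g r \<le> g r0" using r r0 by (intro mono_onD[OF mono]) auto
      also have "\<dots> \<le> 2 powr \<eta> * g r0 * max 1 r powr \<eta>"
      proof -
        have "1 * 1 \<le> 2 powr \<eta> * max 1 r powr \<eta>"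
          by (intro mult_mono ge_one_powr_ge_zero) (use \<eta>0 in auto)
        from mult_right_mono[OF this, of "g r0"] show ?thesis using g0 by (simp add: mult_ac)
      qed
      finally show ?thesis by (simp add: C_def)
    next
      case False
      then have "g r \<le> 2 powr \<eta> * (r / r0) powr \<eta> * g r0" using r0 by auto
      also have "\<dots> \<le> 2 powr \<eta> * (max 1 r) powr \<eta> * g r0"
        using r r0(1) \<eta>0 g0 False
        by (intro mult_right_mono mult_left_mono powr_mono2) (auto simp: divide_simps mult_le_cancel_left1)
      finally show ?thesis by (simp add: C_def mult_ac)
    qed
  qed
qed

lemma dominating_integrable:
  assumes p: "\<rho> + p < -1" and F0: "\<And>r. r > 0 \<Longrightarrow> 0 \<le> K r"
    and F: "\<And>r. r > 0 \<Longrightarrow> K r \<le> D * max 1 r powr p" and c: "continuous_on {0<..} K"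
  shows "(\<lambda>r. g r * K r) integrable_on {0..}"
proof -
  \<comment> \<open>Any exponent strictly between \<open>\<rho>\<close> and \<open>- 1 - p\<close> would do; this is the midpoint.\<close>
  define \<eta> where "\<eta> = (\<rho> + (- 1 - p)) / 2"
  have \<eta>: "\<rho> < \<eta>" "\<eta> + p < -1" using p by (simp_all add: \<eta>_def field_simps)
  obtain C where C: "0 < C" "\<And>r. 0 \<le> r \<Longrightarrow> g r \<le> C * max 1 r powr \<eta>"
    using polynomial_bound[OF \<eta>(1)] by blast
  have D: "D \<ge> 0" using order_trans[OF F0 F, of 1] by simp
  show ?thesis
  proof (rule dominated_integrable(1))
    fix a b :: real assume a: "0 < a"
    have "(\<lambda>r. g r *\<^sub>R K r) integrable_on {a..b}"
      by (rule integrable_mono_scaleR_continuous)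
        (use a mono c in \<open>auto intro: mono_on_subset continuous_on_subset\<close>)
    then show "(\<lambda>r. g r * K r) integrable_on {a..b}" by simp
  next
    show "(\<lambda>r. (C * D) * max 1 r powr (\<eta> + p)) integrable_on {0..}"
      using has_integral_max_powr[OF \<eta>(2), of 1] by (intro integrable_on_mult_right) auto
    fix r :: real assume r: "r > 0"
    have "norm (g r * K r) = g r * K r" using F0[OF r] nonneg[OF r] by simp
    also have "\<dots> \<le> (C * max 1 r powr \<eta>) * (D * max 1 r powr p)"
      using C F[OF r] F0[OF r] r by (intro mult_mono) (auto intro: less_imp_le)
    finally show "norm (g r * K r) \<le> (C * D) * max 1 r powr (\<eta> + p)"
      by (simp add: powr_add mult_ac)
  qed
qed

text \<open>
  The value \<open>S\<^sub>g(-is)\<close> of the Stieltjes function of \<open>g\<close>.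
\<close>

definition transform :: "real \<Rightarrow> complex"
  where "transform s = integral {0..} (\<lambda>r. g r *\<^sub>R inverse (of_real r - \<i> * of_real s) ^ 2)"

lemma transform_kernel_local:
  "0 < a \<Longrightarrow> (\<lambda>r. g r *\<^sub>R inverse (of_real r - \<i> * of_real s) ^ 2) integrable_on {a..b}"
  by (intro integrable_mono_scaleR_continuous continuous_intros)
    (use mono ne_imaginary in \<open>auto intro: mono_on_subset\<close>)

lemma transform_kernel_le:
  assumes "r > 0"
  shows "norm (g r *\<^sub>R inverse (of_real r - \<i> * of_real s) ^ 2) \<le> g r * max \<bar>s\<bar> r powr (-2)"
proof -
  have "inverse (cmod (of_real r - \<i> * of_real s)) \<le> inverse (max \<bar>s\<bar> r)"
    using assms max_le_cmod[of r s] by (intro le_imp_inverse_le) auto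
  then have "(inverse (cmod (of_real r - \<i> * of_real s)))\<^sup>2 \<le> (inverse (max \<bar>s\<bar> r))\<^sup>2"
    using assms by (intro power_mono) auto
  also have "\<dots> = max \<bar>s\<bar> r powr (-2)"
    using assms by (simp add: powr_minus powr_numeral power_inverse)
  finally show ?thesis
    using nonneg[OF assms] by (simp add: norm_inverse norm_power mult_left_mono)
qed

lemma dominating2: "(\<lambda>r. g r * max 1 r powr (-2)) integrable_on {0..}"
  by (rule dominating_integrable[of "-2" _ 1]) (use \<rho> in \<open>auto intro!: continuous_intros\<close>)

lemma transform_integrable:
  assumes "\<bar>s\<bar> \<ge> 1"
  shows "(\<lambda>r. g r *\<^sub>R inverse (of_real r - \<i> * of_real s) ^ 2) integrable_on {0..}"
    and "cmod (transform s) \<le> integral {0..} (\<lambda>r. g r * max 1 r powr (-2))"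
proof -
  have le: "norm (g r *\<^sub>R inverse (of_real r - \<i> * of_real s) ^ 2) \<le> g r * max 1 r powr (-2)" if "r > 0" for r
    by (rule order_trans[OF transform_kernel_le[OF that]])
      (use that assms nonneg in \<open>auto intro!: mult_left_mono powr_mono2'\<close>)
  note d = dominated_integrable[OF transform_kernel_local dominating2 le]
  show "(\<lambda>r. g r *\<^sub>R inverse (of_real r - \<i> * of_real s) ^ 2) integrable_on {0..}" by (rule d(1))
  show "cmod (transform s) \<le> integral {0..} (\<lambda>r. g r * max 1 r powr (-2))"
    unfolding transform_def by (rule d(2))
qed

text \<open>
  With \<open>\<eta> < 1\<close> in the bound for the growth of \<open>g\<close>, the part of the integral over \<open>r > \<bar>s\<bar>\<close> converges and is
  of the same order \<open>g(\<bar>s\<bar>) / \<bar>s\<bar>\<close> as the part over \<open>r \<le> \<bar>s\<bar>\<close>.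
\<close>

lemma transform_upper:
  obtains r0 C where "1 \<le> r0" "0 < C" "\<And>s. r0 \<le> \<bar>s\<bar> \<Longrightarrow> cmod (transform s) \<le> C * (g \<bar>s\<bar> / \<bar>s\<bar>)"
proof -
  define \<eta> where "\<eta> = (1 + \<rho>) / 2"
  have \<eta>: "\<rho> < \<eta>" "\<eta> < 1" "0 < \<eta>" using \<rho> by (auto simp: \<eta>_def)
  obtain r0 where r0: "1 \<le> r0" "\<And>s r. r0 \<le> s \<Longrightarrow> s \<le> r \<Longrightarrow> g r \<le> 2 powr \<eta> * (r / s) powr \<eta> * g s"
    using potter_bound[OF \<eta>(1)] by blast
  define C where "C = 2 powr \<eta> * (1 - 1 / (\<eta> - 1))"
  show ?thesis
  proof (rule that[OF r0(1)])
    have "0 < 1 - 1 / (\<eta> - 1)" using \<eta> by (simp add: field_simps)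
    then show "0 < C" by (simp add: C_def)
    fix s assume s: "r0 \<le> \<bar>s\<bar>"
    define a where "a = \<bar>s\<bar>"
    have a: "a \<ge> r0" "a > 0" using s r0 by (auto simp: a_def)
    define h where "h r = (2 powr \<eta> * g a * a powr (-\<eta>)) * max a r powr (\<eta> - 2)" for r
    have hI: "(h has_integral (2 powr \<eta> * g a * a powr (-\<eta>)) * (a powr (\<eta> - 2 + 1) * (1 - 1 / (\<eta> - 2 + 1)))) {0..}"
      unfolding h_def by (rule has_integral_mult_right[OF has_integral_max_powr]) (use \<eta> a in auto)
    have le: "norm (g r *\<^sub>R inverse (of_real r - \<i> * of_real s) ^ 2) \<le> h r" if r: "r > 0" for r
    proof -
      have "g r \<le> g (max a r)" using r a by (intro mono_onD[OF mono]) auto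
      also have "\<dots> \<le> 2 powr \<eta> * (max a r / a) powr \<eta> * g a" using r0(2)[of a "max a r"] a by auto
      finally have "g r * max a r powr (-2) \<le> (2 powr \<eta> * (max a r / a) powr \<eta> * g a) * max a r powr (-2)"
        by (rule mult_right_mono) simp
      also have "\<dots> = h r"
        using a by (simp add: h_def powr_divide powr_minus powr_diff field_simps)
      finally show ?thesis using transform_kernel_le[OF r, of s] unfolding a_def by linarith
    qed
    have "cmod (transform s) \<le> integral {0..} h" unfolding transform_def
      by (rule dominated_integrable(2)[OF transform_kernel_local has_integral_integrable[OF hI] le])
    also have "\<dots> = C * (g a * (a powr (-\<eta>) * a powr (\<eta> - 1)))"
      unfolding integral_unique[OF hI] by (simp add: C_def mult_ac)
    also have "a powr (-\<eta>) * a powr (\<eta> - 1) = 1 / a"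
      using a powr_add[of a "-\<eta>" "\<eta> - 1"] by (simp add: powr_minus inverse_eq_divide)
    finally show "cmod (transform s) \<le> C * (g \<bar>s\<bar> / \<bar>s\<bar>)" by (simp add: a_def)
  qed
qed

text \<open>
  The imaginary part of \<open>(r - is)\<^sup>-\<^sup>2\<close> is \<open>2 r s / (r\<^sup>2 + s\<^sup>2)\<^sup>2\<close>. It has the sign of \<open>s\<close> for all \<open>r > 0\<close>, so nothing
  cancels and the interval \<open>[\<bar>s\<bar>, 2\<bar>s\<bar>]\<close>, on which \<open>g(r) \<ge> g(\<bar>s\<bar>)\<close>, already gives the right order.
\<close>

lemma transform_lower:
  assumes "\<bar>s\<bar> \<ge> 1"
  shows "2 / 25 * (g \<bar>s\<bar> / \<bar>s\<bar>) \<le> cmod (transform s)"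
proof -
  let ?f = "\<lambda>r. g r *\<^sub>R inverse (of_real r - \<i> * of_real s) ^ 2"
  define a where "a = \<bar>s\<bar>"
  have a: "a \<ge> 1" using assms by (simp add: a_def)
  note int = transform_integrable(1)[OF assms]
  have bl: "bounded_linear (\<lambda>z. sgn s * Im z)"
    using bounded_linear_Im by (rule bounded_linear_const_mult)
  have Im: "sgn s * Im (?f r) = g r * (2 * r * a / (r\<^sup>2 + a\<^sup>2)\<^sup>2)" if "r > 0" for r
  proof -
    have "inverse (of_real r - \<i> * of_real s) = Complex (r / (r\<^sup>2 + s\<^sup>2)) (s / (r\<^sup>2 + s\<^sup>2))"
      by (simp add: complex_eq_iff Re_divide Im_divide inverse_eq_divide power2_eq_square)
    then have "Im (inverse (of_real r - \<i> * of_real s) ^ 2) = 2 * r * s / (r\<^sup>2 + s\<^sup>2)\<^sup>2"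
      by (simp add: power2_eq_square)
    then have "sgn s * Im (?f r) = g r * (2 * r * (sgn s * s) / (r\<^sup>2 + s\<^sup>2)\<^sup>2)"
      by simp
    moreover have "s\<^sup>2 = a\<^sup>2" by (simp add: a_def)
    moreover have "sgn s * s = a" by (simp add: a_def sgn_if)
    ultimately show ?thesis by simp
  qed
  have "(g a * (2 / (25 * a\<^sup>2))) * (2 * a - a) \<le> integral {0..} (\<lambda>r. sgn s * Im (?f r))"
  proof (rule integral_lower_bound)
    show "(\<lambda>r. sgn s * Im (?f r)) integrable_on {0..}"
      using integrable_linear[OF int bl] by (simp add: o_def)
    show "0 \<le> sgn s * Im (?f r)" if "r > 0" for r
      unfolding Im[OF that] using that a nonneg[OF that] by simp
    fix r assume r: "r \<in> {a..2 * a}"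
    have "r\<^sup>2 \<le> (2 * a)\<^sup>2" using r a by (intro power_mono) auto
    then have "r\<^sup>2 + a\<^sup>2 \<le> 5 * a\<^sup>2" by (simp add: power_mult_distrib)
    then have "(r\<^sup>2 + a\<^sup>2)\<^sup>2 \<le> (5 * a\<^sup>2)\<^sup>2" by (intro power_mono) auto
    then have "(2 * a * a) / (5 * a\<^sup>2)\<^sup>2 \<le> 2 * r * a / (r\<^sup>2 + a\<^sup>2)\<^sup>2"
      using r a by (intro frac_le mult_mono) (auto simp: add_pos_pos)
    moreover have "(2 * a * a) / (5 * a\<^sup>2)\<^sup>2 = 2 / (25 * a\<^sup>2)"
      using a by (simp add: power2_eq_square)
    moreover have "g a \<le> g r" using r a by (intro mono_onD[OF mono]) auto
    ultimately have "g a * (2 / (25 * a\<^sup>2)) \<le> g r * (2 * r * a / (r\<^sup>2 + a\<^sup>2)\<^sup>2)"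
      using r a nonneg by (intro mult_mono) auto
    then show "g a * (2 / (25 * a\<^sup>2)) \<le> sgn s * Im (?f r)"
      using r a by (subst Im) auto
  qed (use a in auto)
  also have "integral {0..} (\<lambda>r. sgn s * Im (?f r)) = sgn s * Im (transform s)"
    using integral_linear[OF int bl] by (simp add: o_def transform_def)
  also have "\<dots> \<le> \<bar>Im (transform s)\<bar>" by (auto simp: sgn_if)
  also have "\<dots> \<le> cmod (transform s)" by (rule abs_Im_le_cmod)
  finally have "(g a * (2 / (25 * a\<^sup>2))) * (2 * a - a) \<le> cmod (transform s)" .
  moreover have "(g a * (2 / (25 * a\<^sup>2))) * (2 * a - a) = 2 / 25 * (g a / a)"
    using a by (simp add: power2_eq_square)
  ultimately show ?thesis by (simp add: a_def)
qed

lemma growth_dominated: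
  fixes K :: "real \<Rightarrow> 'b::banach"
  assumes p: "\<rho> + p < -1" and K: "continuous_on {0<..} K"
    and le: "\<And>r. r > 0 \<Longrightarrow> norm (K r) \<le> D * max 1 r powr p"
  shows "(\<lambda>r. g r *\<^sub>R K r) integrable_on {0..}"
    and "norm (integral {0..} (\<lambda>r. g r *\<^sub>R K r)) \<le> D * integral {0..} (\<lambda>r. g r * max 1 r powr p)"
proof -
  have h0: "(\<lambda>r. g r * max 1 r powr p) integrable_on {0..}"
    by (rule dominating_integrable[OF p, of _ 1]) (auto intro!: continuous_intros)
  then have h: "(\<lambda>r. D * (g r * max 1 r powr p)) integrable_on {0..}"
    by (rule integrable_on_mult_right)
  have loc: "(\<lambda>r. g r *\<^sub>R K r) integrable_on {a..b}" if "0 < a" for a b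
    by (rule integrable_mono_scaleR_continuous)
      (use that mono K in \<open>auto intro: mono_on_subset continuous_on_subset\<close>)
  have "norm (g r *\<^sub>R K r) \<le> D * (g r * max 1 r powr p)" if "r > 0" for r
    using mult_left_mono[OF le[OF that] nonneg[OF that]] nonneg[OF that] by (simp add: mult_ac)
  note d = dominated_integrable[OF loc h this]
  show "(\<lambda>r. g r *\<^sub>R K r) integrable_on {0..}" by (rule d(1))
  show "norm (integral {0..} (\<lambda>r. g r *\<^sub>R K r)) \<le> D * integral {0..} (\<lambda>r. g r * max 1 r powr p)"
    using d(2) by simp
qed

end

section \<open>The resolvent on the positive half-line\<close>

context resolvent_family
begin

lemma R_cop: "Re z \<ge> 0 \<Longrightarrow> R z o\<^sub>L cop w = cop w o\<^sub>L R z"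
  by (rule clinear_op_cop_commute[OF clin])

lemma R_commute:
  assumes "Re z \<ge> 0" "Re w \<ge> 0"
  shows "R z o\<^sub>L R w = R w o\<^sub>L R z"
proof (cases "z = w")
  case False
  have "cop (w - z) o\<^sub>L (R w o\<^sub>L R z) = cop (w - z) o\<^sub>L (R z o\<^sub>L R w)"
  proof -
    have "cop (w - z) o\<^sub>L (R w o\<^sub>L R z) = - (R w - R z)"
      by (simp add: resolvent[OF assms, symmetric])
    also have "\<dots> = (- cop (z - w)) o\<^sub>L (R z o\<^sub>L R w)"
      by (simp only: resolvent[OF assms(2,1)] comp.minus_left)
    also have "- cop (z - w) = cop (w - z)"
      by (simp add: cop_minus[symmetric])
    finally show ?thesis .
  qed
  then have "cop (inverse (w - z)) o\<^sub>L (cop (w - z) o\<^sub>L (R w o\<^sub>L R z)) = cop (inverse (w - z)) o\<^sub>L (cop (w - z) o\<^sub>L (R z o\<^sub>L R w))"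
    by simp
  then show ?thesis using False by (simp add: comp_assoc[symmetric] cop_mult)
qed simp

lemma R_prod:
  assumes "Re z \<ge> 0" "Re w \<ge> 0" "z \<noteq> w"
  shows "R z o\<^sub>L R w = cop (inverse (w - z)) o\<^sub>L (R z - R w)"
  unfolding resolvent[OF assms(1,2)] R_commute[OF assms(1,2)]
  using assms(3) by (simp add: comp_assoc[symmetric] cop_mult)

definition Rr :: "real \<Rightarrow> 'a \<Rightarrow>\<^sub>L 'a"
  where "Rr r = R (of_real r)"

lemma Rr_diff: "0 \<le> r \<Longrightarrow> 0 \<le> t \<Longrightarrow> Rr r - Rr t = (t - r) *\<^sub>R (Rr t o\<^sub>L Rr r)"
  unfolding Rr_def using resolvent[of "of_real r" "of_real t"] cop_of_real_comp[of "t - r" "R (of_real t) o\<^sub>L R (of_real r)"]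
  by simp

lemma Rr_commute: "0 \<le> r \<Longrightarrow> 0 \<le> t \<Longrightarrow> Rr r o\<^sub>L Rr t = Rr t o\<^sub>L Rr r"
  unfolding Rr_def by (rule R_commute) auto

lemma Rr_le: "r > 0 \<Longrightarrow> norm (Rr r) \<le> M / r"
  using bound[of "of_real r"] by (simp add: Rr_def field_simps)

definition N where "N = (1 + M) * norm (R 0) + M"

lemma N_ge_1: "1 \<le> N"
  using M_ge_1 by (simp add: N_def add_increasing)

text \<open>
  Near \<open>0\<close> the bound \<open>M / r\<close> is useless; there \<open>R(r) = (1 - r R(r)) R(0)\<close> helps.
\<close>

lemma Rr_bound: "r \<ge> 0 \<Longrightarrow> norm (Rr r) \<le> N / max r 1"
proof (cases "r = 0")
  case True
  have "norm (R 0) \<le> N" using M_ge_1 by (simp add: N_def algebra_simps add_increasing)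
  then show ?thesis using True by (simp add: Rr_def)
next
  case False
  assume "r \<ge> 0"
  then have r: "r > 0" using False by simp
  show ?thesis
  proof (cases "r \<le> 1")
    case True
    have "Rr r = Rr 0 - r *\<^sub>R (Rr 0 o\<^sub>L Rr r)" using Rr_diff[of r 0] r by (simp add: algebra_simps)
    then have "norm (Rr r) \<le> norm (Rr 0) + r * norm (Rr 0 o\<^sub>L Rr r)"
      using norm_triangle_ineq4[of "Rr 0" "r *\<^sub>R (Rr 0 o\<^sub>L Rr r)"] r by simp
    also have "r * norm (Rr 0 o\<^sub>L Rr r) \<le> r * (norm (Rr 0) * (M / r))"
      using r by (intro mult_left_mono norm_comp_le Rr_le) auto
    finally show ?thesis using True r M_ge_1 by (simp add: N_def Rr_def algebra_simps)
  next
    case False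
    have "M / r \<le> N / r" using r M_ge_1 by (intro divide_right_mono) (auto simp: N_def)
    then show ?thesis using Rr_le[OF r] False by simp
  qed
qed

lemma Rr_le_N: "r \<ge> 0 \<Longrightarrow> norm (Rr r) \<le> N"
  by (rule order_trans[OF Rr_bound]) (use N_ge_1 in \<open>auto simp: divide_le_eq mult_le_cancel_left1\<close>)

lemma Rr_taylor:
  assumes "0 \<le> r" "0 \<le> t"
  shows "Rr t - Rr r - (t - r) *\<^sub>R (- (Rr r o\<^sub>L Rr r)) = (t - r)\<^sup>2 *\<^sub>R (Rr r o\<^sub>L (Rr r o\<^sub>L Rr t))"
proof -
  have d: "Rr t = Rr r - (t - r) *\<^sub>R (Rr r o\<^sub>L Rr t)"
    using Rr_diff[OF assms(2,1)] by (simp add: algebra_simps)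
  have "Rr r o\<^sub>L Rr t = (Rr r o\<^sub>L Rr r) - (t - r) *\<^sub>R (Rr r o\<^sub>L (Rr r o\<^sub>L Rr t))"
    using arg_cong[OF d, of "\<lambda>B. Rr r o\<^sub>L B"] unfolding comp.diff_right comp.scaleR_right .
  then have "Rr t = Rr r - (t - r) *\<^sub>R ((Rr r o\<^sub>L Rr r) - (t - r) *\<^sub>R (Rr r o\<^sub>L (Rr r o\<^sub>L Rr t)))"
    using d by metis
  moreover define Y where "Y = (Rr r o\<^sub>L (Rr r o\<^sub>L Rr t))"
  ultimately have "Rr t = Rr r - (t - r) *\<^sub>R ((Rr r o\<^sub>L Rr r) - (t - r) *\<^sub>R Y)" by simp
  then show ?thesis
    unfolding Y_def[symmetric] by (simp add: scaleR_diff_right power2_eq_square)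
qed

lemma Rr_taylor_bound:
  assumes "0 \<le> r" "0 \<le> t"
  shows "norm (Rr t - Rr r - (t - r) *\<^sub>R (- (Rr r o\<^sub>L Rr r))) \<le> N * (N * N) * (t - r)\<^sup>2"
proof -
  have "norm (Rr r o\<^sub>L (Rr r o\<^sub>L Rr t)) \<le> N * (N * N)"
    by (intro norm_comp_le Rr_le_N assms)
  from mult_left_mono[OF this, of "(t - r)\<^sup>2"] show ?thesis
    by (simp only: Rr_taylor[OF assms] norm_scaleR abs_power2 zero_le_power2 mult.commute[of "N * (N * N)"])
qed

lemma Rr_has_vector_derivative:
  "0 \<le> r \<Longrightarrow> (Rr has_vector_derivative (- (Rr r o\<^sub>L Rr r))) (at r within {0..})"
  by (rule has_vector_derivative_quadratic[OF Rr_taylor_bound]) auto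

lemma Rr_continuous: "continuous_on {0..} Rr"
  using Rr_has_vector_derivative
  by (auto simp: continuous_on_eq_continuous_within intro: has_vector_derivative_continuous)

lemma Rr_shift_continuous: "0 \<le> a \<Longrightarrow> continuous_on {0<..} (\<lambda>r. Rr (r + a))"
  by (intro continuous_on_compose2[OF Rr_continuous] continuous_intros) auto

lemma Rr_shift_bound: "0 \<le> a \<Longrightarrow> 0 < r \<Longrightarrow> norm (Rr (r + a)) \<le> N / max r 1"
  using N_ge_1 by (intro order_trans[OF Rr_bound] divide_left_mono) auto

section \<open>Fractional powers as integrals of the resolvent\<close>

text \<open>
  \<open>Q \<theta> a\<close> is \<open>\<pi> / sin (\<pi>\<theta>)\<close> times the fractional power \<open>(a + A)\<^sup>-\<^sup>\<theta>\<close>. The shift \<open>a\<close> serves as the independent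
  variable of a differential equation.
\<close>

definition Q :: "real \<Rightarrow> real \<Rightarrow> 'a \<Rightarrow>\<^sub>L 'a"
  where "Q \<theta> a = integral {0..} (\<lambda>r. r powr (-\<theta>) *\<^sub>R Rr (r + a))"

context
  fixes \<theta> :: real
  assumes \<theta>: "0 < \<theta>" "\<theta> < 1"
begin

lemma Q_integrable:
  assumes "0 \<le> a"
  shows "(\<lambda>r. r powr (-\<theta>) *\<^sub>R Rr (r + a)) integrable_on {0..}"
    and "(\<lambda>r. r powr (-\<theta>) *\<^sub>R (Rr (r + a) o\<^sub>L Rr (r + a))) integrable_on {0..}"
    and "(\<lambda>r. r powr (1 - \<theta>) *\<^sub>R (Rr (r + a) o\<^sub>L Rr (r + a))) integrable_on {0..}"
proof -
  note c = Rr_shift_continuous[OF assms] bounded_bilinear.continuous_on[OF bounded_bilinear_blinfun_compose]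
  show "(\<lambda>r. r powr (-\<theta>) *\<^sub>R Rr (r + a)) integrable_on {0..}"
  proof (rule powr_dominated(1)[OF \<theta>, of 1 _ N])
    show "norm (r powr (-\<theta>) *\<^sub>R Rr (r + a)) \<le> N * (r powr (-\<theta>) / max r 1)" if "r > 0" for r
      using mult_left_mono[OF Rr_shift_bound[OF assms that], of "r powr (-\<theta>)"] by (simp add: mult.commute)
  qed (auto intro!: continuous_intros c)
  show "(\<lambda>r. r powr (-\<theta>) *\<^sub>R (Rr (r + a) o\<^sub>L Rr (r + a))) integrable_on {0..}"
  proof (rule powr_dominated(1)[OF \<theta>, of 1 _ "N * N"])
    fix r :: real assume r: "r > 0"
    have "norm (Rr (r + a) o\<^sub>L Rr (r + a)) \<le> (N / max r 1) * N"
      by (intro norm_comp_le Rr_shift_bound Rr_le_N) (use r assms in auto)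
    from mult_left_mono[OF this, of "r powr (-\<theta>)"]
    show "norm (r powr (-\<theta>) *\<^sub>R (Rr (r + a) o\<^sub>L Rr (r + a))) \<le> N * N * (r powr (-\<theta>) / max r 1)"
      by (simp add: mult_ac)
  qed (auto intro!: continuous_intros c)
  show "(\<lambda>r. r powr (1 - \<theta>) *\<^sub>R (Rr (r + a) o\<^sub>L Rr (r + a))) integrable_on {0..}"
  proof (rule powr_dominated(1)[OF \<theta>, of 1 _ "N * N"])
    fix r :: real assume r: "r > 0"
    have "norm (Rr (r + a) o\<^sub>L Rr (r + a)) \<le> (N / max r 1) * (N / max r 1)"
      by (intro norm_comp_le Rr_shift_bound) (use r assms in auto)
    from mult_left_mono[OF this, of "r powr (-\<theta>) * r"]
    have "norm (r powr (1 - \<theta>) *\<^sub>R (Rr (r + a) o\<^sub>L Rr (r + a))) \<le> N * N * (r powr (-\<theta>) / max r 1) * (r / max r 1)"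
      using r powr_add[of r "-\<theta>" 1] by (simp add: mult_ac)
    also have "\<dots> \<le> N * N * (r powr (-\<theta>) / max r 1) * 1"
      using r N_ge_1 by (intro mult_left_mono) (auto simp: divide_le_eq)
    finally show "norm (r powr (1 - \<theta>) *\<^sub>R (Rr (r + a) o\<^sub>L Rr (r + a))) \<le> N * N * (r powr (-\<theta>) / max r 1)" by simp
  qed (auto intro!: continuous_intros c)
qed

lemma Q_commute:
  assumes "0 \<le> a" "Re z \<ge> 0"
  shows "Q \<theta> a o\<^sub>L R z = R z o\<^sub>L Q \<theta> a"
proof -
  have "Q \<theta> a o\<^sub>L R z = integral {0..} (\<lambda>r. (r powr (-\<theta>) *\<^sub>R Rr (r + a)) o\<^sub>L R z)"
    unfolding Q_def by (rule integral_comp_left(2)[symmetric, OF Q_integrable(1)[OF assms(1)]])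
  also have "\<dots> = integral {0..} (\<lambda>r. R z o\<^sub>L (r powr (-\<theta>) *\<^sub>R Rr (r + a)))"
    by (intro integral_cong) (use assms in \<open>auto simp: comp.scaleR_left comp.scaleR_right Rr_def intro!: R_commute\<close>)
  also have "\<dots> = R z o\<^sub>L Q \<theta> a"
    unfolding Q_def by (rule integral_comp_right(2)[OF Q_integrable(1)[OF assms(1)]])
  finally show ?thesis .
qed

text \<open>
  Integration by parts: \<open>- R(r + a)\<^sup>2\<close> is the derivative of \<open>R(r + a)\<close>, and \<open>r\<^bsup>1-\<theta>\<^esup> R(r + a)\<close> vanishes at both ends of the
  half-line.
\<close>

lemma Q_by_parts:
  assumes a: "0 \<le> a"
  shows "integral {0..} (\<lambda>r. r powr (1 - \<theta>) *\<^sub>R (Rr (r + a) o\<^sub>L Rr (r + a))) = (1 - \<theta>) *\<^sub>R Q \<theta> a"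
proof -
  define G where "G r = r powr (1 - \<theta>) *\<^sub>R Rr (r + a)" for r
  define G' where "G' r = (1 - \<theta>) *\<^sub>R (r powr (-\<theta>) *\<^sub>R Rr (r + a)) - r powr (1 - \<theta>) *\<^sub>R (Rr (r + a) o\<^sub>L Rr (r + a))" for r
  note c = Rr_shift_continuous[OF a] bounded_bilinear.continuous_on[OF bounded_bilinear_blinfun_compose]
  have deriv: "(G has_vector_derivative G' r) (at r)" if r: "r > 0" for r
  proof -
    have "(Rr has_vector_derivative (- (Rr (r + a) o\<^sub>L Rr (r + a)))) (at (r + a) within {0<..})"
      by (rule has_vector_derivative_within_subset[OF Rr_has_vector_derivative]) (use r a in auto)
    then have "(Rr has_vector_derivative (- (Rr (r + a) o\<^sub>L Rr (r + a)))) (at (r + a))"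
      using r a by (subst (asm) at_within_open) auto
    from vector_diff_chain_at[of "\<lambda>r. r + a" 1 r, OF _ this]
    have 1: "((\<lambda>r. Rr (r + a)) has_vector_derivative (- (Rr (r + a) o\<^sub>L Rr (r + a)))) (at r)"
      by (simp add: o_def has_vector_derivative_add_const)
    have 2: "((\<lambda>r. r powr (1 - \<theta>)) has_field_derivative (1 - \<theta>) * r powr (-\<theta>)) (at r)"
      using has_real_derivative_powr[OF r, of "1 - \<theta>"] by simp
    show ?thesis
      unfolding G_def G'_def using has_vector_derivative_scaleR[OF 2 1] by (simp add: algebra_simps)
  qed
  have GI: "integral {inverse (Suc n)..Suc n} G' = G (Suc n) - G (inverse (Suc n))" for n
  proof (rule integral_unique, rule fundamental_theorem_of_calculus)
    show "inverse (real (Suc n)) \<le> real (Suc n)"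
      by (rule order_trans[of _ 1]) (auto simp: inverse_le_1_iff)
    show "(G has_vector_derivative G' x) (at x within {inverse (real (Suc n))..real (Suc n)})"
      if "x \<in> {inverse (real (Suc n))..real (Suc n)}" for x
    proof -
      have "0 < inverse (real (Suc n))" by simp
      then have "x > 0" using that by (meson atLeastAtMost_iff less_le_trans)
      then show ?thesis by (rule has_vector_derivative_at_within[OF deriv])
    qed
  qed
  have lim: "(\<lambda>n. integral {inverse (Suc n)..Suc n} G') \<longlonglongrightarrow> integral {0..} G'"
  proof (rule powr_dominated(3)[OF \<theta>, of 1 _ "N + N * N"])
    show "continuous_on {0<..} G'" unfolding G'_def by (auto intro!: continuous_intros c)
    fix r :: real assume r: "r > 0"
    have 1: "norm ((1 - \<theta>) *\<^sub>R (r powr (-\<theta>) *\<^sub>R Rr (r + a))) \<le> N * (r powr (-\<theta>) / max r 1)"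
    proof -
      have "(1 - \<theta>) * (r powr (-\<theta>) * norm (Rr (r + a))) \<le> 1 * (r powr (-\<theta>) * (N / max r 1))"
        using \<theta> Rr_shift_bound[OF a r] N_ge_1 r by (intro mult_mono) auto
      then show ?thesis using \<theta> by (simp add: mult_ac)
    qed
    have "norm (Rr (r + a) o\<^sub>L Rr (r + a)) \<le> (N / max r 1) * (N / max r 1)"
      by (intro norm_comp_le Rr_shift_bound) (use r a in auto)
    from mult_left_mono[OF this, of "r powr (-\<theta>) * r"]
    have "norm (r powr (1 - \<theta>) *\<^sub>R (Rr (r + a) o\<^sub>L Rr (r + a))) \<le> N * N * (r powr (-\<theta>) / max r 1) * (r / max r 1)"
      using r powr_add[of r "-\<theta>" 1] by (simp add: mult_ac)
    also have "\<dots> \<le> N * N * (r powr (-\<theta>) / max r 1) * 1"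
      using r N_ge_1 by (intro mult_left_mono) (auto simp: divide_le_eq)
    finally show "norm (G' r) \<le> (N + N * N) * (r powr (-\<theta>) / max r 1)"
      unfolding G'_def distrib_right using 1 by (intro order_trans[OF norm_triangle_ineq4] add_mono) auto
  qed simp
  have Gle: "norm (G r) \<le> N * (r powr (1 - \<theta>) / max r 1)" if "r > 0" for r
    unfolding G_def using mult_left_mono[OF Rr_shift_bound[OF a that], of "r powr (1 - \<theta>)"] by (simp add: mult_ac)
  have Suc_top: "filterlim (\<lambda>n. real (Suc n)) at_top sequentially"
    by (rule filterlim_compose[OF filterlim_real_sequentially filterlim_Suc])
  have "(\<lambda>n. real (Suc n) powr (-\<theta>)) \<longlonglongrightarrow> 0"
    by (rule tendsto_neg_powr[OF _ Suc_top]) (use \<theta> in auto)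
  then have z1: "(\<lambda>n. N * real (Suc n) powr (-\<theta>)) \<longlonglongrightarrow> 0" by (rule tendsto_mult_right_zero)
  have "(\<lambda>n. G (Suc n)) \<longlonglongrightarrow> 0"
  proof (rule Lim_null_comparison[OF always_eventually z1], rule allI)
    fix n show "norm (G (Suc n)) \<le> N * real (Suc n) powr (-\<theta>)"
      using Gle[of "Suc n"] powr_diff[of "real (Suc n)" "1 - \<theta>" 1] by (simp add: max_def split: if_splits)
  qed
  moreover have "(\<lambda>n. G (inverse (Suc n))) \<longlonglongrightarrow> 0"
  proof -
    have "(\<lambda>n. real (Suc n) powr (-(1-\<theta>))) \<longlonglongrightarrow> 0"
      by (rule tendsto_neg_powr[OF _ Suc_top]) (use \<theta> in auto)
    then have z2: "(\<lambda>n. N * real (Suc n) powr (-(1-\<theta>))) \<longlonglongrightarrow> 0" by (rule tendsto_mult_right_zero)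
    show ?thesis
    proof (rule Lim_null_comparison[OF always_eventually z2], rule allI)
      fix n
      have "inverse (real (Suc n)) \<le> 1" by (simp add: inverse_le_1_iff)
      moreover have "inverse (real (Suc n)) powr (1 - \<theta>) = real (Suc n) powr (-(1-\<theta>))"
        by (simp only: powr_minus inverse_powr)
      ultimately show "norm (G (inverse (Suc n))) \<le> N * real (Suc n) powr (-(1-\<theta>))"
        using Gle[of "inverse (Suc n)"] by (simp add: max_def)
    qed
  qed
  ultimately have "(\<lambda>n. G (Suc n) - G (inverse (Suc n))) \<longlonglongrightarrow> 0 - 0" by (rule tendsto_diff)
  then have "integral {0..} G' = 0"
    using lim unfolding GI by (intro LIMSEQ_unique) auto
  moreover have "integral {0..} G' = (1 - \<theta>) *\<^sub>R Q \<theta> a - integral {0..} (\<lambda>r. r powr (1 - \<theta>) *\<^sub>R (Rr (r + a) o\<^sub>L Rr (r + a)))"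
    unfolding G'_def Q_def integral_cmul[symmetric]
    by (rule integral_diff[OF integrable_cmul[OF Q_integrable(1)[OF a]] Q_integrable(3)[OF a]])
  ultimately show ?thesis by simp
qed

text \<open>
  Insert \<open>R(r + a) = R(a) - r R(a) R(r + a)\<close> into one factor and integrate the second term by parts.
\<close>

lemma Q_square:
  assumes a: "0 \<le> a"
  shows "integral {0..} (\<lambda>r. r powr (-\<theta>) *\<^sub>R (Rr (r + a) o\<^sub>L Rr (r + a))) = \<theta> *\<^sub>R (Rr a o\<^sub>L Q \<theta> a)"
proof -
  have id: "r powr (-\<theta>) *\<^sub>R (Rr (r + a) o\<^sub>L Rr (r + a)) =
      (Rr a o\<^sub>L (r powr (-\<theta>) *\<^sub>R Rr (r + a))) - (Rr a o\<^sub>L (r powr (1 - \<theta>) *\<^sub>R (Rr (r + a) o\<^sub>L Rr (r + a))))"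
    if r: "r \<ge> 0" for r
  proof -
    have "Rr (r + a) = Rr a - r *\<^sub>R (Rr a o\<^sub>L Rr (r + a))"
      using Rr_diff[of "r + a" a] r a by (simp add: algebra_simps)
    from arg_cong[OF this, of "\<lambda>B. B o\<^sub>L Rr (r + a)"]
    have sq: "Rr (r + a) o\<^sub>L Rr (r + a) = (Rr a o\<^sub>L Rr (r + a)) - r *\<^sub>R (Rr a o\<^sub>L (Rr (r + a) o\<^sub>L Rr (r + a)))"
      unfolding comp.diff_left comp.scaleR_left comp_assoc .
    have pw: "r powr (1 - \<theta>) = r powr (-\<theta>) * r"
      using r powr_add[of r "-\<theta>" 1] by simp
    have "r powr (-\<theta>) *\<^sub>R (Rr (r + a) o\<^sub>L Rr (r + a)) =
        r powr (-\<theta>) *\<^sub>R ((Rr a o\<^sub>L Rr (r + a)) - r *\<^sub>R (Rr a o\<^sub>L (Rr (r + a) o\<^sub>L Rr (r + a))))"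
      by (rule arg_cong[OF sq])
    then show ?thesis by (simp only: comp.scaleR_right scaleR_diff_right scaleR_scaleR pw)
  qed
  note I = Q_integrable[OF a]
  have "integral {0..} (\<lambda>r. r powr (-\<theta>) *\<^sub>R (Rr (r + a) o\<^sub>L Rr (r + a)))
    = integral {0..} (\<lambda>r. (Rr a o\<^sub>L (r powr (-\<theta>) *\<^sub>R Rr (r + a))) - (Rr a o\<^sub>L (r powr (1 - \<theta>) *\<^sub>R (Rr (r + a) o\<^sub>L Rr (r + a)))))"
    by (intro integral_cong id) simp
  also have "\<dots> = (Rr a o\<^sub>L Q \<theta> a) - (Rr a o\<^sub>L ((1 - \<theta>) *\<^sub>R Q \<theta> a))"
    unfolding Q_by_parts[OF a, symmetric] unfolding Q_def
    using integral_comp_right[OF I(1), of "Rr a"] integral_comp_right[OF I(3), of "Rr a"] by (simp add: integral_diff)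
  also have "\<dots> = \<theta> *\<^sub>R (Rr a o\<^sub>L Q \<theta> a)"
    unfolding comp.scaleR_right by (simp add: scaleR_diff_left)
  finally show ?thesis .
qed

text \<open>
  The derivative expected of \<open>(a + A)\<^sup>-\<^sup>\<theta>\<close>. The integrand is expanded to second order in \<open>b - a\<close>, with a
  remainder that is integrable uniformly in \<open>b\<close>.
\<close>

lemma Q_has_vector_derivative:
  assumes a: "0 \<le> a"
  shows "(Q \<theta> has_vector_derivative - (\<theta> *\<^sub>R (Rr a o\<^sub>L Q \<theta> a))) (at a within {0..})"
proof (rule has_vector_derivative_quadratic)
  fix b :: real assume "b \<in> {0..}"
  then have b: "b \<ge> 0" by simp
  let ?K = "\<lambda>r. r powr (-\<theta>) *\<^sub>R (Rr (r + a) o\<^sub>L (Rr (r + a) o\<^sub>L Rr (r + b)))"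
  note c = Rr_shift_continuous[OF a] Rr_shift_continuous[OF b] bounded_bilinear.continuous_on[OF bounded_bilinear_blinfun_compose]
  have K: "norm (integral {0..} ?K) \<le> N * (N * N) * (1 powr (-\<theta>) * (1 / (1 - \<theta>) + 1 / \<theta>))"
  proof (rule powr_dominated(2)[OF \<theta>])
    fix r :: real assume r: "r > 0"
    have "norm (Rr (r + a) o\<^sub>L (Rr (r + a) o\<^sub>L Rr (r + b))) \<le> (N / max r 1) * (N * N)"
      by (intro norm_comp_le Rr_shift_bound Rr_le_N) (use r a b in auto)
    from mult_left_mono[OF this, of "r powr (-\<theta>)"]
    show "norm (?K r) \<le> N * (N * N) * (r powr (-\<theta>) / max r 1)" by (simp add: mult_ac)
  qed (auto intro!: continuous_intros c)
  note I = Q_integrable(1)[OF b] Q_integrable(1,2)[OF a]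
  have "Q \<theta> b - Q \<theta> a - (b - a) *\<^sub>R (- (\<theta> *\<^sub>R (Rr a o\<^sub>L Q \<theta> a)))
     = integral {0..} (\<lambda>r. r powr (-\<theta>) *\<^sub>R Rr (r + b) - r powr (-\<theta>) *\<^sub>R Rr (r + a)
          + (b - a) *\<^sub>R (r powr (-\<theta>) *\<^sub>R (Rr (r + a) o\<^sub>L Rr (r + a))))"
  proof -
    have i1: "(\<lambda>r. r powr (-\<theta>) *\<^sub>R Rr (r + b) - r powr (-\<theta>) *\<^sub>R Rr (r + a)) integrable_on {0..}"
      by (intro integrable_diff I)
    have i2: "(\<lambda>r. (b - a) *\<^sub>R (r powr (-\<theta>) *\<^sub>R (Rr (r + a) o\<^sub>L Rr (r + a)))) integrable_on {0..}"
      by (intro integrable_cmul I)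
    show ?thesis
      unfolding integral_add[OF i1 i2] integral_diff[OF I(1,2)] integral_cmul Q_square[OF a] Q_def
      by simp
  qed
  also have "\<dots> = integral {0..} (\<lambda>r. (b - a)\<^sup>2 *\<^sub>R ?K r)"
  proof (rule integral_cong)
    fix r :: real assume "r \<in> {0..}"
    then have "Rr (r + b) - Rr (r + a) - (b - a) *\<^sub>R (- (Rr (r + a) o\<^sub>L Rr (r + a)))
        = (b - a)\<^sup>2 *\<^sub>R (Rr (r + a) o\<^sub>L (Rr (r + a) o\<^sub>L Rr (r + b)))"
      using Rr_taylor[of "r + a" "r + b"] a b by simp
    from arg_cong[OF this, of "scaleR (r powr (-\<theta>))"]
    show "r powr (-\<theta>) *\<^sub>R Rr (r + b) - r powr (-\<theta>) *\<^sub>R Rr (r + a)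
          + (b - a) *\<^sub>R (r powr (-\<theta>) *\<^sub>R (Rr (r + a) o\<^sub>L Rr (r + a))) = (b - a)\<^sup>2 *\<^sub>R ?K r"
      by (simp add: scaleR_diff_right scaleR_add_right mult.commute)
  qed
  also have "\<dots> = (b - a)\<^sup>2 *\<^sub>R integral {0..} ?K" by (rule integral_cmul)
  finally show "norm (Q \<theta> b - Q \<theta> a - (b - a) *\<^sub>R (- (\<theta> *\<^sub>R (Rr a o\<^sub>L Q \<theta> a))))
      \<le> N * (N * N) * (1 powr (-\<theta>) * (1 / (1 - \<theta>) + 1 / \<theta>)) * (b - a)\<^sup>2"
    using mult_left_mono[OF K, of "(b - a)\<^sup>2"] by (simp add: mult.commute)
qed

end

lemma Q_decay:
  assumes \<theta>: "0 < \<theta>" "\<theta> < 1" and a: "0 < a"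
  shows "norm (Q \<theta> a) \<le> M * (a powr (-\<theta>) * (1 / (1 - \<theta>) + 1 / \<theta>))"
  unfolding Q_def
proof (rule powr_dominated(2)[OF \<theta> a])
  show "continuous_on {0<..} (\<lambda>r. r powr (-\<theta>) *\<^sub>R Rr (r + a))"
    using a by (auto intro!: continuous_intros Rr_shift_continuous)
  fix r :: real assume r: "r > 0"
  have "norm (Rr (r + a)) \<le> M / (r + a)" using r a by (intro Rr_le) auto
  also have "\<dots> \<le> M / max r a" using r a M_ge_1 by (intro divide_left_mono) auto
  finally show "norm (r powr (-\<theta>) *\<^sub>R Rr (r + a)) \<le> M * (r powr (-\<theta>) / max r a)"
    using mult_left_mono[of "norm (Rr (r + a))" "M / max r a" "r powr (-\<theta>)"] by (simp add: mult_ac)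
qed

text \<open>
  For large \<open>a\<close>, the operator \<open>(a + A)\<^sup>-\<^sup>\<theta>\<close> acts on the range of \<open>A\<^sup>-\<^sup>1\<close> like the number \<open>a\<^sup>-\<^sup>\<theta>\<close>.
\<close>

lemma Rr_Q_asymptotic:
  assumes \<theta>: "0 < \<theta>" "\<theta> < 1" and a: "0 < a"
  shows "norm ((Rr 0 o\<^sub>L Q \<theta> a) - integral {0..} (\<lambda>r. r powr (-\<theta>) / (r + a)) *\<^sub>R Rr 0)
    \<le> M / a * (a powr (-\<theta>) * (1 / (1 - \<theta>) + 1 / \<theta>))"
proof -
  let ?k = "\<lambda>r. r powr (-\<theta>) / (r + a)"
  let ?E = "\<lambda>r. ?k r *\<^sub>R Rr (r + a)"
  have E: "?E integrable_on {0..}"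
    "norm (integral {0..} ?E) \<le> M / a * (a powr (-\<theta>) * (1 / (1 - \<theta>) + 1 / \<theta>))"
  proof -
    have c: "continuous_on {0<..} ?E"
      using a by (auto intro!: continuous_intros Rr_shift_continuous)
    have le: "norm (?E r) \<le> M / a * (r powr (-\<theta>) / max r a)" if r: "r > 0" for r
    proof -
      have "norm (Rr (r + a)) \<le> M / (r + a)" using r a by (intro Rr_le) auto
      also have "\<dots> \<le> M / a" using r a M_ge_1 by (intro divide_left_mono) auto
      finally have "norm (Rr (r + a)) \<le> M / a" .
      moreover have "?k r \<le> r powr (-\<theta>) / max r a" using r a by (intro divide_left_mono) auto
      ultimately have "?k r * norm (Rr (r + a)) \<le> (r powr (-\<theta>) / max r a) * (M / a)"
        using r a by (intro mult_mono) auto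
      then show ?thesis using r a by (simp add: mult_ac)
    qed
    show "?E integrable_on {0..}"
      "norm (integral {0..} ?E) \<le> M / a * (a powr (-\<theta>) * (1 / (1 - \<theta>) + 1 / \<theta>))"
      by (rule powr_dominated[OF \<theta> a c le]; assumption)+
  qed
  note k = powr_transform_neg_axis(1)[OF \<theta> a]
  have k': "(\<lambda>r. ?k r *\<^sub>R Rr 0) integrable_on {0..}" "integral {0..} (\<lambda>r. ?k r *\<^sub>R Rr 0) = integral {0..} ?k *\<^sub>R Rr 0"
    using integrable_linear[OF k bounded_linear_scaleR_left[of "Rr 0"]]
      integral_linear[OF k bounded_linear_scaleR_left[of "Rr 0"]] by (simp_all add: o_def)
  have "Rr 0 o\<^sub>L Q \<theta> a = integral {0..} (\<lambda>r. Rr 0 o\<^sub>L (r powr (-\<theta>) *\<^sub>R Rr (r + a)))"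
    unfolding Q_def using a by (intro integral_comp_right(2)[symmetric] Q_integrable[OF \<theta>]) auto
  also have "\<dots> = integral {0..} (\<lambda>r. ?k r *\<^sub>R Rr 0 - ?E r)"
  proof (rule integral_cong)
    fix r :: real assume "r \<in> {0..}"
    then have r: "r \<ge> 0" by simp
    have "Rr 0 - Rr (r + a) = (r + a) *\<^sub>R (Rr 0 o\<^sub>L Rr (r + a))"
      using Rr_diff[of 0 "r + a"] Rr_commute[of 0 "r + a"] r a by simp
    then have "?k r *\<^sub>R (Rr 0 - Rr (r + a)) = r powr (-\<theta>) *\<^sub>R (Rr 0 o\<^sub>L Rr (r + a))"
      using r a by simp
    then show "Rr 0 o\<^sub>L (r powr (-\<theta>) *\<^sub>R Rr (r + a)) = ?k r *\<^sub>R Rr 0 - ?E r"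
      by (simp only: comp.scaleR_right scaleR_diff_right)
  qed
  also have "\<dots> = integral {0..} ?k *\<^sub>R Rr 0 - integral {0..} ?E"
    unfolding k'(2)[symmetric] by (rule integral_diff[OF k'(1) E(1)])
  finally show ?thesis using E(2) by simp
qed

text \<open>
  The product \<open>F(a) = Q\<^sub>\<gamma>(a) Q\<^bsub>1-\<gamma>\<^esub>(a)\<close> satisfies \<open>F' = - R(a) F\<close>, the equation of \<open>R(a)\<close> itself; hence
  \<open>A\<^sup>-\<^sup>1 (a + A) F(a) = F(a) + a A\<^sup>-\<^sup>1 F(a)\<close> is constant. As \<open>a \<rightarrow> \<infinity>\<close>, the first summand tends to \<open>0\<close> and the second one
  approaches scalar multiples of \<open>A\<^sup>-\<^sup>1\<close> whose coefficients stay in a compact subset of \<open>(0, \<infinity>)\<close>.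
\<close>

theorem Q_product:
  assumes \<gamma>: "0 < \<gamma>" "\<gamma> < 1"
  obtains \<kappa> where "0 < \<kappa>" "Q \<gamma> 0 o\<^sub>L Q (1 - \<gamma>) 0 = \<kappa> *\<^sub>R R 0"
proof -
  define \<delta> where "\<delta> = 1 - \<gamma>"
  have \<delta>: "0 < \<delta>" "\<delta> < 1" using \<gamma> by (auto simp: \<delta>_def)
  define F where "F a = (Q \<gamma> a o\<^sub>L Q \<delta> a)" for a
  define H where "H a = F a + a *\<^sub>R (Rr 0 o\<^sub>L F a)" for a
  have F': "(F has_vector_derivative - (Rr a o\<^sub>L F a)) (at a within {0..})" if a: "a \<ge> 0" for a
  proof -
    have "(F has_vector_derivative (Q \<gamma> a o\<^sub>L (- (\<delta> *\<^sub>R (Rr a o\<^sub>L Q \<delta> a)))) + ((- (\<gamma> *\<^sub>R (Rr a o\<^sub>L Q \<gamma> a))) o\<^sub>L Q \<delta> a)) (at a within {0..})"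
      unfolding F_def using a
      by (intro bounded_bilinear.has_vector_derivative[OF bounded_bilinear_blinfun_compose]
          Q_has_vector_derivative \<gamma> \<delta>)
    moreover have "Q \<gamma> a o\<^sub>L (Rr a o\<^sub>L Q \<delta> a) = Rr a o\<^sub>L F a"
      using Q_commute[OF \<gamma> a, of "of_real a"] a by (simp add: F_def Rr_def comp_assoc[symmetric])
    moreover have "(Rr a o\<^sub>L Q \<gamma> a) o\<^sub>L Q \<delta> a = Rr a o\<^sub>L F a" by (simp add: F_def comp_assoc)
    moreover have "- (\<delta> *\<^sub>R X) + - (\<gamma> *\<^sub>R X) = - X" for X :: "'a \<Rightarrow>\<^sub>L 'a"
      by (simp add: \<delta>_def algebra_simps)
    ultimately show ?thesis
      by (simp add: comp.minus_left comp.minus_right comp.scaleR_left comp.scaleR_right)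
  qed
  have H': "(H has_vector_derivative 0) (at a within {0..})" if a: "a \<in> {0..}" for a
  proof -
    have a0: "a \<ge> 0" using a by simp
    have 1: "((\<lambda>a. Rr 0 o\<^sub>L F a) has_vector_derivative Rr 0 o\<^sub>L (- (Rr a o\<^sub>L F a))) (at a within {0..})"
      by (rule bounded_linear.has_vector_derivative[OF comp.bounded_linear_right F'[OF a0]])
    have 2: "((\<lambda>a. a *\<^sub>R (Rr 0 o\<^sub>L F a)) has_vector_derivative
        a *\<^sub>R (Rr 0 o\<^sub>L (- (Rr a o\<^sub>L F a))) + 1 *\<^sub>R (Rr 0 o\<^sub>L F a)) (at a within {0..})"
      by (rule has_vector_derivative_scaleR[OF DERIV_ident 1])
    have "a *\<^sub>R (Rr 0 o\<^sub>L Rr a) = Rr 0 - Rr a"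
      using Rr_diff[of 0 a] Rr_commute[of 0 a] a0 by simp
    then have "(a *\<^sub>R (Rr 0 o\<^sub>L Rr a)) o\<^sub>L F a = (Rr 0 o\<^sub>L F a) - (Rr a o\<^sub>L F a)"
      by (simp add: comp.diff_left)
    then have "a *\<^sub>R (Rr 0 o\<^sub>L (- (Rr a o\<^sub>L F a))) = (Rr a o\<^sub>L F a) - (Rr 0 o\<^sub>L F a)"
      by (simp add: comp.scaleR_left comp.minus_right comp_assoc)
    then have "- (Rr a o\<^sub>L F a) + (a *\<^sub>R (Rr 0 o\<^sub>L (- (Rr a o\<^sub>L F a))) + 1 *\<^sub>R (Rr 0 o\<^sub>L F a)) = 0"
      by simp
    then show ?thesis
      unfolding H_def using has_vector_derivative_add[OF F'[OF a0] 2] by simp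
  qed
  obtain c where c: "\<And>a. a \<in> {0..} \<Longrightarrow> H a = c"
    using has_vector_derivative_zero_constant[of "{0..}" H] H' by auto
  have F0: "F 0 = F a + a *\<^sub>R (Rr 0 o\<^sub>L F a)" if "a \<ge> 0" for a
    using c[of a] c[of 0] that by (simp add: H_def)
  define K where "K \<theta> = 1 / (1 - \<theta>) + 1 / \<theta>" for \<theta> :: real
  have K: "K \<gamma> > 0" "K \<delta> > 0" using \<gamma> \<delta> by (auto simp: K_def add_pos_pos)
  define k where "k \<theta> a = integral {0..} (\<lambda>r. r powr (-\<theta>) / (r + a))" for \<theta> a :: real
  have k: "k \<theta> a \<le> a powr (-\<theta>) * K \<theta>" "a powr (-\<theta>) / 4 \<le> k \<theta> a"
    if "0 < \<theta>" "\<theta> < 1" "a > 0" for \<theta> a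
    using powr_transform_neg_axis[OF that] by (auto simp: k_def K_def)
  \<comment> \<open>Each of the three error terms in the limit \<open>a \<rightarrow> \<infinity>\<close> carries this factor.\<close>
  have aa: "a powr (-\<gamma>) * a powr (-\<delta>) = 1 / a" if "a > 0" for a
    using that powr_add[of a "-\<gamma>" "-\<delta>"] by (simp add: \<delta>_def powr_minus inverse_eq_divide)
  define \<kappa> where "\<kappa> a = a * k \<gamma> a * k \<delta> a" for a
  have \<kappa>: "\<kappa> a \<in> {1/16..K \<gamma> * K \<delta>}" if a: "a > 0" for a
  proof -
    have "a * ((a powr (-\<gamma>) / 4) * (a powr (-\<delta>) / 4)) \<le> a * (k \<gamma> a * k \<delta> a)"
      using a by (intro mult_left_mono mult_mono k \<gamma> \<delta> order_trans[OF _ k(2)]) auto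
    moreover have "a * (k \<gamma> a * k \<delta> a) \<le> a * ((a powr (-\<gamma>) * K \<gamma>) * (a powr (-\<delta>) * K \<delta>))"
      using a K by (intro mult_left_mono mult_mono k \<gamma> \<delta> order_trans[OF _ k(2)]) auto
    moreover have "a * ((a powr (-\<gamma>) / 4) * (a powr (-\<delta>) / 4)) = 1 / 16"
      "a * ((a powr (-\<gamma>) * K \<gamma>) * (a powr (-\<delta>) * K \<delta>)) = K \<gamma> * K \<delta>"
    proof -
      have e: "a * (a powr (-\<gamma>) * a powr (-\<delta>)) = 1" unfolding aa[OF a] using a by simp
      have "a * ((a powr (-\<gamma>) / 4) * (a powr (-\<delta>) / 4)) = a * (a powr (-\<gamma>) * a powr (-\<delta>)) / 16" by simp
      then show "a * ((a powr (-\<gamma>) / 4) * (a powr (-\<delta>) / 4)) = 1 / 16" by (simp only: e)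
      have "a * ((a powr (-\<gamma>) * K \<gamma>) * (a powr (-\<delta>) * K \<delta>)) = a * (a powr (-\<gamma>) * a powr (-\<delta>)) * (K \<gamma> * K \<delta>)"
        by (simp only: mult_ac)
      then show "a * ((a powr (-\<gamma>) * K \<gamma>) * (a powr (-\<delta>) * K \<delta>)) = K \<gamma> * K \<delta>" by (simp only: e mult_1)
    qed
    moreover have "\<kappa> a = a * (k \<gamma> a * k \<delta> a)" by (simp add: \<kappa>_def)
    ultimately show ?thesis by simp
  qed
  define C where "C = 3 * (M * M * (K \<gamma> * K \<delta>))"
  have est: "dist (\<kappa> a *\<^sub>R R 0) (F 0) \<le> C / a" if a: "a > 0" for a
  proof -
    define e\<gamma> where "e\<gamma> = (Rr 0 o\<^sub>L Q \<gamma> a) - k \<gamma> a *\<^sub>R Rr 0"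
    define e\<delta> where "e\<delta> = (Rr 0 o\<^sub>L Q \<delta> a) - k \<delta> a *\<^sub>R Rr 0"
    have n: "norm e\<gamma> \<le> M / a * (a powr (-\<gamma>) * K \<gamma>)" "norm e\<delta> \<le> M / a * (a powr (-\<delta>) * K \<delta>)"
      "norm (Q \<gamma> a) \<le> M * (a powr (-\<gamma>) * K \<gamma>)" "norm (Q \<delta> a) \<le> M * (a powr (-\<delta>) * K \<delta>)"
      unfolding e\<gamma>_def e\<delta>_def k_def K_def by (intro Rr_Q_asymptotic Q_decay \<gamma> \<delta> a)+
    have q: "Rr 0 o\<^sub>L Q \<gamma> a = k \<gamma> a *\<^sub>R Rr 0 + e\<gamma>" "Rr 0 o\<^sub>L Q \<delta> a = k \<delta> a *\<^sub>R Rr 0 + e\<delta>"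
      by (simp_all add: e\<gamma>_def e\<delta>_def)
    have "Rr 0 o\<^sub>L F a = (Rr 0 o\<^sub>L Q \<gamma> a) o\<^sub>L Q \<delta> a" by (simp add: F_def comp_assoc)
    also have "\<dots> = k \<gamma> a *\<^sub>R (k \<delta> a *\<^sub>R Rr 0 + e\<delta>) + (e\<gamma> o\<^sub>L Q \<delta> a)"
      unfolding q(1) comp.add_left comp.scaleR_left q(2) ..
    finally have "a *\<^sub>R (Rr 0 o\<^sub>L F a) = \<kappa> a *\<^sub>R Rr 0 + (a * k \<gamma> a) *\<^sub>R e\<delta> + a *\<^sub>R (e\<gamma> o\<^sub>L Q \<delta> a)"
      by (simp add: scaleR_add_right \<kappa>_def)
    then have "F 0 - \<kappa> a *\<^sub>R R 0 = F a + (a * k \<gamma> a) *\<^sub>R e\<delta> + a *\<^sub>R (e\<gamma> o\<^sub>L Q \<delta> a)"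
      using F0[of a] a by (simp add: Rr_def)
    then have "dist (\<kappa> a *\<^sub>R R 0) (F 0) = norm (F a + (a * k \<gamma> a) *\<^sub>R e\<delta> + a *\<^sub>R (e\<gamma> o\<^sub>L Q \<delta> a))"
      by (simp add: dist_norm norm_minus_commute)
    also have "\<dots> \<le> norm (F a) + norm ((a * k \<gamma> a) *\<^sub>R e\<delta>) + norm (a *\<^sub>R (e\<gamma> o\<^sub>L Q \<delta> a))"
      by (rule order_trans[OF norm_triangle_ineq add_right_mono[OF norm_triangle_ineq]])
    also have "\<dots> \<le> M * M * (K \<gamma> * K \<delta>) / a + M * M * (K \<gamma> * K \<delta>) / a + M * M * (K \<gamma> * K \<delta>) / a"
    proof (intro add_mono)
      have "norm (F a) \<le> (M * (a powr (-\<gamma>) * K \<gamma>)) * (M * (a powr (-\<delta>) * K \<delta>))"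
        unfolding F_def by (intro norm_comp_le n)
      also have "\<dots> = (a powr (-\<gamma>) * a powr (-\<delta>)) * (M * M * (K \<gamma> * K \<delta>))" by (simp add: mult_ac)
      finally show "norm (F a) \<le> M * M * (K \<gamma> * K \<delta>) / a" unfolding aa[OF a] by simp
      have k0: "0 \<le> k \<gamma> a" using k(2)[OF \<gamma> a] by (rule order_trans[rotated]) simp
      have "norm ((a * k \<gamma> a) *\<^sub>R e\<delta>) = (a * k \<gamma> a) * norm e\<delta>" using a k0 by (simp add: abs_mult)
      also have "\<dots> \<le> (a * (a powr (-\<gamma>) * K \<gamma>)) * (M / a * (a powr (-\<delta>) * K \<delta>))"
        by (intro mult_mono mult_left_mono k n \<gamma>) (use a K in auto)
      also have "\<dots> = (a powr (-\<gamma>) * a powr (-\<delta>)) * (M * (K \<gamma> * K \<delta>))" using a by (simp add: mult_ac)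
      also have "\<dots> \<le> (a powr (-\<gamma>) * a powr (-\<delta>)) * (M * (M * (K \<gamma> * K \<delta>)))"
        using M_ge_1 mult_pos_pos[OF K] by (intro mult_left_mono) (auto simp: mult_le_cancel_right1)
      finally show "norm ((a * k \<gamma> a) *\<^sub>R e\<delta>) \<le> M * M * (K \<gamma> * K \<delta>) / a" unfolding aa[OF a] by (simp add: mult_ac)
      have "norm (e\<gamma> o\<^sub>L Q \<delta> a) \<le> (M / a * (a powr (-\<gamma>) * K \<gamma>)) * (M * (a powr (-\<delta>) * K \<delta>))"
        by (intro norm_comp_le n)
      from mult_left_mono[OF this, of a]
      have "norm (a *\<^sub>R (e\<gamma> o\<^sub>L Q \<delta> a)) \<le> a * ((M / a * (a powr (-\<gamma>) * K \<gamma>)) * (M * (a powr (-\<delta>) * K \<delta>)))"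
        using a by simp
      also have "\<dots> = (a powr (-\<gamma>) * a powr (-\<delta>)) * (M * M * (K \<gamma> * K \<delta>))" using a by (simp add: mult_ac)
      finally show "norm (a *\<^sub>R (e\<gamma> o\<^sub>L Q \<delta> a)) \<le> M * M * (K \<gamma> * K \<delta>) / a" unfolding aa[OF a] by simp
    qed
    also have "\<dots> = C / a" by (simp add: C_def add_divide_distrib[symmetric])
    finally show ?thesis .
  qed
  \<comment> \<open>The operators \<open>\<kappa> a *\<^sub>R R 0\<close> converge to \<open>F 0\<close> inside a compact set of positive multiples of \<open>R 0\<close>.\<close>
  have "compact ((\<lambda>x. x *\<^sub>R R 0) ` {1/16..K \<gamma> * K \<delta>})"
    by (intro compact_continuous_image continuous_intros) auto
  then have cl: "closed ((\<lambda>x. x *\<^sub>R R 0) ` {1/16..K \<gamma> * K \<delta>})" by (rule compact_imp_closed)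
  have "F 0 \<in> (\<lambda>x. x *\<^sub>R R 0) ` {1/16..K \<gamma> * K \<delta>}"
  proof (rule closed_approachable[THEN iffD1, OF cl], intro allI impI)
    fix e :: real assume e: "0 < e"
    define a where "a = (C + 1) / e"
    have "C > 0" using K M_ge_1 by (simp add: C_def)
    then have a: "a > 0" and "C / a < e" using e by (auto simp: a_def field_simps)
    then have "dist (\<kappa> a *\<^sub>R R 0) (F 0) < e" using est[OF a] by linarith
    then show "\<exists>y\<in>(\<lambda>x. x *\<^sub>R R 0) ` {1/16..K \<gamma> * K \<delta>}. dist y (F 0) < e"
      using \<kappa>[OF a] by blast
  qed
  then obtain x where "x \<in> {1/16..K \<gamma> * K \<delta>}" "F 0 = x *\<^sub>R R 0" by blast
  then show ?thesis using that[of x] by (auto simp: F_def \<delta>_def)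
qed

section \<open>Symbols of operators along the imaginary axis\<close>

text \<open>
  The functions \<open>X(z) = F(A) R(z)\<close>, with \<open>F(A)\<close> possibly unbounded, satisfy the resolvent equation in
  this form. Both cases of the theorem are instances: \<open>F(A) = 1\<close> and \<open>F(A) = A\<^sup>\<gamma>\<close>.
\<close>

definition resolvent_like :: "(complex \<Rightarrow> 'a \<Rightarrow>\<^sub>L 'a) \<Rightarrow> bool"
  where "resolvent_like X \<longleftrightarrow>
    (\<forall>z w. Re z \<ge> 0 \<longrightarrow> Re w \<ge> 0 \<longrightarrow> X z o\<^sub>L R w = R w o\<^sub>L X z) \<and>
    (\<forall>z w. Re z \<ge> 0 \<longrightarrow> Re w \<ge> 0 \<longrightarrow> z \<noteq> w \<longrightarrow> R z o\<^sub>L X w = cop (inverse (w - z)) o\<^sub>L (X z - X w))"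

lemma resolvent_like_R: "resolvent_like R"
  unfolding resolvent_like_def using R_commute R_prod by blast

lemma partial_fractions:
  assumes X: "resolvent_like X" and zw: "Re z \<ge> 0" "Re w \<ge> 0" "z \<noteq> w"
  defines "v \<equiv> inverse (w - z)"
  shows "R z o\<^sub>L (X w o\<^sub>L R w) = (cop (v\<^sup>2) o\<^sub>L X z) - ((cop (v\<^sup>2) o\<^sub>L X w) + (cop v o\<^sub>L (X w o\<^sub>L R w)))"
proof -
  have "inverse (z - w) = - v" unfolding v_def by (metis inverse_minus_eq minus_diff_eq)
  then have "X z o\<^sub>L R w = cop (- v) o\<^sub>L (X w - X z)"
    using X zw unfolding resolvent_like_def by metis
  then have 1: "X z o\<^sub>L R w = cop v o\<^sub>L (X z - X w)"
    by (simp add: cop_minus comp.minus_left comp.diff_right)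
  have "R z o\<^sub>L (X w o\<^sub>L R w) = (R z o\<^sub>L X w) o\<^sub>L R w" by (simp add: comp_assoc)
  also have "R z o\<^sub>L X w = cop v o\<^sub>L (X z - X w)"
    using X zw unfolding resolvent_like_def v_def by blast
  also have "(cop v o\<^sub>L (X z - X w)) o\<^sub>L R w = cop v o\<^sub>L ((X z o\<^sub>L R w) - (X w o\<^sub>L R w))"
    by (simp add: comp_assoc comp.diff_left)
  also have "\<dots> = (cop v o\<^sub>L (cop v o\<^sub>L (X z - X w))) - (cop v o\<^sub>L (X w o\<^sub>L R w))"
    unfolding 1 comp.diff_right ..
  also have "cop v o\<^sub>L (cop v o\<^sub>L (X z - X w)) = (cop (v\<^sup>2) o\<^sub>L X z) - (cop (v\<^sup>2) o\<^sub>L X w)"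
    by (simp add: comp_assoc[symmetric] cop_mult power2_eq_square comp.diff_right)
  finally show ?thesis by simp
qed

text \<open>
  \<open>V\<close> acts on \<open>R(is)\<close> like a number whose modulus is comparable to \<open>h(\<bar>s\<bar>)\<close>, up to an error bounded in \<open>s\<close>.
\<close>

definition has_symbol :: "('a \<Rightarrow>\<^sub>L 'a) \<Rightarrow> (real \<Rightarrow> real) \<Rightarrow> bool"
  where "has_symbol V h \<longleftrightarrow> (\<exists>m s0 C c1 c2. 1 \<le> s0 \<and> 0 < c1 \<and> (\<forall>s. s0 \<le> \<bar>s\<bar> \<longrightarrow>
    norm ((R (\<i> * of_real s) o\<^sub>L V) - (cop (m s) o\<^sub>L R (\<i> * of_real s))) \<le> C \<and>
    c1 * h \<bar>s\<bar> \<le> cmod (m s) \<and> cmod (m s) \<le> c2 * h \<bar>s\<bar>))"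

lemma has_symbolI:
  assumes "1 \<le> s0" "0 < c1"
    and "\<And>s. s0 \<le> \<bar>s\<bar> \<Longrightarrow> norm ((R (\<i> * of_real s) o\<^sub>L V) - (cop (m s) o\<^sub>L R (\<i> * of_real s))) \<le> C"
    and "\<And>s. s0 \<le> \<bar>s\<bar> \<Longrightarrow> c1 * h \<bar>s\<bar> \<le> cmod (m s)"
    and "\<And>s. s0 \<le> \<bar>s\<bar> \<Longrightarrow> cmod (m s) \<le> c2 * h \<bar>s\<bar>"
  shows "has_symbol V h"
  unfolding has_symbol_def using assms by blast

lemma has_symbol_cong:
  assumes "has_symbol V h" "\<And>a. a \<ge> 1 \<Longrightarrow> h a = h' a"
  shows "has_symbol V h'"
proof -
  obtain m s0 C c1 c2 where *: "1 \<le> s0" "0 < c1" "\<And>s. s0 \<le> \<bar>s\<bar> \<Longrightarrow>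
    norm ((R (\<i> * of_real s) o\<^sub>L V) - (cop (m s) o\<^sub>L R (\<i> * of_real s))) \<le> C \<and>
    c1 * h \<bar>s\<bar> \<le> cmod (m s) \<and> cmod (m s) \<le> c2 * h \<bar>s\<bar>"
    using assms(1) unfolding has_symbol_def by blast
  show ?thesis
    by (rule has_symbolI[OF *(1,2), of _ m C _ c2]) (use *(1,3) assms(2) in auto)
qed

lemma has_symbol_id: "has_symbol id_blinfun (\<lambda>a. 1)"
  by (rule has_symbolI[of 1 1 _ "\<lambda>s. 1" 0 _ 1]) auto

text \<open>
  \<open>R V V' = m R V' + O(1) = m m' R + m O(1) + O(1)\<close>; the symbol of the first factor has to be bounded.
\<close>

lemma has_symbol_comp:
  assumes V: "has_symbol V h" and V': "has_symbol V' h'"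
    and h: "\<And>a. a \<ge> 1 \<Longrightarrow> 0 < h a \<and> h a \<le> B" and h': "\<And>a. a \<ge> 1 \<Longrightarrow> 0 < h' a"
  shows "has_symbol (V o\<^sub>L V') (\<lambda>a. h a * h' a)"
proof -
  obtain m s0 C c1 c2 where m: "1 \<le> s0" "0 < c1" "\<And>s. s0 \<le> \<bar>s\<bar> \<Longrightarrow>
    norm ((R (\<i> * of_real s) o\<^sub>L V) - (cop (m s) o\<^sub>L R (\<i> * of_real s))) \<le> C \<and>
    c1 * h \<bar>s\<bar> \<le> cmod (m s) \<and> cmod (m s) \<le> c2 * h \<bar>s\<bar>"
    using V unfolding has_symbol_def by blast
  obtain m' s0' C' c1' c2' where m': "1 \<le> s0'" "0 < c1'" "\<And>s. s0' \<le> \<bar>s\<bar> \<Longrightarrow>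
    norm ((R (\<i> * of_real s) o\<^sub>L V') - (cop (m' s) o\<^sub>L R (\<i> * of_real s))) \<le> C' \<and>
    c1' * h' \<bar>s\<bar> \<le> cmod (m' s) \<and> cmod (m' s) \<le> c2' * h' \<bar>s\<bar>"
    using V' unfolding has_symbol_def by blast
  show ?thesis
  proof (rule has_symbolI[of "max s0 s0'" "c1 * c1'" _ "\<lambda>s. m s * m' s" "C * norm V' + \<bar>c2\<bar> * B * C'" _ "c2 * c2'"])
    fix s assume "max s0 s0' \<le> \<bar>s\<bar>"
    then have s: "s0 \<le> \<bar>s\<bar>" "s0' \<le> \<bar>s\<bar>" "1 \<le> \<bar>s\<bar>" using m(1) by auto
    note ms = m(3)[OF s(1)] m'(3)[OF s(2)] and hs = h[OF s(3)] h'[OF s(3)]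
    let ?R = "R (\<i> * of_real s)"
    have "(?R o\<^sub>L (V o\<^sub>L V')) - (cop (m s * m' s) o\<^sub>L ?R)
      = (((?R o\<^sub>L V) - (cop (m s) o\<^sub>L ?R)) o\<^sub>L V') + (cop (m s) o\<^sub>L ((?R o\<^sub>L V') - (cop (m' s) o\<^sub>L ?R)))"
      by (simp add: comp.diff_left comp.diff_right comp_assoc cop_mult[symmetric])
    also have "norm \<dots> \<le> C * norm V' + \<bar>c2\<bar> * B * C'"
    proof (rule order_trans[OF norm_triangle_ineq add_mono])
      show "norm (((?R o\<^sub>L V) - (cop (m s) o\<^sub>L ?R)) o\<^sub>L V') \<le> C * norm V'"
        by (intro norm_comp_le) (use ms in auto)
      have "c2 * h \<bar>s\<bar> \<le> \<bar>c2\<bar> * B" using hs by (intro mult_mono) auto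
      then show "norm (cop (m s) o\<^sub>L ((?R o\<^sub>L V') - (cop (m' s) o\<^sub>L ?R))) \<le> \<bar>c2\<bar> * B * C'"
        using ms by (intro norm_comp_le order_trans[OF norm_cop_le]) auto
    qed
    finally show "norm ((?R o\<^sub>L (V o\<^sub>L V')) - (cop (m s * m' s) o\<^sub>L ?R)) \<le> C * norm V' + \<bar>c2\<bar> * B * C'" .
    have "(c1 * h \<bar>s\<bar>) * (c1' * h' \<bar>s\<bar>) \<le> cmod (m s) * cmod (m' s)"
      using ms hs m(2) m'(2) by (intro mult_mono) auto
    then show "c1 * c1' * (h \<bar>s\<bar> * h' \<bar>s\<bar>) \<le> cmod (m s * m' s)" by (simp add: norm_mult mult_ac)
    have "cmod (m s) * cmod (m' s) \<le> (c2 * h \<bar>s\<bar>) * (c2' * h' \<bar>s\<bar>)"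
      using ms hs by (intro mult_mono) (auto intro: order_trans[OF norm_ge_zero])
    then show "cmod (m s * m' s) \<le> c2 * c2' * (h \<bar>s\<bar> * h' \<bar>s\<bar>)" by (simp add: norm_mult mult_ac)
  qed (use m(1,2) m'(2) in auto)
qed

lemma has_symbol_scaleR:
  assumes V: "has_symbol V h" and k: "0 < k"
  shows "has_symbol (k *\<^sub>R V) h"
proof -
  obtain m s0 C c1 c2 where m: "1 \<le> s0" "0 < c1" "\<And>s. s0 \<le> \<bar>s\<bar> \<Longrightarrow>
    norm ((R (\<i> * of_real s) o\<^sub>L V) - (cop (m s) o\<^sub>L R (\<i> * of_real s))) \<le> C \<and>
    c1 * h \<bar>s\<bar> \<le> cmod (m s) \<and> cmod (m s) \<le> c2 * h \<bar>s\<bar>"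
    using V unfolding has_symbol_def by blast
  show ?thesis
  proof (rule has_symbolI[OF m(1), of "k * c1" _ "\<lambda>s. k *\<^sub>R m s" "k * C" _ "k * c2"])
    fix s assume s: "s0 \<le> \<bar>s\<bar>"
    let ?R = "R (\<i> * of_real s)"
    have "(?R o\<^sub>L (k *\<^sub>R V)) - (cop (k *\<^sub>R m s) o\<^sub>L ?R) = k *\<^sub>R ((?R o\<^sub>L V) - (cop (m s) o\<^sub>L ?R))"
      unfolding scaleR_cop_comp[symmetric] comp.scaleR_right scaleR_diff_right ..
    then show "norm ((?R o\<^sub>L (k *\<^sub>R V)) - (cop (k *\<^sub>R m s) o\<^sub>L ?R)) \<le> k * C"
      using m(3)[OF s] k by (simp add: mult_left_mono)
    show "k * c1 * h \<bar>s\<bar> \<le> cmod (k *\<^sub>R m s)" "cmod (k *\<^sub>R m s) \<le> k * c2 * h \<bar>s\<bar>"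
      using m(3)[OF s] k by (simp_all add: mult.assoc mult_left_mono)
  qed (use k m(2) in auto)
qed

lemma has_symbol_R0: "has_symbol (R 0) (\<lambda>a. a powr (-1))"
proof (rule has_symbolI[of 1 1 _ "\<lambda>s. inverse (- (\<i> * of_real s))" "norm (R 0)" _ 1])
  fix s :: real assume s: "1 \<le> \<bar>s\<bar>"
  let ?v = "inverse (- (\<i> * of_real s))"
  have v: "cmod ?v = \<bar>s\<bar> powr (-1)" using s by (simp add: norm_inverse norm_mult powr_minus)
  have "R (\<i> * of_real s) o\<^sub>L R 0 = cop ?v o\<^sub>L (R (\<i> * of_real s) - R 0)"
    using R_prod[of "\<i> * of_real s" 0] s by auto
  then have "(R (\<i> * of_real s) o\<^sub>L R 0) - (cop ?v o\<^sub>L R (\<i> * of_real s)) = - (cop ?v o\<^sub>L R 0)"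
    by (simp add: comp.diff_right)
  then have "norm ((R (\<i> * of_real s) o\<^sub>L R 0) - (cop ?v o\<^sub>L R (\<i> * of_real s))) = \<bar>s\<bar> powr (-1) * norm (R 0)"
    by (simp only: norm_minus_cancel norm_cop_comp v)
  also have "\<dots> \<le> 1 * norm (R 0)"
    using s by (intro mult_right_mono) (auto simp: powr_minus inverse_le_1_iff)
  finally show "norm ((R (\<i> * of_real s) o\<^sub>L R 0) - (cop ?v o\<^sub>L R (\<i> * of_real s))) \<le> norm (R 0)" by simp
  show "1 * \<bar>s\<bar> powr (-1) \<le> cmod ?v" "cmod ?v \<le> 1 * \<bar>s\<bar> powr (-1)" unfolding v by simp_all
qed auto

text \<open>
  The gain \<open>1 / \<bar>s\<bar>\<close> beyond boundedness is needed when the error is multiplied by \<open>is\<close>, in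
  \<open>has_symbol_stieltjes_op_D\<close>.
\<close>

lemma Q_symbol_error:
  assumes \<theta>: "0 < \<theta>" "\<theta> < 1" and s: "1 \<le> \<bar>s\<bar>"
  shows "norm ((R (\<i> * of_real s) o\<^sub>L Q \<theta> 0) - (cop (powr_transform \<theta> s) o\<^sub>L R (\<i> * of_real s)))
    \<le> N / \<bar>s\<bar> * (1 powr (-\<theta>) * (1 / (1 - \<theta>) + 1 / \<theta>))"
proof -
  let ?R = "R (\<i> * of_real s)"
  let ?v = "\<lambda>r. inverse (of_real r - \<i> * of_real s)"
  let ?E = "\<lambda>r. r powr (-\<theta>) *\<^sub>R (cop (?v r) o\<^sub>L Rr r)"
  have s0: "s \<noteq> 0" using s by auto
  have E: "?E integrable_on {0..}"
    "norm (integral {0..} ?E) \<le> N / \<bar>s\<bar> * (1 powr (-\<theta>) * (1 / (1 - \<theta>) + 1 / \<theta>))"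
  proof -
    have c: "continuous_on {0<..} ?E"
      using Rr_shift_continuous[of 0] ne_imaginary by (auto intro!: continuous_intros)
    have le: "norm (?E r) \<le> N / \<bar>s\<bar> * (r powr (-\<theta>) / max r 1)" if r: "r > 0" for r
    proof -
      have "norm (cop (?v r) o\<^sub>L Rr r) \<le> 1 / \<bar>s\<bar> * (N / max r 1)"
        unfolding norm_cop_comp using r s N_ge_1 by (intro mult_mono inverse_line_le Rr_bound) auto
      from mult_left_mono[OF this, of "r powr (-\<theta>)"] show ?thesis by (simp add: mult_ac)
    qed
    show "?E integrable_on {0..}"
      "norm (integral {0..} ?E) \<le> N / \<bar>s\<bar> * (1 powr (-\<theta>) * (1 / (1 - \<theta>) + 1 / \<theta>))"
      by (rule powr_dominated[OF \<theta> _ c le]; simp)+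
  qed
  note \<phi> = powr_transform_bounds(1)[OF \<theta> s0]
  note main = integral_comp_left[OF integral_cop(1)[OF \<phi>], of ?R]
  have "?R o\<^sub>L Q \<theta> 0 = integral {0..} (\<lambda>r. ?R o\<^sub>L (r powr (-\<theta>) *\<^sub>R Rr (r + 0)))"
    unfolding Q_def by (intro integral_comp_right(2)[symmetric] Q_integrable[OF \<theta>]) auto
  also have "\<dots> = integral {0..} (\<lambda>r. (cop (r powr (-\<theta>) *\<^sub>R ?v r) o\<^sub>L ?R) - ?E r)"
  proof (rule integral_cong)
    fix r :: real assume "r \<in> {0..}"
    then have "?R o\<^sub>L Rr r = cop (?v r) o\<^sub>L (?R - Rr r)"
      unfolding Rr_def using s0 by (intro R_prod) (auto simp: complex_eq_iff)
    then show "?R o\<^sub>L (r powr (-\<theta>) *\<^sub>R Rr (r + 0)) = (cop (r powr (-\<theta>) *\<^sub>R ?v r) o\<^sub>L ?R) - ?E r"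
      by (simp only: add_0_right comp.scaleR_right comp.diff_right scaleR_diff_right scaleR_cop_comp)
  qed
  also have "\<dots> = (cop (powr_transform \<theta> s) o\<^sub>L ?R) - integral {0..} ?E"
    unfolding integral_diff[OF main(1) E(1)] main(2) integral_cop(2)[OF \<phi>] powr_transform_def ..
  finally show ?thesis using E(2) by simp
qed

lemma has_symbol_Q:
  assumes \<theta>: "0 < \<theta>" "\<theta> < 1"
  shows "has_symbol (Q \<theta> 0) (\<lambda>a. a powr (-\<theta>))"
proof (rule has_symbolI[of 1 "1/4" _ "powr_transform \<theta>" "N * (1 powr (-\<theta>) * (1 / (1 - \<theta>) + 1 / \<theta>))" _ "1 / (1 - \<theta>) + 1 / \<theta>"])
  fix s :: real assume s: "1 \<le> \<bar>s\<bar>"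
  then have s0: "s \<noteq> 0" by auto
  have "N / \<bar>s\<bar> \<le> N" using s N_ge_1 by (simp add: divide_le_eq mult_le_cancel_left1)
  then have "N / \<bar>s\<bar> * (1 powr (-\<theta>) * (1 / (1 - \<theta>) + 1 / \<theta>)) \<le> N * (1 powr (-\<theta>) * (1 / (1 - \<theta>) + 1 / \<theta>))"
    using \<theta> by (intro mult_right_mono) auto
  then show "norm ((R (\<i> * of_real s) o\<^sub>L Q \<theta> 0) - (cop (powr_transform \<theta> s) o\<^sub>L R (\<i> * of_real s)))
     \<le> N * (1 powr (-\<theta>) * (1 / (1 - \<theta>) + 1 / \<theta>))"
    using Q_symbol_error[OF \<theta> s] by linarith
  show "1/4 * \<bar>s\<bar> powr (-\<theta>) \<le> cmod (powr_transform \<theta> s)"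
    "cmod (powr_transform \<theta> s) \<le> (1 / (1 - \<theta>) + 1 / \<theta>) * \<bar>s\<bar> powr (-\<theta>)"
    using powr_transform_bounds[OF \<theta> s0] by (simp_all add: mult.commute)
qed auto

text \<open>
  A multiple of \<open>A\<^sup>-\<^sup>\<delta> A R(z) = A\<^bsup>1-\<delta>\<^esup> R(z)\<close>, written through \<open>A R(z) = 1 - z R(z)\<close>.
\<close>

definition D :: "real \<Rightarrow> complex \<Rightarrow> 'a \<Rightarrow>\<^sub>L 'a"
  where "D \<delta> z = Q \<delta> 0 o\<^sub>L (id_blinfun - (cop z o\<^sub>L R z))"

lemma Q_cop:
  assumes \<theta>: "0 < \<theta>" "\<theta> < 1"
  shows "Q \<theta> 0 o\<^sub>L cop w = cop w o\<^sub>L Q \<theta> 0"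
proof -
  have i: "(\<lambda>r. r powr (-\<theta>) *\<^sub>R Rr (r + 0)) integrable_on {0..}" by (rule Q_integrable[OF \<theta>]) simp
  have "Q \<theta> 0 o\<^sub>L cop w = integral {0..} (\<lambda>r. (r powr (-\<theta>) *\<^sub>R Rr (r + 0)) o\<^sub>L cop w)"
    unfolding Q_def by (rule integral_comp_left(2)[symmetric, OF i])
  also have "\<dots> = integral {0..} (\<lambda>r. cop w o\<^sub>L (r powr (-\<theta>) *\<^sub>R Rr (r + 0)))"
    by (intro integral_cong) (auto simp: comp.scaleR_left comp.scaleR_right Rr_def R_cop)
  also have "\<dots> = cop w o\<^sub>L Q \<theta> 0" unfolding Q_def by (rule integral_comp_right(2)[OF i])
  finally show ?thesis .
qed

lemma D_eq:
  assumes \<delta>: "0 < \<delta>" "\<delta> < 1" and z: "Re z \<ge> 0"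
  shows "D \<delta> z = Q \<delta> 0 - (cop z o\<^sub>L (R z o\<^sub>L Q \<delta> 0))"
proof -
  have "Q \<delta> 0 o\<^sub>L (cop z o\<^sub>L R z) = cop z o\<^sub>L (Q \<delta> 0 o\<^sub>L R z)"
    by (simp add: comp_assoc[symmetric] Q_cop[OF \<delta>])
  then show ?thesis by (simp add: D_def comp.diff_right Q_commute[OF \<delta> _ z])
qed

lemma R_shift_identity:
  assumes "Re z \<ge> 0" "Re w \<ge> 0" "z \<noteq> w"
  shows "R z o\<^sub>L (id_blinfun - (cop w o\<^sub>L R w)) =
    cop (inverse (w - z)) o\<^sub>L ((id_blinfun - (cop z o\<^sub>L R z)) - (id_blinfun - (cop w o\<^sub>L R w)))"
proof -
  let ?v = "inverse (w - z)"
  have v: "?v * (w - z) = 1" using assms(3) by simp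
  then have e: "?v * w = 1 + ?v * z" by (simp add: algebra_simps)
  have "R z o\<^sub>L (id_blinfun - (cop w o\<^sub>L R w)) = R z - (cop w o\<^sub>L (R z o\<^sub>L R w))"
    by (simp add: comp.diff_right comp_assoc[symmetric] R_cop[OF assms(1)])
  also have "\<dots> = R z - ((cop (?v * w) o\<^sub>L R z) - (cop (?v * w) o\<^sub>L R w))"
    unfolding R_prod[OF assms] by (simp add: comp_assoc[symmetric] cop_mult comp.diff_right mult.commute)
  also have "\<dots> = (cop (?v * w) o\<^sub>L R w) - (cop (?v * z) o\<^sub>L R z)"
  proof -
    have "cop (?v * w) o\<^sub>L R z = R z + (cop (?v * z) o\<^sub>L R z)"
      by (simp only: e cop_add comp.add_left cop_one id_comp)
    then show ?thesis by simp
  qed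
  also have "\<dots> = cop ?v o\<^sub>L ((id_blinfun - (cop z o\<^sub>L R z)) - (id_blinfun - (cop w o\<^sub>L R w)))"
    by (simp add: comp.diff_right comp_assoc[symmetric] cop_mult)
  finally show ?thesis .
qed

lemma resolvent_like_D:
  assumes \<delta>: "0 < \<delta>" "\<delta> < 1"
  shows "resolvent_like (D \<delta>)"
  unfolding resolvent_like_def
proof safe
  fix z w assume zw: "0 \<le> Re z" "0 \<le> Re w"
  have q: "Q \<delta> 0 o\<^sub>L R u = R u o\<^sub>L Q \<delta> 0" if "Re u \<ge> 0" for u
    using that by (intro Q_commute \<delta>) auto
  let ?B = "\<lambda>z. id_blinfun - (cop z o\<^sub>L R z)"
  have b: "?B z o\<^sub>L R w = R w o\<^sub>L ?B z"
  proof -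
    have "(cop z o\<^sub>L R z) o\<^sub>L R w = R w o\<^sub>L (cop z o\<^sub>L R z)"
      by (simp add: comp_assoc R_commute[OF zw]) (simp add: comp_assoc[symmetric] R_cop[OF zw(2)])
    then show ?thesis by (simp add: comp.diff_left comp.diff_right)
  qed
  have "D \<delta> z o\<^sub>L R w = Q \<delta> 0 o\<^sub>L (R w o\<^sub>L ?B z)" by (simp add: D_def comp_assoc b)
  also have "\<dots> = R w o\<^sub>L D \<delta> z" by (simp add: D_def comp_assoc[symmetric] q[OF zw(2)])
  finally show "D \<delta> z o\<^sub>L R w = R w o\<^sub>L D \<delta> z" .
  assume ne: "z \<noteq> w"
  have "R z o\<^sub>L D \<delta> w = Q \<delta> 0 o\<^sub>L (R z o\<^sub>L ?B w)" by (simp add: D_def comp_assoc[symmetric] q[OF zw(1)])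
  also have "\<dots> = (Q \<delta> 0 o\<^sub>L cop (inverse (w - z))) o\<^sub>L (?B z - ?B w)"
    unfolding R_shift_identity[OF zw ne] comp_assoc ..
  also have "Q \<delta> 0 o\<^sub>L cop (inverse (w - z)) = cop (inverse (w - z)) o\<^sub>L Q \<delta> 0"
    by (rule Q_cop[OF \<delta>])
  finally show "R z o\<^sub>L D \<delta> w = cop (inverse (w - z)) o\<^sub>L (D \<delta> z - D \<delta> w)"
    unfolding D_def by (simp only: comp_assoc comp.diff_right)
qed

lemma D_real: "D \<delta> (of_real r) = Q \<delta> 0 o\<^sub>L (id_blinfun - r *\<^sub>R Rr r)"
  by (simp add: D_def Rr_def cop_of_real_comp)

lemma norm_id_minus: "r \<ge> 0 \<Longrightarrow> norm (id_blinfun - r *\<^sub>R Rr r) \<le> 1 + M"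
proof -
  assume r: "r \<ge> 0"
  have "r * norm (Rr r) \<le> M"
    using bound[of "of_real r"] r M_ge_1 by (cases "r = 0") (auto simp: Rr_def)
  then show ?thesis
    using norm_triangle_ineq4[of "id_blinfun :: 'a \<Rightarrow>\<^sub>L 'a" "r *\<^sub>R Rr r"] norm_blinfun_id_le[where 'a='a] r by simp
qed

lemma D_continuous: "continuous_on {0<..} (\<lambda>r. D \<delta> (of_real r))"
  unfolding D_real using Rr_shift_continuous[of 0]
  by (auto intro!: continuous_intros bounded_bilinear.continuous_on[OF bounded_bilinear_blinfun_compose])

text \<open>
  The integrand \<open>R(t) (1 - r R(r)) = (1 - t R(t)) R(r)\<close> of \<open>D\<close> is bounded by multiples of both \<open>1 / t\<close> and \<open>1 / r\<close>,
  which produces the decay \<open>r\<^sup>-\<^sup>\<delta>\<close>.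
\<close>

lemma D_bound:
  assumes \<delta>: "0 < \<delta>" "\<delta> < 1"
  obtains K where "\<And>r. r > 0 \<Longrightarrow> norm (D \<delta> (of_real r)) \<le> K * max 1 r powr (-\<delta>)"
proof -
  define K1 where "K1 = (1 + M) * M * (1 / (1 - \<delta>) + 1 / \<delta>)"
  define K2 where "K2 = norm (Q \<delta> 0) * (1 + M)"
  have K1: "K1 \<ge> 0" using \<delta> M_ge_1 by (auto simp: K1_def)
  have K2: "K2 \<ge> 0" using M_ge_1 by (auto simp: K2_def)
  have big: "norm (D \<delta> (of_real r)) \<le> K1 * r powr (-\<delta>)" if r: "r > 0" for r
  proof -
    let ?B = "id_blinfun - r *\<^sub>R Rr r"
    let ?f = "\<lambda>t. (t powr (-\<delta>) *\<^sub>R Rr (t + 0)) o\<^sub>L ?B"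
    have "D \<delta> (of_real r) = integral {0..} ?f"
      unfolding D_real Q_def by (intro integral_comp_left(2)[symmetric] Q_integrable[OF \<delta>]) simp
    also have "norm \<dots> \<le> ((1 + M) * M) * (r powr (-\<delta>) * (1 / (1 - \<delta>) + 1 / \<delta>))"
    proof (rule powr_dominated(2)[OF \<delta> r])
      show "continuous_on {0<..} ?f" using Rr_shift_continuous[of 0]
        by (auto intro!: continuous_intros bounded_bilinear.continuous_on[OF bounded_bilinear_blinfun_compose])
      fix t :: real assume t: "t > 0"
      have "norm (Rr t o\<^sub>L ?B) \<le> (M / t) * (1 + M)"
        using r t by (intro norm_comp_le Rr_le norm_id_minus) auto
      moreover have "norm (Rr t o\<^sub>L ?B) \<le> (1 + M) * (M / r)"
      proof -
        have "Rr t - Rr r = r *\<^sub>R (Rr t o\<^sub>L Rr r) - t *\<^sub>R (Rr t o\<^sub>L Rr r)"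
          using Rr_diff[of t r] Rr_commute[of r t] r t by (simp add: scaleR_diff_left)
        then have "Rr t o\<^sub>L ?B = (id_blinfun - t *\<^sub>R Rr t) o\<^sub>L Rr r"
          by (simp add: comp.diff_left comp.diff_right comp.scaleR_left comp.scaleR_right algebra_simps)
        then show ?thesis using r t by (simp only:) (intro norm_comp_le Rr_le norm_id_minus, auto)
      qed
      ultimately have "norm (Rr t o\<^sub>L ?B) \<le> (1 + M) * M / max t r"
        by (auto simp: max_def mult.commute)
      from mult_left_mono[OF this, of "t powr (-\<delta>)"]
      show "norm (?f t) \<le> (1 + M) * M * (t powr (-\<delta>) / max t r)"
        by (simp add: comp.scaleR_left mult_ac)
    qed
    finally show ?thesis by (simp add: K1_def mult_ac)
  qed
  have small: "norm (D \<delta> (of_real r)) \<le> K2" if "r > 0" for r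
    unfolding D_real K2_def using that by (intro norm_comp_le norm_id_minus) auto
  show ?thesis
  proof (rule that[of "K1 + K2"])
    fix r :: real assume r: "r > 0"
    show "norm (D \<delta> (of_real r)) \<le> (K1 + K2) * max 1 r powr (-\<delta>)"
    proof (cases "r \<le> 1")
      case True
      then have "max 1 r powr (-\<delta>) = 1" by (simp add: max_absorb1)
      then show ?thesis using small[OF r] K1 by (simp only:) simp
    next
      case False
      then have "norm (D \<delta> (of_real r)) \<le> K1 * max 1 r powr (-\<delta>)" using big[OF r] by simp
      also have "\<dots> \<le> (K1 + K2) * max 1 r powr (-\<delta>)" using K2 by (intro mult_right_mono) auto
      finally show ?thesis .
    qed
  qed
qed

text \<open>
  Statement (i) concerns large \<open>\<bar>s\<bar>\<close>; on compact pieces of the imaginary axis the resolvent is continuous.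
\<close>

lemma R_imaginary_bounded:
  obtains B where "\<And>s. \<bar>s\<bar> \<le> s1 \<Longrightarrow> norm (R (\<i> * of_real s)) \<le> B"
proof -
  let ?R = "\<lambda>s::real. R (\<i> * of_real s)"
  have diff: "norm (?R s - ?R t) \<le> \<bar>s - t\<bar> * (norm (?R t) * norm (?R s))" for s t
  proof -
    have "?R s - ?R t = cop (\<i> * of_real t - \<i> * of_real s) o\<^sub>L (?R t o\<^sub>L ?R s)"
      by (rule resolvent) auto
    moreover have "cmod (\<i> * of_real t - \<i> * of_real s) = \<bar>s - t\<bar>"
      by (simp add: right_diff_distrib[symmetric] norm_mult of_real_diff[symmetric] abs_minus_commute del: of_real_diff)
    ultimately show ?thesis
      by (simp add: norm_cop_comp mult_left_mono norm_blinfun_compose)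
  qed
  have "isCont ?R t" for t
  proof -
    \<comment> \<open>Within distance \<open>d\<close> of \<open>t\<close> the norm at most doubles, which makes the resolvent Lipschitz at \<open>t\<close>.\<close>
    define d where "d = 1 / (2 * (norm (?R t) + 1))"
    have nt: "norm (?R t) + 1 > 0" by (rule add_nonneg_pos) auto
    have d: "d > 0" using nt by (simp add: d_def)
    have two: "norm (?R s) \<le> 2 * norm (?R t)" if "\<bar>s - t\<bar> < d" for s
    proof -
      have "\<bar>s - t\<bar> * norm (?R t) \<le> d * (norm (?R t) + 1)" using that d by (intro mult_mono) auto
      also have "\<dots> = 1/2" using nt by (simp add: d_def)
      finally have "(\<bar>s - t\<bar> * norm (?R t)) * norm (?R s) \<le> 1/2 * norm (?R s)" by (intro mult_right_mono) auto
      then have "norm (?R s - ?R t) \<le> 1/2 * norm (?R s)" using diff[of s t] by (simp add: mult.assoc)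
      then show ?thesis using norm_triangle_ineq2[of "?R s" "?R t"] by linarith
    qed
    have "((\<lambda>s. \<bar>s - t\<bar> * (norm (?R t) * (2 * norm (?R t)))) \<longlongrightarrow> \<bar>t - t\<bar> * (norm (?R t) * (2 * norm (?R t)))) (at t)"
      by (intro tendsto_intros)
    then have z: "((\<lambda>s. \<bar>s - t\<bar> * (norm (?R t) * (2 * norm (?R t)))) \<longlongrightarrow> 0) (at t)" by simp
    have "((\<lambda>s. ?R s - ?R t) \<longlongrightarrow> 0) (at t)"
    proof (rule Lim_null_comparison[OF _ z])
      show "\<forall>\<^sub>F s in at t. norm (?R s - ?R t) \<le> \<bar>s - t\<bar> * (norm (?R t) * (2 * norm (?R t)))"
        unfolding eventually_at
      proof (intro exI[of _ d] conjI ballI impI)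
        fix s assume "s \<noteq> t \<and> dist s t < d"
        then have "\<bar>s - t\<bar> < d" by (simp add: dist_real_def)
        from two[OF this] show "norm (?R s - ?R t) \<le> \<bar>s - t\<bar> * (norm (?R t) * (2 * norm (?R t)))"
          by (intro order_trans[OF diff] mult_left_mono) auto
      qed (rule d)
    qed
    then show "isCont ?R t" unfolding isCont_def by (rule LIM_zero_cancel)
  qed
  then have "compact (?R ` {-s1..s1})"
    by (intro compact_continuous_image continuous_at_imp_continuous_on) auto
  then obtain B where "\<forall>x\<in>?R ` {-s1..s1}. norm x \<le> B"
    using compact_imp_bounded bounded_iff by metis
  then show ?thesis by (intro that[of B]) (auto simp: abs_le_iff)
qed

text \<open>
  From \<open>R(z) W = (1 - a R(z)) R(is) W\<close> for \<open>z = a + is\<close>, where \<open>\<parallel>a R(z)\<parallel> \<le> M\<close>.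
\<close>

lemma half_plane_bound:
  assumes W: "\<And>s. norm (R (\<i> * of_real s) o\<^sub>L W) \<le> B"
  shows "bdd_above ((\<lambda>z. norm (R z o\<^sub>L W)) ` {z. Re z > 0})"
proof (rule bdd_aboveI2)
  fix z assume "z \<in> {z. Re z > 0}"
  then have z: "Re z > 0" by simp
  let ?w = "\<i> * of_real (Im z)"
  have "?w - z = of_real (- Re z)" by (simp add: complex_eq_iff)
  then have "R z - R ?w = cop (of_real (- Re z)) o\<^sub>L (R z o\<^sub>L R ?w)"
    using resolvent[of z ?w] R_commute[of z ?w] z by simp
  then have "R z = R ?w - Re z *\<^sub>R (R z o\<^sub>L R ?w)"
    unfolding cop_of_real_comp by (simp add: algebra_simps)
  then have "R z o\<^sub>L W = (R ?w - Re z *\<^sub>R (R z o\<^sub>L R ?w)) o\<^sub>L W" by simp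
  then have "R z o\<^sub>L W = (R ?w o\<^sub>L W) - Re z *\<^sub>R (R z o\<^sub>L (R ?w o\<^sub>L W))"
    by (simp add: comp.diff_left comp.scaleR_left comp_assoc)
  then have "norm (R z o\<^sub>L W) \<le> norm (R ?w o\<^sub>L W) + norm (Re z *\<^sub>R (R z o\<^sub>L (R ?w o\<^sub>L W)))"
    by (simp only: norm_triangle_ineq4)
  also have "norm (Re z *\<^sub>R (R z o\<^sub>L (R ?w o\<^sub>L W))) \<le> Re z * (norm (R z) * B)"
    using z norm_comp_le[OF order_refl W, of "R z"] by simp
  also have "\<dots> = (Re z * norm (R z)) * B" by simp
  also have "\<dots> \<le> M * B"
    using bound[OF z] order_trans[OF norm_ge_zero W] by (rule mult_right_mono)
  finally show "norm (R z o\<^sub>L W) \<le> B + M * B" using W[of "Im z"] by linarith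
qed

text \<open>
  From \<open>R(is) W = (1 + a R(is)) R(a + is) W\<close>, with \<open>a > 0\<close> so small that \<open>a \<parallel>R(is)\<parallel> \<le> 1\<close>.
\<close>

lemma imaginary_axis_bound:
  assumes B: "\<And>z. Re z > 0 \<Longrightarrow> norm (R z o\<^sub>L W) \<le> B"
  shows "norm (R (\<i> * of_real s) o\<^sub>L W) \<le> 2 * B"
proof -
  let ?w = "\<i> * of_real s"
  define a where "a = 1 / (1 + norm (R ?w))"
  have n: "1 + norm (R ?w) > 0" by (rule add_pos_nonneg) auto
  have a: "a > 0" using n by (simp add: a_def)
  define z where "z = of_real a + ?w"
  have z: "Re z > 0" using a by (simp add: z_def)
  have "R ?w - R z = cop (of_real a) o\<^sub>L (R ?w o\<^sub>L R z)"
    using resolvent[of ?w z] R_commute[of z ?w] z by (simp add: z_def)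
  then have "R ?w = R z + a *\<^sub>R (R ?w o\<^sub>L R z)"
    unfolding cop_of_real_comp by (simp add: algebra_simps)
  then have "R ?w o\<^sub>L W = (R z + a *\<^sub>R (R ?w o\<^sub>L R z)) o\<^sub>L W" by simp
  then have "R ?w o\<^sub>L W = (R z o\<^sub>L W) + a *\<^sub>R (R ?w o\<^sub>L (R z o\<^sub>L W))"
    by (simp add: comp.add_left comp.scaleR_left comp_assoc)
  then have "norm (R ?w o\<^sub>L W) \<le> norm (R z o\<^sub>L W) + norm (a *\<^sub>R (R ?w o\<^sub>L (R z o\<^sub>L W)))"
    by (simp only: norm_triangle_ineq)
  also have "norm (a *\<^sub>R (R ?w o\<^sub>L (R z o\<^sub>L W))) \<le> a * (norm (R ?w) * B)"
    using a norm_comp_le[OF order_refl B[OF z], of "R ?w"] by simp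
  also have "\<dots> = (a * norm (R ?w)) * B" by simp
  also have "\<dots> \<le> 1 * B"
    using n order_trans[OF norm_ge_zero B[OF z]] by (intro mult_right_mono) (auto simp: a_def)
  finally show ?thesis using B[OF z] by linarith
qed

text \<open>
  For large \<open>\<bar>s\<bar>\<close> the operators \<open>R(is) W\<close> and \<open>m(s) R(is)\<close> differ by a bounded amount; the remaining \<open>s\<close> form a
  compact set, and the resolvent identity leads from the imaginary axis to the half-plane and back.
\<close>

theorem has_symbol_bounded_iff:
  assumes W: "has_symbol W h" and h: "\<And>a. a \<ge> 1 \<Longrightarrow> 0 < h a"
  shows "(\<exists>C s1. \<forall>s. s1 \<le> \<bar>s\<bar> \<longrightarrow> norm (R (\<i> * of_real s)) \<le> C / h \<bar>s\<bar>) \<longleftrightarrow>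
    bdd_above ((\<lambda>z. norm (R z o\<^sub>L W)) ` {z. Re z > 0})"
proof -
  obtain m s0 E c1 c2 where m: "1 \<le> s0" "0 < c1" "\<And>s. s0 \<le> \<bar>s\<bar> \<Longrightarrow>
    norm ((R (\<i> * of_real s) o\<^sub>L W) - (cop (m s) o\<^sub>L R (\<i> * of_real s))) \<le> E \<and>
    c1 * h \<bar>s\<bar> \<le> cmod (m s) \<and> cmod (m s) \<le> c2 * h \<bar>s\<bar>"
    using W unfolding has_symbol_def by blast
  show ?thesis
  proof
    assume "\<exists>C s1. \<forall>s. s1 \<le> \<bar>s\<bar> \<longrightarrow> norm (R (\<i> * of_real s)) \<le> C / h \<bar>s\<bar>"
    then obtain C s1 where C: "\<And>s. s1 \<le> \<bar>s\<bar> \<Longrightarrow> norm (R (\<i> * of_real s)) \<le> C / h \<bar>s\<bar>" by blast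
    obtain B where B: "\<And>s. \<bar>s\<bar> \<le> max s0 s1 \<Longrightarrow> norm (R (\<i> * of_real s)) \<le> B"
      using R_imaginary_bounded by blast
    have "norm (R (\<i> * of_real s) o\<^sub>L W) \<le> \<bar>B\<bar> * norm W + (\<bar>c2\<bar> * \<bar>C\<bar> + \<bar>E\<bar>)" for s
    proof (cases "\<bar>s\<bar> \<le> max s0 s1")
      case True
      have "norm (R (\<i> * of_real s) o\<^sub>L W) \<le> \<bar>B\<bar> * norm W"
        using B[OF True] by (intro norm_comp_le) auto
      then show ?thesis by (simp add: add_increasing2)
    next
      case False
      then have s: "s0 \<le> \<bar>s\<bar>" "s1 \<le> \<bar>s\<bar>" "1 \<le> \<bar>s\<bar>" using m(1) by auto
      let ?R = "R (\<i> * of_real s)"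
      have hs: "h \<bar>s\<bar> > 0" by (rule h[OF s(3)])
      have "cmod (m s) * norm ?R \<le> (\<bar>c2\<bar> * h \<bar>s\<bar>) * (\<bar>C\<bar> / h \<bar>s\<bar>)"
      proof (rule mult_mono)
        have "c2 * h \<bar>s\<bar> \<le> \<bar>c2\<bar> * h \<bar>s\<bar>" using hs by (intro mult_right_mono) auto
        then show "cmod (m s) \<le> \<bar>c2\<bar> * h \<bar>s\<bar>" using m(3)[OF s(1)] by linarith
        have "C / h \<bar>s\<bar> \<le> \<bar>C\<bar> / h \<bar>s\<bar>" using hs by (intro divide_right_mono) auto
        then show "norm ?R \<le> \<bar>C\<bar> / h \<bar>s\<bar>" using C[OF s(2)] by linarith
      qed (use hs in auto)
      also have "\<dots> = \<bar>c2\<bar> * \<bar>C\<bar>" using hs by simp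
      finally have "norm (cop (m s) o\<^sub>L ?R) \<le> \<bar>c2\<bar> * \<bar>C\<bar>" by (simp add: norm_cop_comp)
      moreover have "norm ((?R o\<^sub>L W) - (cop (m s) o\<^sub>L ?R)) \<le> \<bar>E\<bar>" using m(3)[OF s(1)] by linarith
      moreover have "norm (?R o\<^sub>L W) \<le> norm (cop (m s) o\<^sub>L ?R) + norm ((?R o\<^sub>L W) - (cop (m s) o\<^sub>L ?R))"
        by (rule norm_triangle_sub)
      moreover have "0 \<le> \<bar>B\<bar> * norm W" by simp
      ultimately show ?thesis by linarith
    qed
    then show "bdd_above ((\<lambda>z. norm (R z o\<^sub>L W)) ` {z. Re z > 0})" by (rule half_plane_bound)
  next
    assume "bdd_above ((\<lambda>z. norm (R z o\<^sub>L W)) ` {z. Re z > 0})"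
    then obtain B where B: "\<And>z. Re z > 0 \<Longrightarrow> norm (R z o\<^sub>L W) \<le> B"
      by (auto simp: bdd_above_def)
    show "\<exists>C s1. \<forall>s. s1 \<le> \<bar>s\<bar> \<longrightarrow> norm (R (\<i> * of_real s)) \<le> C / h \<bar>s\<bar>"
    proof (intro exI allI impI)
      fix s assume s: "s0 \<le> \<bar>s\<bar>"
      let ?R = "R (\<i> * of_real s)"
      have hs: "h \<bar>s\<bar> > 0" using h s m(1) by auto
      have "c1 * h \<bar>s\<bar> * norm ?R \<le> cmod (m s) * norm ?R"
        using m(3)[OF s] by (intro mult_right_mono) auto
      also have "\<dots> = norm (cop (m s) o\<^sub>L ?R)" by (simp add: norm_cop_comp)
      also have "\<dots> \<le> norm (?R o\<^sub>L W) + norm ((?R o\<^sub>L W) - (cop (m s) o\<^sub>L ?R))"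
        by (metis norm_minus_commute norm_triangle_sub)
      also have "\<dots> \<le> 2 * B + E"
        using imaginary_axis_bound[OF B, of s] m(3)[OF s] by (intro add_mono) auto
      finally show "norm ?R \<le> ((2 * B + E) / c1) / h \<bar>s\<bar>"
        using hs m(2) by (simp add: field_simps)
    qed
  qed
qed

lemma has_symbol_R0_power:
  assumes B: "has_symbol B (\<lambda>a. a powr (-\<theta>))"
  shows "has_symbol (((\<lambda>B. R 0 o\<^sub>L B) ^^ n) B) (\<lambda>a. a powr (- (real n + \<theta>)))"
proof (induction n)
  case 0 then show ?case using B by simp
next
  case (Suc n)
  have "has_symbol (R 0 o\<^sub>L ((\<lambda>B. R 0 o\<^sub>L B) ^^ n) B) (\<lambda>a. a powr (-1) * a powr (- (real n + \<theta>)))"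
  proof (rule has_symbol_comp[OF has_symbol_R0 Suc])
    fix a :: real assume a: "a \<ge> 1"
    then show "0 < a powr (-1) \<and> a powr (-1) \<le> 1" by (simp add: powr_minus inverse_le_1_iff)
    show "0 < a powr (- (real n + \<theta>))" using a by simp
  qed
  then have "has_symbol (R 0 o\<^sub>L ((\<lambda>B. R 0 o\<^sub>L B) ^^ n) B) (\<lambda>a. a powr (- (real (Suc n) + \<theta>)))"
    by (rule has_symbol_cong) (simp only: powr_add[symmetric], simp add: algebra_simps)
  then show ?case by simp
qed

text \<open>
  \<open>A\<^sup>-\<^sup>\<gamma> x = 0\<close> forces \<open>A\<^sup>-\<^sup>1 x = 0\<close> because \<open>A\<^sup>-\<^sup>\<gamma>\<close> is a factor of \<open>A\<^sup>-\<^sup>1\<close>.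
\<close>

lemma Q_injective:
  assumes \<gamma>: "0 < \<gamma>" "\<gamma> < 1" and x: "Q \<gamma> 0 x = 0"
  shows "x = 0"
proof -
  obtain \<kappa> where \<kappa>: "0 < \<kappa>" "Q (1 - \<gamma>) 0 o\<^sub>L Q (1 - (1 - \<gamma>)) 0 = \<kappa> *\<^sub>R R 0"
    using Q_product[of "1 - \<gamma>"] \<gamma> by auto
  have "(Q (1 - \<gamma>) 0 o\<^sub>L Q (1 - (1 - \<gamma>)) 0) x = 0" using x by (simp add: blinfun.bilinear_simps)
  then have "\<kappa> *\<^sub>R R 0 x = 0" unfolding \<kappa>(2) by (simp add: blinfun.scaleR_left)
  then show ?thesis using \<kappa>(1) inj0 by simp
qed

end

section \<open>Weighted integrals of the resolvent\<close>

locale resolvent_growth = resolvent_family R M + regular_growth g \<rho>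
  for R :: "complex \<Rightarrow> ('a::complex_banach \<Rightarrow>\<^sub>L 'a)" and M g \<rho>
begin

text \<open>
  For \<open>X = R\<close> this is \<open>S\<^sub>g(A)\<close>; for \<open>X = D \<delta>\<close> it is a multiple of the integral of \<open>g(r) A\<^bsup>1-\<delta>\<^esup> R(r)\<^sup>2\<close>.
\<close>

definition stieltjes_op :: "(complex \<Rightarrow> 'a \<Rightarrow>\<^sub>L 'a) \<Rightarrow> 'a \<Rightarrow>\<^sub>L 'a"
  where "stieltjes_op X = integral {0..} (\<lambda>r. g r *\<^sub>R (X (of_real r) o\<^sub>L Rr r))"

text \<open>
  Integrating the partial fraction decomposition of \<open>R(is) X(r) R(r)\<close> against \<open>g\<close>: the terms with \<open>X(r)\<close> are
  dominated, uniformly in \<open>\<bar>s\<bar> \<ge> 1\<close>, by \<open>g(r) (max 1 r)\<^bsup>p-1\<^esup>\<close>, which is integrable since \<open>\<rho> + p < 0\<close>.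
\<close>

lemma stieltjes_op_symbol_error:
  assumes X: "resolvent_like X" and c: "continuous_on {0<..} (\<lambda>r. X (of_real r))"
    and le: "\<And>r. r > 0 \<Longrightarrow> norm (X (of_real r)) \<le> K * max 1 r powr p"
    and p: "-1 \<le> p" "\<rho> + p < 0"
  obtains C where "\<And>s. 1 \<le> \<bar>s\<bar> \<Longrightarrow>
      norm ((R (\<i> * of_real s) o\<^sub>L stieltjes_op X) - (cop (transform s) o\<^sub>L X (\<i> * of_real s))) \<le> C"
proof -
  have p1: "\<rho> + (p - 1) < -1" using p by simp
  have K: "K \<ge> 0" using order_trans[OF norm_ge_zero le, of 1] by simp
  have N: "N \<ge> 0" using N_ge_1 by simp
  note cont = Rr_shift_continuous[of 0, simplified] c bounded_bilinear.continuous_on[OF bounded_bilinear_blinfun_compose]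
  have Rr': "norm (Rr r) \<le> N * max 1 r powr (-1)" if "r > 0" for r
    using Rr_bound[of r] that by (simp add: powr_minus divide_inverse max.commute)
  have mm: "max 1 r powr p * max 1 r powr (-1) = max 1 r powr (p - 1)" for r :: real
    by (simp only: powr_add[symmetric]) simp
  have XR: "norm (X (of_real r) o\<^sub>L Rr r) \<le> K * N * max 1 r powr (p - 1)" if "r > 0" for r
    using norm_comp_le[OF le[OF that] Rr'[OF that]] unfolding mm[symmetric] by (simp add: mult_ac)
  have i0: "(\<lambda>r. g r *\<^sub>R (X (of_real r) o\<^sub>L Rr r)) integrable_on {0..}"
    by (rule growth_dominated(1)[OF p1 _ XR]) (auto intro!: cont)
  show ?thesis
  proof (rule that)
    fix s :: real assume s: "1 \<le> \<bar>s\<bar>"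
    let ?R = "R (\<i> * of_real s)"
    let ?v = "\<lambda>r. inverse (of_real r - \<i> * of_real s)"
    let ?E = "\<lambda>r. (cop ((?v r)\<^sup>2) o\<^sub>L X (of_real r)) + (cop (?v r) o\<^sub>L (X (of_real r) o\<^sub>L Rr r))"
    have cE: "continuous_on {0<..} ?E"
      using ne_imaginary by (auto intro!: continuous_intros cont)
    have E: "norm (?E r) \<le> (K + K * N) * max 1 r powr (p - 1)" if r: "r > 0" for r
    proof -
      have v: "cmod (?v r) \<le> max 1 r powr (-1)" "cmod (?v r) \<le> 1"
        using inverse_line_le(1,2)[of r s] r s by auto
      have "cmod ((?v r)\<^sup>2) = cmod (?v r) * cmod (?v r)" by (simp add: power2_eq_square norm_mult)
      also have "\<dots> \<le> max 1 r powr (-1) * 1" by (intro mult_mono v) auto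
      finally have "norm (cop ((?v r)\<^sup>2) o\<^sub>L X (of_real r)) \<le> max 1 r powr (-1) * (K * max 1 r powr p)"
        unfolding norm_cop_comp using le[OF r] by (intro mult_mono) auto
      also have "\<dots> = K * max 1 r powr (p - 1)" unfolding mm[symmetric] by (simp add: mult_ac)
      finally have 1: "norm (cop ((?v r)\<^sup>2) o\<^sub>L X (of_real r)) \<le> K * max 1 r powr (p - 1)" .
      have "norm (cop (?v r) o\<^sub>L (X (of_real r) o\<^sub>L Rr r)) \<le> 1 * (K * N * max 1 r powr (p - 1))"
        unfolding norm_cop_comp using XR[OF r] v(2) by (intro mult_mono) auto
      then show ?thesis unfolding distrib_right using 1
        by (intro order_trans[OF norm_triangle_ineq add_mono]) auto
    qed
    note iE = growth_dominated[OF p1 cE E]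
    note it = transform_integrable(1)[OF s]
    note im = integral_comp_left[OF integral_cop(1)[OF it], of "X (\<i> * of_real s)"]
    have "?R o\<^sub>L stieltjes_op X = integral {0..} (\<lambda>r. ?R o\<^sub>L (g r *\<^sub>R (X (of_real r) o\<^sub>L Rr r)))"
      unfolding stieltjes_op_def by (rule integral_comp_right(2)[symmetric, OF i0])
    also have "\<dots> = integral {0..} (\<lambda>r. (cop (g r *\<^sub>R (?v r)\<^sup>2) o\<^sub>L X (\<i> * of_real s)) - g r *\<^sub>R ?E r)"
    proof (rule integral_cong)
      fix r :: real assume "r \<in> {0..}"
      then have "?R o\<^sub>L (X (of_real r) o\<^sub>L Rr r) = (cop ((?v r)\<^sup>2) o\<^sub>L X (\<i> * of_real s)) - ?E r"
        unfolding Rr_def using s by (intro partial_fractions[OF X]) (auto simp: complex_eq_iff)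
      then show "?R o\<^sub>L (g r *\<^sub>R (X (of_real r) o\<^sub>L Rr r))
          = (cop (g r *\<^sub>R (?v r)\<^sup>2) o\<^sub>L X (\<i> * of_real s)) - g r *\<^sub>R ?E r"
        by (simp only: comp.scaleR_right scaleR_diff_right scaleR_cop_comp)
    qed
    also have "\<dots> = (cop (transform s) o\<^sub>L X (\<i> * of_real s)) - integral {0..} (\<lambda>r. g r *\<^sub>R ?E r)"
    proof -
      have "integral {0..} (\<lambda>r. (cop (g r *\<^sub>R (?v r)\<^sup>2) o\<^sub>L X (\<i> * of_real s)) - g r *\<^sub>R ?E r)
        = integral {0..} (\<lambda>r. cop (g r *\<^sub>R (?v r)\<^sup>2) o\<^sub>L X (\<i> * of_real s)) - integral {0..} (\<lambda>r. g r *\<^sub>R ?E r)"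
        by (rule integral_diff[OF im(1) iE(1)])
      then show ?thesis by (simp only: im(2) integral_cop(2)[OF it] transform_def)
    qed
    finally show "norm ((?R o\<^sub>L stieltjes_op X) - (cop (transform s) o\<^sub>L X (\<i> * of_real s)))
        \<le> (K + K * N) * integral {0..} (\<lambda>r. g r * max 1 r powr (p - 1))"
      using iE(2) by simp
  qed
qed

lemma has_symbol_stieltjes_op: "has_symbol (stieltjes_op R) (\<lambda>a. g a / a)"
proof -
  have "norm (R (of_real r)) \<le> N * max 1 r powr (-1)" if "r > 0" for r
    using Rr_bound[of r] that by (simp add: Rr_def powr_minus divide_inverse max.commute)
  then obtain C where C: "\<And>s. 1 \<le> \<bar>s\<bar> \<Longrightarrow>
      norm ((R (\<i> * of_real s) o\<^sub>L stieltjes_op R) - (cop (transform s) o\<^sub>L R (\<i> * of_real s))) \<le> C"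
    using stieltjes_op_symbol_error[OF resolvent_like_R, of N "-1"] \<rho> Rr_shift_continuous[of 0] by (auto simp: Rr_def)
  obtain r0 c2 where r0: "1 \<le> r0" "\<And>s. r0 \<le> \<bar>s\<bar> \<Longrightarrow> cmod (transform s) \<le> c2 * (g \<bar>s\<bar> / \<bar>s\<bar>)"
    using transform_upper by metis
  show ?thesis
    by (rule has_symbolI[OF r0(1), of "2/25" _ transform C _ c2])
      (use r0 C transform_lower in auto)
qed

text \<open>
  Since \<open>D(is) = Q\<^sub>\<delta> - is R(is) Q\<^sub>\<delta>\<close>, the symbol of \<open>Q\<^sub>\<delta>\<close> enters once more and contributes \<open>\<bar>s\<bar> \<bar>s\<bar>\<^sup>-\<^sup>\<delta>\<close>.
\<close>

lemma has_symbol_stieltjes_op_D: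
  assumes \<delta>: "0 < \<delta>" "\<delta> < 1" "\<rho> < \<delta>"
  shows "has_symbol (stieltjes_op (D \<delta>)) (\<lambda>a. a powr (1 - \<delta>) * (g a / a))"
proof -
  obtain K where K: "\<And>r. r > 0 \<Longrightarrow> norm (D \<delta> (of_real r)) \<le> K * max 1 r powr (-\<delta>)"
    using D_bound[OF \<delta>(1,2)] by blast
  obtain C where C: "\<And>s. 1 \<le> \<bar>s\<bar> \<Longrightarrow>
      norm ((R (\<i> * of_real s) o\<^sub>L stieltjes_op (D \<delta>)) - (cop (transform s) o\<^sub>L D \<delta> (\<i> * of_real s))) \<le> C"
    using stieltjes_op_symbol_error[OF resolvent_like_D[OF \<delta>(1,2)] D_continuous K] \<delta> by auto
  obtain r0 c2 where r0: "1 \<le> r0" "0 < c2" "\<And>s. r0 \<le> \<bar>s\<bar> \<Longrightarrow> cmod (transform s) \<le> c2 * (g \<bar>s\<bar> / \<bar>s\<bar>)"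
    using transform_upper by metis
  define J where "J = integral {0..} (\<lambda>r. g r * max 1 r powr (-2))"
  define k where "k = 1 / (1 - \<delta>) + 1 / \<delta>"
  define m where "m s = - (transform s * (\<i> * of_real s * powr_transform \<delta> s))" for s :: real
  have sp: "\<bar>s\<bar> * \<bar>s\<bar> powr (-\<delta>) = \<bar>s\<bar> powr (1 - \<delta>)" if "1 \<le> \<bar>s\<bar>" for s :: real
    using that powr_add[of "\<bar>s\<bar>" 1 "-\<delta>"] by simp
  show ?thesis
  proof (rule has_symbolI[OF r0(1), of "1/50" _ m "C + J * (norm (Q \<delta> 0) + N * k)" _ "k * c2"])
    fix s assume "r0 \<le> \<bar>s\<bar>"
    then have s: "r0 \<le> \<bar>s\<bar>" "1 \<le> \<bar>s\<bar>" "s \<noteq> 0" using r0(1) by auto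
    let ?R = "R (\<i> * of_real s)"
    let ?e = "(?R o\<^sub>L Q \<delta> 0) - (cop (powr_transform \<delta> s) o\<^sub>L ?R)"
    have e: "norm (cop (\<i> * of_real s) o\<^sub>L ?e) \<le> N * k"
    proof -
      have "norm (cop (\<i> * of_real s) o\<^sub>L ?e) \<le> \<bar>s\<bar> * (N / \<bar>s\<bar> * (1 powr (-\<delta>) * k))"
        unfolding norm_cop_comp k_def using Q_symbol_error[OF \<delta>(1,2) s(2)]
        by (intro mult_mono) (auto simp: norm_mult)
      then show ?thesis using s(3) by simp
    qed
    have "D \<delta> (\<i> * of_real s) = Q \<delta> 0 - (cop (\<i> * of_real s) o\<^sub>L (?R o\<^sub>L Q \<delta> 0))"
      by (rule D_eq[OF \<delta>(1,2)]) simp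
    then have "cop (transform s) o\<^sub>L D \<delta> (\<i> * of_real s) =
      (cop (m s) o\<^sub>L ?R) + (cop (transform s) o\<^sub>L (Q \<delta> 0 - (cop (\<i> * of_real s) o\<^sub>L ?e)))"
      by (simp add: m_def cop_minus comp.minus_left comp.diff_right comp_assoc[symmetric] cop_mult mult.assoc)
    then have "(?R o\<^sub>L stieltjes_op (D \<delta>)) - (cop (m s) o\<^sub>L ?R) =
      ((?R o\<^sub>L stieltjes_op (D \<delta>)) - (cop (transform s) o\<^sub>L D \<delta> (\<i> * of_real s)))
       + (cop (transform s) o\<^sub>L (Q \<delta> 0 - (cop (\<i> * of_real s) o\<^sub>L ?e)))" by simp
    also have "norm \<dots> \<le> C + J * (norm (Q \<delta> 0) + N * k)"
    proof (rule order_trans[OF norm_triangle_ineq add_mono])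
      show "norm ((?R o\<^sub>L stieltjes_op (D \<delta>)) - (cop (transform s) o\<^sub>L D \<delta> (\<i> * of_real s))) \<le> C" by (rule C[OF s(2)])
      have "norm (Q \<delta> 0 - (cop (\<i> * of_real s) o\<^sub>L ?e)) \<le> norm (Q \<delta> 0) + N * k"
        by (rule order_trans[OF norm_triangle_ineq4]) (use e in simp)
      then show "norm (cop (transform s) o\<^sub>L (Q \<delta> 0 - (cop (\<i> * of_real s) o\<^sub>L ?e))) \<le> J * (norm (Q \<delta> 0) + N * k)"
        unfolding norm_cop_comp J_def using transform_integrable(2)[OF s(2)]
        by (intro mult_mono) (auto intro: order_trans[OF norm_ge_zero])
    qed
    finally show "norm ((?R o\<^sub>L stieltjes_op (D \<delta>)) - (cop (m s) o\<^sub>L ?R)) \<le> C + J * (norm (Q \<delta> 0) + N * k)" .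
    have nm: "cmod (m s) = cmod (transform s) * (\<bar>s\<bar> * cmod (powr_transform \<delta> s))"
      by (simp add: m_def norm_mult)
    have g0: "g \<bar>s\<bar> / \<bar>s\<bar> > 0" using pos s by simp
    note \<phi> = powr_transform_bounds(2,3)[OF \<delta>(1,2) s(3), folded k_def]
    have "(2/25 * (g \<bar>s\<bar> / \<bar>s\<bar>)) * (\<bar>s\<bar> * (\<bar>s\<bar> powr (-\<delta>) / 4)) \<le> cmod (m s)"
      unfolding nm using transform_lower[OF s(2)] \<phi>(2) g0 by (intro mult_mono mult_left_mono) auto
    moreover have "(2/25 * (g \<bar>s\<bar> / \<bar>s\<bar>)) * (\<bar>s\<bar> * (\<bar>s\<bar> powr (-\<delta>) / 4)) = 1/50 * (\<bar>s\<bar> powr (1 - \<delta>) * (g \<bar>s\<bar> / \<bar>s\<bar>))"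
      unfolding sp[OF s(2), symmetric] by simp
    ultimately show "1/50 * (\<bar>s\<bar> powr (1 - \<delta>) * (g \<bar>s\<bar> / \<bar>s\<bar>)) \<le> cmod (m s)" by linarith
    have "cmod (m s) \<le> (c2 * (g \<bar>s\<bar> / \<bar>s\<bar>)) * (\<bar>s\<bar> * (\<bar>s\<bar> powr (-\<delta>) * k))"
      unfolding nm
      by (intro mult_mono mult_left_mono r0(3)[OF s(1)] \<phi>(1) mult_nonneg_nonneg[OF less_imp_le[OF r0(2)] less_imp_le[OF g0]]) auto
    also have "\<dots> = k * c2 * (\<bar>s\<bar> powr (1 - \<delta>) * (g \<bar>s\<bar> / \<bar>s\<bar>))"
      unfolding sp[OF s(2), symmetric] by simp
    finally show "cmod (m s) \<le> k * c2 * (\<bar>s\<bar> powr (1 - \<delta>) * (g \<bar>s\<bar> / \<bar>s\<bar>))" .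
  qed auto
qed

end

section \<open>The operator W and its symbol\<close>

lemma regular_growth_g_fun:
  assumes l: "slowly_varying l" and \<beta>: "\<beta> \<in> {0<..1}" and mono: "mono_on {0..} (g_fun \<beta> l)"
  shows "regular_growth (g_fun \<beta> l) (1 - \<beta>)"
proof
  have lpos: "l s > 0" if "s \<ge> 0" for s using l that by (simp add: slowly_varying_def)
  have g: "g_fun \<beta> l s = s powr (1 - \<beta>) * l s" if "s > 0" for s using that by (simp add: g_fun_def)
  show "g_fun \<beta> l s > 0" if "s > 0" for s using g[OF that] lpos[of s] that by simp
  have "((\<lambda>s. l (2 * s) / l s) \<longlongrightarrow> 1) at_top" using l by (simp add: slowly_varying_def)
  then have "((\<lambda>s. 2 powr (1 - \<beta>) * (l (2 * s) / l s)) \<longlongrightarrow> 2 powr (1 - \<beta>) * 1) at_top"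
    by (intro tendsto_intros)
  then have "((\<lambda>s. g_fun \<beta> l (2 * s) / g_fun \<beta> l s) \<longlongrightarrow> 2 powr (1 - \<beta>) * 1) at_top"
  proof (rule Lim_transform_eventually)
    show "\<forall>\<^sub>F s in at_top. 2 powr (1 - \<beta>) * (l (2 * s) / l s) = g_fun \<beta> l (2 * s) / g_fun \<beta> l s"
      using eventually_gt_at_top[of 0]
      by eventually_elim (simp add: g powr_mult)
  qed
  then show "((\<lambda>s. g_fun \<beta> l (2 * s) / g_fun \<beta> l s) \<longlongrightarrow> 2 powr (1 - \<beta>)) at_top" by simp
qed (use mono \<beta> in auto)

lemma bigo_at_infinity_iff:
  assumes h: "\<And>a. a \<ge> 1 \<Longrightarrow> 0 < (h a :: real)"
  shows "(f :: real \<Rightarrow> real) \<in> O[at_infinity](\<lambda>s. 1 / h \<bar>s\<bar>) \<longleftrightarrow>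
    (\<exists>C s1. \<forall>s. s1 \<le> \<bar>s\<bar> \<longrightarrow> \<bar>f s\<bar> \<le> C / h \<bar>s\<bar>)"
proof
  assume "f \<in> O[at_infinity](\<lambda>s. 1 / h \<bar>s\<bar>)"
  then obtain C s1 where C: "\<And>s. s1 \<le> \<bar>s\<bar> \<Longrightarrow> \<bar>f s\<bar> \<le> C * \<bar>1 / h \<bar>s\<bar>\<bar>"
    unfolding bigo_def eventually_at_infinity by auto
  have "\<bar>f s\<bar> \<le> C / h \<bar>s\<bar>" if "max 1 s1 \<le> \<bar>s\<bar>" for s
    using C[of s] h[of "\<bar>s\<bar>"] that by simp
  then show "\<exists>C s1. \<forall>s. s1 \<le> \<bar>s\<bar> \<longrightarrow> \<bar>f s\<bar> \<le> C / h \<bar>s\<bar>" by blast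
next
  assume "\<exists>C s1. \<forall>s. s1 \<le> \<bar>s\<bar> \<longrightarrow> \<bar>f s\<bar> \<le> C / h \<bar>s\<bar>"
  then obtain C s1 where C: "\<And>s. s1 \<le> \<bar>s\<bar> \<Longrightarrow> \<bar>f s\<bar> \<le> C / h \<bar>s\<bar>" by blast
  show "f \<in> O[at_infinity](\<lambda>s. 1 / h \<bar>s\<bar>)"
  proof (rule bigoI[of _ C], unfold eventually_at_infinity, intro exI allI impI)
    fix s :: real assume "max 1 s1 \<le> norm s"
    then show "norm (f s) \<le> C * norm (1 / h \<bar>s\<bar>)" using C[of s] h[of "\<bar>s\<bar>"] by simp
  qed
qed

text \<open>
  In the notation of graphs, \<open>op_graph C O (op_graph P)\<inverse>\<close> is \<open>P\<^sup>-\<^sup>1 C\<close>.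
\<close>

lemma bounded_op_of_comp_inverse:
  assumes "\<And>x. blinfun_apply P x = 0 \<Longrightarrow> x = 0" and "P o\<^sub>L B = C"
  shows "bounded_op_of (op_graph C O (op_graph P)\<inverse>) = B"
proof -
  have "P u = C x \<longleftrightarrow> u = B x" for u x
  proof -
    have "P u = C x \<longleftrightarrow> P (u - B x) = 0"
      using assms(2) by (auto simp: blinfun.bilinear_simps)
    also have "\<dots> \<longleftrightarrow> u = B x" using assms(1)[of "u - B x"] by (auto simp: blinfun.bilinear_simps)
    finally show ?thesis .
  qed
  then have "op_graph C O (op_graph P)\<inverse> = op_graph B"
    unfolding op_graph_def by (auto simp: relcomp_unfold) (metis)+
  then show ?thesis by simp
qed

context
  fixes A :: "('a::complex_banach \<times> 'a) set" and M :: real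
  assumes rf: "resolvent_family (shift_inv A) M"
begin

interpretation resolvent_family "shift_inv A" M by (rule rf)

lemma neg_power_eq:
  "neg_power A c = ((\<lambda>B. shift_inv A 0 o\<^sub>L B) ^^ nat \<lfloor>c\<rfloor>)
    (if frac c = 0 then id_blinfun else (sin (pi * frac c) / pi) *\<^sub>R Q (frac c) 0)"
  by (simp add: neg_power_def Q_def Rr_def)

lemma sin_frac_pos: "frac c \<noteq> 0 \<Longrightarrow> 0 < sin (pi * frac c) / pi"
  using frac_lt_1[of c] frac_ge_0[of c]
  by (intro divide_pos_pos sin_gt_zero) (auto simp: less_le)

lemma has_symbol_neg_power:
  assumes "c \<ge> 0"
  shows "has_symbol (neg_power A c) (\<lambda>a. a powr (- c))"
proof -
  let ?B = "if frac c = 0 then id_blinfun else (sin (pi * frac c) / pi) *\<^sub>R Q (frac c) 0"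
  have "has_symbol ?B (\<lambda>a. a powr (- frac c))"
  proof (cases "frac c = 0")
    case True
    have "has_symbol id_blinfun (\<lambda>a. a powr (- frac c))"
      by (rule has_symbol_cong[OF has_symbol_id]) (simp add: True)
    then show ?thesis by (subst if_P[OF True])
  next
    case False
    then have "has_symbol ((sin (pi * frac c) / pi) *\<^sub>R Q (frac c) 0) (\<lambda>a. a powr (- frac c))"
      using frac_lt_1[of c] frac_ge_0[of c]
      by (intro has_symbol_scaleR has_symbol_Q sin_frac_pos) (auto simp: less_le)
    then show ?thesis using False by simp
  qed
  from has_symbol_R0_power[OF this, of "nat \<lfloor>c\<rfloor>"]
  have "has_symbol (neg_power A c) (\<lambda>a. a powr (- (real (nat \<lfloor>c\<rfloor>) + frac c)))"
    unfolding neg_power_eq .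
  moreover have "real (nat \<lfloor>c\<rfloor>) + frac c = c" using assms by (simp add: frac_def)
  ultimately show ?thesis by simp
qed

text \<open>
  \<open>A\<^sup>\<gamma> R(s)\<^sup>2\<close> is a multiple of \<open>D(s) R(s)\<close>: by \<open>Q_product\<close>, applying \<open>A\<^sup>-\<^sup>\<gamma>\<close> to the latter gives a multiple of
  \<open>A\<^sup>-\<^sup>1 A R(s)\<^sup>2 = R(s)\<^sup>2\<close>.
\<close>

lemma bounded_op_of_power_resolvent_square:
  assumes \<gamma>: "0 < \<gamma>" "\<gamma> < 1"
  obtains k where "0 < k"
    and "\<And>s. s \<ge> 0 \<Longrightarrow> bounded_op_of (op_graph (shift_inv A (of_real s) o\<^sub>L shift_inv A (of_real s)) O op_power A \<gamma>)
      = k *\<^sub>R (D (1 - \<gamma>) (of_real s) o\<^sub>L Rr s)"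
proof -
  obtain \<kappa> where \<kappa>: "0 < \<kappa>" "Q \<gamma> 0 o\<^sub>L Q (1 - \<gamma>) 0 = \<kappa> *\<^sub>R shift_inv A 0"
    using Q_product[OF \<gamma>] by blast
  define c where "c = sin (pi * \<gamma>) / pi"
  have fl: "\<lfloor>\<gamma>\<rfloor> = 0" using \<gamma> by linarith
  then have fr: "frac \<gamma> = \<gamma>" by (simp add: frac_def)
  have c: "c > 0" using sin_frac_pos[of \<gamma>] \<gamma> by (simp add: c_def fr)
  have np: "neg_power A \<gamma> = c *\<^sub>R Q \<gamma> 0" using \<gamma> by (simp add: neg_power_eq fl fr c_def)
  show ?thesis
  proof (rule that[of "1 / (c * \<kappa>)"])
    show "0 < 1 / (c * \<kappa>)" using c \<kappa>(1) by simp
    fix s :: real assume s: "s \<ge> 0"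
    let ?B = "(1 / (c * \<kappa>)) *\<^sub>R (D (1 - \<gamma>) (of_real s) o\<^sub>L Rr s)"
    have "Rr 0 o\<^sub>L (id_blinfun - s *\<^sub>R Rr s) = Rr s"
      using Rr_diff[of 0 s] Rr_commute[of 0 s] s by (simp add: comp.diff_right comp.scaleR_right algebra_simps)
    then have R0: "shift_inv A 0 o\<^sub>L (id_blinfun - s *\<^sub>R Rr s) = Rr s" by (simp add: Rr_def)
    have "Q \<gamma> 0 o\<^sub>L (D (1 - \<gamma>) (of_real s) o\<^sub>L Rr s) = ((Q \<gamma> 0 o\<^sub>L Q (1 - \<gamma>) 0) o\<^sub>L (id_blinfun - s *\<^sub>R Rr s)) o\<^sub>L Rr s"
      unfolding D_real by (simp add: comp_assoc)
    also have "\<dots> = \<kappa> *\<^sub>R (Rr s o\<^sub>L Rr s)"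
      unfolding \<kappa>(2) comp.scaleR_left R0 ..
    finally have "neg_power A \<gamma> o\<^sub>L ?B = Rr s o\<^sub>L Rr s"
      unfolding np comp.scaleR_left comp.scaleR_right using c \<kappa>(1) by simp
    moreover have "x = 0" if "neg_power A \<gamma> x = 0" for x
      using that c Q_injective[OF \<gamma>, of x] by (simp add: np blinfun.scaleR_left)
    ultimately have "bounded_op_of (op_graph (Rr s o\<^sub>L Rr s) O (op_graph (neg_power A \<gamma>))\<inverse>) = ?B"
      by (intro bounded_op_of_comp_inverse)
    then show "bounded_op_of (op_graph (shift_inv A (of_real s) o\<^sub>L shift_inv A (of_real s)) O op_power A \<gamma>) = ?B"
      using \<gamma> by (simp add: op_power_def Rr_def)
  qed
qed

text \<open>
  In both cases the powers of \<open>a\<close> combine with \<open>g(a) / a = a\<^sup>-\<^sup>\<beta> l(a)\<close> to \<open>a\<^sup>-\<^sup>\<alpha> l(a)\<close>.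
\<close>

lemma has_symbol_W_op:
  assumes l: "slowly_varying l" and \<alpha>: "\<alpha> > 0" and \<beta>: "\<beta> \<in> {0<..1}" and mono: "mono_on {0..} (g_fun \<beta> l)"
  shows "has_symbol (W_op \<alpha> \<beta> l A) (\<lambda>a. l a / a powr \<alpha>)"
proof -
  interpret regular_growth "g_fun \<beta> l" "1 - \<beta>" by (rule regular_growth_g_fun[OF l \<beta> mono])
  interpret resolvent_growth "shift_inv A" M "g_fun \<beta> l" "1 - \<beta>" ..
  have g: "g_fun \<beta> l a / a = a powr (-\<beta>) * l a" if "a \<ge> 1" for a
    using that by (simp add: g_fun_def powr_diff powr_minus field_simps)
  have g0: "g_fun \<beta> l a / a > 0" if "a \<ge> 1" for a using pos[of a] that by simp
  show ?thesis
  proof (cases "\<alpha> \<ge> \<beta>")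
    case True
    have "S_op (g_fun \<beta> l) A = stieltjes_op (shift_inv A)"
      by (simp add: S_op_def stieltjes_op_def Rr_def)
    then have W: "W_op \<alpha> \<beta> l A = neg_power A (\<alpha> - \<beta>) o\<^sub>L stieltjes_op (shift_inv A)"
      using True by (simp add: W_op_def op_power_def)
    have "has_symbol (W_op \<alpha> \<beta> l A) (\<lambda>a. a powr (-(\<alpha> - \<beta>)) * (g_fun \<beta> l a / a))"
      unfolding W
    proof (rule has_symbol_comp[OF has_symbol_neg_power has_symbol_stieltjes_op])
      show "0 < a powr (-(\<alpha> - \<beta>)) \<and> a powr (-(\<alpha> - \<beta>)) \<le> 1" if "a \<ge> 1" for a :: real
        using that True powr_mono[of "-(\<alpha> - \<beta>)" 0 a] by simp
    qed (use True g0 in auto)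
    then show ?thesis
    proof (rule has_symbol_cong)
      fix a :: real assume a: "a \<ge> 1"
      have "a powr (-(\<alpha> - \<beta>)) * (a powr (-\<beta>) * l a) = a powr (-(\<alpha> - \<beta>) + -\<beta>) * l a"
        by (simp only: powr_add mult.assoc)
      then show "a powr (-(\<alpha> - \<beta>)) * (g_fun \<beta> l a / a) = l a / a powr \<alpha>"
        unfolding g[OF a] by (simp add: powr_minus divide_inverse mult.commute)
    qed
  next
    case False
    define \<gamma> where "\<gamma> = \<beta> - \<alpha>"
    have \<gamma>: "0 < \<gamma>" "\<gamma> < 1" using False \<alpha> \<beta> by (auto simp: \<gamma>_def)
    obtain k where k: "0 < k" "\<And>s. s \<ge> 0 \<Longrightarrow>
        bounded_op_of (op_graph (shift_inv A (of_real s) o\<^sub>L shift_inv A (of_real s)) O op_power A \<gamma>)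
        = k *\<^sub>R (D (1 - \<gamma>) (of_real s) o\<^sub>L Rr s)"
      using bounded_op_of_power_resolvent_square[OF \<gamma>] by blast
    have "W_op \<alpha> \<beta> l A = integral {0..} (\<lambda>s. k *\<^sub>R (g_fun \<beta> l s *\<^sub>R (D (1 - \<gamma>) (of_real s) o\<^sub>L Rr s)))"
      unfolding W_op_def \<gamma>_def[symmetric] using False
      by (simp only: if_False) (intro integral_cong, simp add: k(2))
    then have W: "W_op \<alpha> \<beta> l A = k *\<^sub>R stieltjes_op (D (1 - \<gamma>))"
      unfolding stieltjes_op_def by (simp only: integral_cmul)
    have "has_symbol (W_op \<alpha> \<beta> l A) (\<lambda>a. a powr (1 - (1 - \<gamma>)) * (g_fun \<beta> l a / a))"
      unfolding W using \<gamma> \<alpha> by (intro has_symbol_scaleR has_symbol_stieltjes_op_D k(1)) (auto simp: \<gamma>_def)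
    then show ?thesis
    proof (rule has_symbol_cong)
      fix a :: real assume a: "a \<ge> 1"
      have "a powr \<gamma> * (a powr (-\<beta>) * l a) = a powr (\<gamma> + -\<beta>) * l a"
        by (simp only: powr_add mult.assoc)
      moreover have "\<gamma> + -\<beta> = -\<alpha>" by (simp add: \<gamma>_def)
      ultimately have "a powr \<gamma> * (a powr (-\<beta>) * l a) = a powr (-\<alpha>) * l a" by (simp only:)
      then show "a powr (1 - (1 - \<gamma>)) * (g_fun \<beta> l a / a) = l a / a powr \<alpha>"
        unfolding g[OF a] by (simp add: powr_minus divide_inverse mult.commute)
    qed
  qed
qed

lemma bigo_resolvent_iff_W_op_bounded:
  assumes l: "slowly_varying l" and \<alpha>: "\<alpha> > 0" and \<beta>: "\<beta> \<in> {0<..1}" and mono: "mono_on {0..} (g_fun \<beta> l)"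
  shows "(\<lambda>s::real. norm (shift_inv A (\<i> * complex_of_real s)))
            \<in> O[at_infinity](\<lambda>s. \<bar>s\<bar> powr \<alpha> / l \<bar>s\<bar>)
         \<longleftrightarrow>
         bdd_above ((\<lambda>z. norm (shift_inv A z o\<^sub>L W_op \<alpha> \<beta> l A)) ` {z. Re z > 0})"
proof -
  have h: "0 < l a / a powr \<alpha>" if "a \<ge> 1" for a
    using l that by (auto simp: slowly_varying_def intro!: divide_pos_pos)
  show ?thesis
    using has_symbol_bounded_iff[OF has_symbol_W_op[OF l \<alpha> \<beta> mono] h]
      bigo_at_infinity_iff[of "\<lambda>a. l a / a powr \<alpha>" "\<lambda>s. norm (shift_inv A (\<i> * of_real s))", OF h]
    by simp
qed

end

theorem theorem5p5:
  fixes T :: "real \<Rightarrow> ('a::complex_banach \<Rightarrow>\<^sub>L 'a)"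
    and A :: "('a \<times> 'a) set"
    and l :: "real \<Rightarrow> real"
    and \<alpha> \<beta> :: real
  assumes "bounded_C0_semigroup T"
    and "op_uminus A = C0_generator T"
    and "range (\<lambda>s. \<i> * complex_of_real s) \<subseteq> resolvent_set A"
    and "slowly_varying l"
    and "\<alpha> > 0"
    and "\<beta> \<in> {0<..1}"
    and "mono_on {0..} (g_fun \<beta> l)"
  shows "(\<lambda>s::real. norm (shift_inv A (\<i> * complex_of_real s)))
            \<in> O[at_infinity](\<lambda>s. \<bar>s\<bar> powr \<alpha> / l \<bar>s\<bar>)
         \<longleftrightarrow>
         bdd_above ((\<lambda>z. norm (shift_inv A z o\<^sub>L W_op \<alpha> \<beta> l A)) ` {z. Re z > 0})"
proof -
  obtain M where "resolvent_family (shift_inv A) M"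
    using semigroup_resolvent_family[OF assms(1-3)] .
  then show ?thesis
    by (rule bigo_resolvent_iff_W_op_bounded) (rule assms)+
qed

end
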